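(* Let $G$ be a profinite group. The following conditions are equivalent: (1) the set of all commutators $\{[x,y] : x,y\in G\}$ is covered by countably many nilpotent subgroups, that is, it is contained in the union of a countable family of nilpotent subgroups of $G$; (2) the commutator subgroup $G'$ is finite-by-nilpotent, that is, $G'$ has a finite normal subgroup $K$ such that $G'/K$ is nilpotent; (3) there exists a positive integer $m$ such that $Z_m(G')$ is open in $G'$.
   Context: For $x,y\in G$, $[x,y]=x^{-1}y^{-1}xy$. $G'$ denotes the closed subgroup of $G$ generated by all commutators $[x,y]$, $x,y\in G$. $Z_m(H)$ denotes the $m$th term of the upper central series of a group $H$ ($Z_0(H)=1$ and $Z_{i+1}(H)/Z_i(H)=Z(H/Z_i(H))$). "Countably many" allows finitely many. The nilpotent subgroups in the cover need not have a common bound on their nilpotency classes. *)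

theory Defs
  imports "HOL-Analysis.Analysis" "HOL-Algebra.Algebra"
begin

definition totally_disconnected_space :: "'a topology \<Rightarrow> bool" where
  "totally_disconnected_space T \<longleftrightarrow> (\<forall>S. connectedin T S \<longrightarrow> (\<exists>a. S \<subseteq> {a}))"

locale topological_group = group G for G (structure) +
  fixes T :: "'a topology"
  assumes topspace_eq: "topspace T = carrier G"
    and continuous_mult: "continuous_map (prod_topology T T) T (\<lambda>(x, y). x \<otimes> y)"
    and continuous_inv: "continuous_map T T (\<lambda>x. inv x)"

locale profinite_group = topological_group +
  assumes compact: "compact_space T"
    and Hausdorff: "Hausdorff_space T"
    and totally_disconnected: "totally_disconnected_space T"

definition center :: "('a, 'b) monoid_scheme \<Rightarrow> 'a set" where
  "center G = {z \<in> carrier G. \<forall>x \<in> carrier G. z \<otimes>\<^bsub>G\<^esub> x = x \<otimes>\<^bsub>G\<^esub> z}"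

primrec upper_central :: "('a, 'b) monoid_scheme \<Rightarrow> nat \<Rightarrow> 'a set" where
  "upper_central G 0 = {\<one>\<^bsub>G\<^esub>}"
| "upper_central G (Suc i) =
    {x \<in> carrier G. upper_central G i #>\<^bsub>G\<^esub> x \<in> center (G Mod upper_central G i)}"

definition nilpotent_group :: "('a, 'b) monoid_scheme \<Rightarrow> bool" where
  "nilpotent_group G \<longleftrightarrow> group G \<and> (\<exists>n. upper_central G n = carrier G)"

definition finite_by_nilpotent :: "('a, 'b) monoid_scheme \<Rightarrow> bool" where
  "finite_by_nilpotent G \<longleftrightarrow> (\<exists>K. K \<lhd> G \<and> finite K \<and> nilpotent_group (G Mod K))"

(* The library's derived_set uses the other convention x y x^-1 y^-1. *)
definition commutator :: "('a, 'b) monoid_scheme \<Rightarrow> 'a \<Rightarrow> 'a \<Rightarrow> 'a" where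
  "commutator G x y = inv\<^bsub>G\<^esub> x \<otimes>\<^bsub>G\<^esub> inv\<^bsub>G\<^esub> y \<otimes>\<^bsub>G\<^esub> x \<otimes>\<^bsub>G\<^esub> y"

definition commutator_set :: "('a, 'b) monoid_scheme \<Rightarrow> 'a set" where
  "commutator_set G = {commutator G x y | x y. x \<in> carrier G \<and> y \<in> carrier G}"

definition closed_generate :: "('a, 'b) monoid_scheme \<Rightarrow> 'a topology \<Rightarrow> 'a set \<Rightarrow> 'a set" where
  "closed_generate G T S = \<Inter>{H. subgroup H G \<and> closedin T H \<and> S \<subseteq> H}"

(* Not the library's derived, which is the abstract (not topologically closed) subgroup. *)
definition closed_derived :: "('a, 'b) monoid_scheme \<Rightarrow> 'a topology \<Rightarrow> 'a set" where
  "closed_derived G T = closed_generate G T (commutator_set G)"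

end

theory Submission
  imports Defs
begin

text \<open>
  Suppose the commutators are covered by countably many nilpotent subgroups, without loss of generality closed ones.
  By Baire's theorem every pair of cosets of an open normal subgroup contains a pair \<open>(x, y)\<close> that is good for some
  smaller open normal subgroup \<open>M\<close>: all \<open>[xm, yn]\<close> with \<open>m, n \<in> M\<close> lie in one nilpotent subgroup. Goodness has three
  consequences. First, \<open>[M, M]\<close> is nilpotent. Secondly, if good pairs represent all cosets, then \<open>[M, G]\<close> acts nilpotently
  on \<open>[M, M]\<close>, and modulo the centralizer \<open>R\<close> of the resulting series the group \<open>G\<close> is central-by-finite, so that \<open>G'R/R\<close>
  is finite by Schur. Thirdly, \<open>[x, y]\<close> acts unipotently on all abelian sections of \<open>M\<close>.

  On an abelian section of a still smaller open normal subgroup \<open>U\<close>, \<open>G'\<close> therefore acts as the derived subgroup of a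
  finite group all of whose commutators are unipotent. After splitting off primes these commutators are \<open>p\<close>-elements on a
  section of exponent \<open>p\<close>. Transfer to a Sylow subgroup shows that a finite group whose commutators are \<open>p\<close>-elements has
  a \<open>p\<close>-group as derived subgroup, so \<open>G'\<close> acts nilpotently. Altogether \<open>[U, G', \<dots>, G'] = 1\<close>, hence some \<open>Z\<^sub>m(G')\<close> is
  open. Baer's theorem then makes \<open>G'\<close> finite-by-nilpotent, and the remaining implications are elementary.
\<close>

section \<open>Commutators and relative upper central series\<close>

text \<open>Baire's theorem cannot make a prescribed pair good. It only moves a pair inside cosets
  of a subgroup fixed beforehand, and pays with a smaller subgroup. Hence the three layers of the
  main argument: one pair good for \<open>M1\<close> makes all pairs inside \<open>M1\<close> good;
  pairs good for \<open>M\<close> need to represent only the cosets of \<open>M1\<close>, because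
  together with \<open>M1\<close> they generate \<open>G\<close>; pairs good for \<open>U\<close>
  represent the cosets of \<open>M\<close>, and centrality of \<open>M / R\<close> in
  \<open>G / R\<close> absorbs the remaining freedom. The nilpotency classes in the cover are
  unbounded, so each uniform bound comes from the finiteness of an index. The second obstacle is
  that the abelian sections are infinite and of arbitrary exponent. If \<open>g\<close> acts on such
  a section with \<open>(g - 1)^k = 0\<close> and period \<open>n\<close>, then every
  \<open>[v, g]\<close> is killed by \<open>n^k\<close>. One commutator step therefore leads into a
  torsion part of bounded exponent, and only there can primes be split off. All series are taken
  relative to sets of elements; their terms are closed, which permits replacing the commutators by
  the closed subgroup \<open>G'\<close> at the very end.\<close>

context group
begin

definition cj :: "'a \<Rightarrow> 'a \<Rightarrow> 'a" where
  "cj g x = inv g \<otimes> x \<otimes> g"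

abbreviation cm :: "'a \<Rightarrow> 'a \<Rightarrow> 'a" where
  "cm \<equiv> commutator G"

lemma inv_cancel_left [simp]:
  "x \<in> carrier G \<Longrightarrow> y \<in> carrier G \<Longrightarrow> inv x \<otimes> (x \<otimes> y) = y"
  "x \<in> carrier G \<Longrightarrow> y \<in> carrier G \<Longrightarrow> x \<otimes> (inv x \<otimes> y) = y"
  by (simp_all flip: m_assoc)

lemmas word_simps = cj_def commutator_def m_assoc inv_mult_group

lemma cj_closed [simp, intro]: "g \<in> carrier G \<Longrightarrow> x \<in> carrier G \<Longrightarrow> cj g x \<in> carrier G"
  by (simp add: cj_def)

lemma cm_closed [simp, intro]: "x \<in> carrier G \<Longrightarrow> y \<in> carrier G \<Longrightarrow> cm x y \<in> carrier G"
  by (simp add: commutator_def)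

lemma cj_one [simp]: "a \<in> carrier G \<Longrightarrow> cj a \<one> = \<one>"
  by (simp add: word_simps)

lemma one_cj [simp]: "a \<in> carrier G \<Longrightarrow> cj \<one> a = a"
  by (simp add: word_simps)

lemma cj_self [simp]: "a \<in> carrier G \<Longrightarrow> cj a a = a"
  by (simp add: word_simps)

lemma cm_one [simp]: "a \<in> carrier G \<Longrightarrow> cm a \<one> = \<one>" "a \<in> carrier G \<Longrightarrow> cm \<one> a = \<one>"
  by (simp_all add: word_simps)

lemma cm_self [simp]: "a \<in> carrier G \<Longrightarrow> cm a a = \<one>"
  by (simp add: word_simps)

context
  fixes a b
  assumes [simp]: "a \<in> carrier G" "b \<in> carrier G"
begin

lemma cj_inv: "cj a (inv b) = inv (cj a b)"
  by (simp add: word_simps)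

lemma cj_inv_cj [simp]: "cj a (cj (inv a) b) = b" "cj (inv a) (cj a b) = b"
  by (simp_all add: word_simps)

lemma cm_inv_left: "cm (inv a) b = cj (inv a) (inv (cm a b))"
  by (simp add: word_simps)

lemma cm_inv_right: "cm a (inv b) = cj (inv b) (inv (cm a b))"
  by (simp add: word_simps)

lemma inv_cm: "inv (cm a b) = cm b a"
  by (simp add: word_simps)

lemma cj_eq_cm: "cj b a = a \<otimes> cm a b"
  by (simp add: word_simps)

lemma cm_eq_cj: "cm a b = inv a \<otimes> cj b a"
  by (simp add: word_simps)

lemma mult_cj: "a \<otimes> cj a b = b \<otimes> a"
  by (simp add: word_simps)

end

context
  fixes a b c
  assumes [simp]: "a \<in> carrier G" "b \<in> carrier G" "c \<in> carrier G"
begin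

lemma cj_mult: "cj a (b \<otimes> c) = cj a b \<otimes> cj a c"
  by (simp add: word_simps)

lemma cj_cj: "cj a (cj b c) = cj (b \<otimes> a) c"
  by (simp add: word_simps)

lemma cm_mult_left: "cm (a \<otimes> b) c = cj b (cm a c) \<otimes> cm b c"
  by (simp add: word_simps)

lemma cm_mult_right: "cm a (b \<otimes> c) = cm a c \<otimes> cj c (cm a b)"
  by (simp add: word_simps)

lemma cj_cm: "cj c (cm a b) = cm (cj c a) (cj c b)"
  by (simp add: word_simps)

end

lemma mult_eq_cm: "a \<in> carrier G \<Longrightarrow> b \<in> carrier G \<Longrightarrow> a \<otimes> b = (b \<otimes> a) \<otimes> cm a b"
  by (simp add: word_simps)

lemma cj_eq_iff: "a \<in> carrier G \<Longrightarrow> b \<in> carrier G \<Longrightarrow> cj a b = b \<longleftrightarrow> cm b a = \<one>"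
  using l_cancel[of b "cm b a" \<one>] by (simp add: cj_eq_cm)

lemma commute_iff_cm: "a \<in> carrier G \<Longrightarrow> b \<in> carrier G \<Longrightarrow> a \<otimes> b = b \<otimes> a \<longleftrightarrow> cm a b = \<one>"
  using l_cancel[of "b \<otimes> a" "cm a b" \<one>] mult_eq_cm[of a b] by simp

lemma cj_nat_pow: "a \<in> carrier G \<Longrightarrow> b \<in> carrier G \<Longrightarrow> cj a (b [^] (n::nat)) = cj a b [^] n"
  by (induction n) (auto simp: cj_mult)

definition nrm :: "'a set \<Rightarrow> 'a set" where
  "nrm S = {g \<in> carrier G. \<forall>s\<in>S. cj g s \<in> S \<and> cj (inv g) s \<in> S}"

lemma nrm_subset: "nrm S \<subseteq> carrier G"
  by (auto simp: nrm_def)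

lemma nrmD: "g \<in> nrm S \<Longrightarrow> s \<in> S \<Longrightarrow> cj g s \<in> S"
  "g \<in> nrm S \<Longrightarrow> s \<in> S \<Longrightarrow> cj (inv g) s \<in> S"
  by (auto simp: nrm_def)

lemma nrmI: "g \<in> carrier G \<Longrightarrow> (\<And>s. s \<in> S \<Longrightarrow> cj g s \<in> S) \<Longrightarrow> (\<And>s. s \<in> S \<Longrightarrow> cj (inv g) s \<in> S) \<Longrightarrow> g \<in> nrm S"
  by (auto simp: nrm_def)

lemma subgroup_nrm:
  assumes "S \<subseteq> carrier G"
  shows "subgroup (nrm S) G"
proof (rule subgroupI)
  have "\<one> \<in> nrm S" using assms by (intro nrmI) auto
  then show "nrm S \<noteq> {}" by auto
next
  fix a assume a: "a \<in> nrm S"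
  then have "a \<in> carrier G" using nrm_subset by blast
  then show "inv a \<in> nrm S" using nrmD[OF a] by (intro nrmI) simp_all
  fix b assume b: "b \<in> nrm S"
  have c: "a \<in> carrier G" "b \<in> carrier G" using a b nrm_subset by blast+
  show "a \<otimes> b \<in> nrm S"
  proof (rule nrmI)
    fix s assume s: "s \<in> S"
    then have "s \<in> carrier G" using assms by auto
    then show "cj (a \<otimes> b) s \<in> S" "cj (inv (a \<otimes> b)) s \<in> S"
      using c nrmD(1)[OF b nrmD(1)[OF a s]] nrmD(2)[OF a nrmD(2)[OF b s]]
      by (simp_all add: cj_cj inv_mult_group)
  qed (use c in simp)
qed (fact nrm_subset)

lemma subgroup_cj: "subgroup H G \<Longrightarrow> g \<in> H \<Longrightarrow> x \<in> H \<Longrightarrow> cj g x \<in> H"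
  by (auto simp: cj_def subgroup_def)

lemma subgroup_cm: "subgroup H G \<Longrightarrow> x \<in> H \<Longrightarrow> y \<in> H \<Longrightarrow> cm x y \<in> H"
  by (auto simp: commutator_def subgroup_def)

lemma subgroup_subset_nrm: "subgroup H G \<Longrightarrow> H \<subseteq> nrm H"
  by (auto simp: nrm_def subgroup_cj subgroup.m_inv_closed subgroup.mem_carrier)

lemma normal_iff_nrm: "N \<lhd> G \<longleftrightarrow> subgroup N G \<and> nrm N = carrier G"
proof
  assume N: "N \<lhd> G"
  then interpret normal N G .
  show "subgroup N G \<and> nrm N = carrier G"
    using subgroup_axioms inv_op_closed1 inv_op_closed2 by (auto simp: nrm_def cj_def)
next
  assume *: "subgroup N G \<and> nrm N = carrier G"
  then have "g \<otimes> x \<otimes> inv g \<in> N" if "g \<in> carrier G" "x \<in> N" for g x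
    using nrmD(2)[of g N x] that by (simp add: cj_def)
  with * show "N \<lhd> G" by (auto simp: normal_inv_iff)
qed

lemma normal_cj: "N \<lhd> G \<Longrightarrow> g \<in> carrier G \<Longrightarrow> x \<in> N \<Longrightarrow> cj g x \<in> N"
  using normal_iff_nrm nrmD by blast

lemma normal_cm_left: "N \<lhd> G \<Longrightarrow> g \<in> carrier G \<Longrightarrow> x \<in> N \<Longrightarrow> cm x g \<in> N"
  by (subst cm_eq_cj)
    (auto simp: normal_cj normal_imp_subgroup subgroup.m_closed subgroup.m_inv_closed subgroup.mem_carrier[OF normal_imp_subgroup])

lemma normal_cm_right: "N \<lhd> G \<Longrightarrow> g \<in> carrier G \<Longrightarrow> x \<in> N \<Longrightarrow> cm g x \<in> N"
  using normal_cm_left[of N g x] inv_cm[of x g]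
  by (metis normal_imp_subgroup subgroup.m_inv_closed subgroup.mem_carrier)

lemma normal_carrier: "N \<lhd> G \<Longrightarrow> x \<in> N \<Longrightarrow> x \<in> carrier G"
  using normal_imp_subgroup subgroup.mem_carrier by metis

lemma normalI_cj:
  assumes "subgroup N G" "\<And>g x. g \<in> carrier G \<Longrightarrow> x \<in> N \<Longrightarrow> cj g x \<in> N"
  shows "N \<lhd> G"
proof -
  have "g \<in> nrm N" if "g \<in> carrier G" for g
    using that assms(2) by (intro nrmI) auto
  then show ?thesis
    unfolding normal_iff_nrm using assms(1) nrm_subset by blast
qed

text \<open>These \<open>g\<close> form the preimage of the centralizer of the image of
  \<open>M\<close> in \<open>G Mod R\<close>; closure under products comes from
  \<open>[m, ab] = [m, b] [m, a]^b\<close>.\<close>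

lemma subgroup_commutator_right:
  assumes R: "R \<lhd> G" and M: "M \<subseteq> carrier G"
  shows "subgroup {g \<in> carrier G. \<forall>m\<in>M. cm m g \<in> R} G"
proof (rule subgroupI)
  let ?S = "{g \<in> carrier G. \<forall>m\<in>M. cm m g \<in> R}"
  note Rs = normal_imp_subgroup[OF R]
  have "\<one> \<in> ?S" using M subgroup.one_closed[OF Rs] by auto
  then show "?S \<noteq> {}" by blast
  fix a assume a: "a \<in> ?S"
  then show "inv a \<in> ?S"
    using M subgroup.m_inv_closed[OF Rs] normal_cj[OF R, of "inv a"] by (auto simp: cm_inv_right subset_iff)
  fix b assume b: "b \<in> ?S"
  show "a \<otimes> b \<in> ?S"
    using a b M subgroup.m_closed[OF Rs] normal_cj[OF R, of b] by (auto simp: cm_mult_right subset_iff)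
qed auto

lemma commutator_left_right_eq:
  assumes R: "R \<lhd> G" and M: "M \<subseteq> carrier G"
  shows "{g \<in> carrier G. \<forall>m\<in>M. cm g m \<in> R} = {g \<in> carrier G. \<forall>m\<in>M. cm m g \<in> R}"
proof -
  have "cm y x \<in> R" if "cm x y \<in> R" "x \<in> carrier G" "y \<in> carrier G" for x y
    using subgroup.m_inv_closed[OF normal_imp_subgroup[OF R] that(1)] that(2,3) by (simp add: inv_cm)
  then show ?thesis using M by blast
qed

lemma normal_commutator_right:
  assumes R: "R \<lhd> G" and M: "M \<lhd> G"
  shows "{g \<in> carrier G. \<forall>m\<in>M. cm m g \<in> R} \<lhd> G"
proof (rule normalI_cj)
  show "subgroup {g \<in> carrier G. \<forall>m\<in>M. cm m g \<in> R} G"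
    using subgroup_commutator_right[OF R] normal_carrier[OF M] by blast
  fix g x assume g: "g \<in> carrier G" and x: "x \<in> {g \<in> carrier G. \<forall>m\<in>M. cm m g \<in> R}"
  have "cm m (cj g x) \<in> R" if m: "m \<in> M" for m
  proof -
    have "cm m (cj g x) = cj g (cm (cj (inv g) m) x)" using g x normal_carrier[OF M m] by (simp add: cj_cm)
    moreover have "cm (cj (inv g) m) x \<in> R" using x normal_cj[OF M _ m] g by simp
    ultimately show ?thesis using normal_cj[OF R g] by simp
  qed
  then show "cj g x \<in> {g \<in> carrier G. \<forall>m\<in>M. cm m g \<in> R}" using g x by simp
qed

end

text \<open>An elementwise form of \<open>[a, D, \<dots>, D] \<subseteq> B\<close>. As no subgroups are generated, it makes sense for
  arbitrary \<open>D\<close>, defines closed sets and does not change when \<open>D\<close> is replaced by its closure.\<close>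

primrec hyper :: "('a, 'b) monoid_scheme \<Rightarrow> 'a set \<Rightarrow> 'a set \<Rightarrow> 'a set \<Rightarrow> nat \<Rightarrow> 'a set" where
  "hyper G E D B 0 = B"
| "hyper G E D B (Suc i) = {a \<in> E. \<forall>d\<in>D. commutator G a d \<in> hyper G E D B i}"

context group
begin

text \<open>Conjugation by \<open>g\<close> is an automorphism preserving \<open>E\<close>,
  \<open>D\<close> and \<open>B\<close>, hence every set defined from them.\<close>

lemma nrm_hyper:
  assumes g: "g \<in> nrm E" "g \<in> nrm D" "g \<in> nrm B" and sub: "E \<subseteq> carrier G" "D \<subseteq> carrier G"
  shows "g \<in> nrm (hyper G E D B i)"
proof (induction i)
  case 0 then show ?case using g by simp
next
  case (Suc i)
  have gc: "g \<in> carrier G" using g nrm_subset by blast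
  show ?case
  proof (rule nrmI)
    fix s assume s: "s \<in> hyper G E D B (Suc i)"
    have *: "cm (cj h s) d \<in> hyper G E D B i"
      if h: "h = g \<or> h = inv g" and d: "d \<in> D" for h d
    proof -
      have hc: "h \<in> carrier G" using h gc by auto
      have dc: "cj (inv h) d \<in> D" using h gc d g nrmD[of g D d] by auto
      have sc: "s \<in> carrier G" using s sub by auto
      have "cm (cj h s) d = cj h (cm s (cj (inv h) d))"
        using hc dc sc sub d by (auto simp: cj_cm subset_iff)
      moreover have "cj h (cm s (cj (inv h) d)) \<in> hyper G E D B i"
        using s dc nrmD[OF Suc] h by auto
      ultimately show ?thesis by simp
    qed
    show "cj g s \<in> hyper G E D B (Suc i)" "cj (inv g) s \<in> hyper G E D B (Suc i)"
      using s * nrmD[OF g(1)] by auto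
  qed (fact gc)
qed

lemma hyper_subset: "B \<subseteq> E \<Longrightarrow> hyper G E D B i \<subseteq> E"
  by (cases i) auto

text \<open>Closure under products rests on \<open>[ab, d] = [a, d]^b [b, d]\<close>. The
  conjugating element \<open>b\<close> lies in \<open>E\<close>, which is why \<open>E\<close> has
  to normalize \<open>D\<close> and \<open>B\<close>.\<close>

lemma subgroup_hyper:
  assumes E: "subgroup E G" and B: "subgroup B G" "B \<subseteq> E" "E \<subseteq> nrm B" and D: "D \<subseteq> carrier G" "E \<subseteq> nrm D"
  shows "subgroup (hyper G E D B i) G"
proof (induction i)
  case 0 then show ?case using B by simp
next
  case (Suc i)
  note EC = subgroup.subset[OF E]
  have n: "e \<in> nrm (hyper G E D B i)" if "e \<in> E" for e
    using that assms subgroup_subset_nrm[OF E] by (intro nrm_hyper) (auto simp: subgroup.subset)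
  show ?case
  proof (rule subgroupI)
    show "hyper G E D B (Suc i) \<subseteq> carrier G" using EC by auto
    have "\<one> \<in> hyper G E D B (Suc i)"
      using Suc D subgroup.one_closed[OF E] by (auto simp: subset_iff subgroup.one_closed)
    then show "hyper G E D B (Suc i) \<noteq> {}" by auto
    fix a assume a: "a \<in> hyper G E D B (Suc i)"
    have ai: "inv a \<in> E" using a E by (auto simp: subgroup.m_inv_closed)
    have "cm (inv a) d \<in> hyper G E D B i" if "d \<in> D" for d
      using a that ai EC D n[OF ai] Suc
      by (auto simp: cm_inv_left subset_iff subgroup.m_inv_closed nrmD)
    then show "inv a \<in> hyper G E D B (Suc i)" using ai by simp
    fix b assume b: "b \<in> hyper G E D B (Suc i)"
    have bE: "b \<in> E" using b by simp
    have "cm (a \<otimes> b) d \<in> hyper G E D B i" if "d \<in> D" for d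
      using a b that EC D n[OF bE] Suc
      by (auto simp: cm_mult_left subset_iff subgroup.m_closed nrmD)
    then show "a \<otimes> b \<in> hyper G E D B (Suc i)" using a b E by (auto simp: subgroup.m_closed)
  qed
qed

lemma hyper_Suc_mono:
  assumes "subgroup B G" "B \<subseteq> E" "D \<subseteq> nrm B"
  shows "hyper G E D B i \<subseteq> hyper G E D B (Suc i)"
proof (induction i)
  case 0
  have "cm b d \<in> B" if "b \<in> B" "d \<in> D" for b d
    using that assms nrm_subset[of B]
    by (subst cm_eq_cj) (auto simp: subset_iff subgroup.mem_carrier subgroup.m_closed subgroup.m_inv_closed nrmD)
  then show ?case using assms by auto
next
  case (Suc i)
  then show ?case by auto
qed

lemma hyper_mono_index:
  assumes "subgroup B G" "B \<subseteq> E" "D \<subseteq> nrm B" "i \<le> j"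
  shows "hyper G E D B i \<subseteq> hyper G E D B j"
  using hyper_Suc_mono[OF assms(1-3)] assms(4) by (rule lift_Suc_mono_le)

lemma hyper_mono_base: "B \<subseteq> B' \<Longrightarrow> hyper G E D B i \<subseteq> hyper G E D B' i"
  by (induction i) auto

lemma hyper_hyper: "hyper G E D (hyper G E D B i) j = hyper G E D B (i + j)"
  by (induction j) auto

lemma hyper_antimono: "D \<subseteq> D' \<Longrightarrow> hyper G E D' B i \<subseteq> hyper G E D B i"
  by (induction i) auto

text \<open>Glues nilpotent actions on two consecutive sections; the main argument assembles the
  sections of \<open>U\<close> in this way.\<close>

lemma hyper_trans:
  "V \<subseteq> hyper G E D W i \<Longrightarrow> W \<subseteq> hyper G E D B j \<Longrightarrow> V \<subseteq> hyper G E D B (j + i)"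
  by (metis hyper_hyper hyper_mono_base order_trans)

text \<open>The counting behind Fitting's theorem on products of nilpotent normal subgroups.\<close>

lemma hyper_union:
  assumes E: "subgroup E G" and L: "L1 \<subseteq> E" "L2 \<subseteq> E" "E \<subseteq> nrm L1" "E \<subseteq> nrm L2"
  shows "hyper G E L1 {\<one>} i \<inter> hyper G E L2 {\<one>} j \<subseteq> hyper G E (L1 \<union> L2) {\<one>} (i + j)"
proof (induction "i + j" arbitrary: i j)
  case 0 then show ?case by simp
next
  case (Suc n)
  note EC = subgroup.subset[OF E]
  have sub: "subgroup (hyper G E L {\<one>} k) G" "E \<subseteq> nrm (hyper G E L {\<one>} k)"
    if "L \<subseteq> E" "E \<subseteq> nrm L" for L k
  proof -
    have 1: "E \<subseteq> nrm {\<one>}" "{\<one>} \<subseteq> E"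
      using E EC by (auto simp: subgroup.one_closed nrm_def)
    show "subgroup (hyper G E L {\<one>} k) G"
      using that EC 1 by (intro subgroup_hyper E triv_subgroup) auto
    show "E \<subseteq> nrm (hyper G E L {\<one>} k)"
    proof
      fix e assume "e \<in> E"
      then show "e \<in> nrm (hyper G E L {\<one>} k)"
        using that EC 1 subgroup_subset_nrm[OF E] by (intro nrm_hyper) blast+
    qed
  qed
  have 0: "hyper G E L {\<one>} k \<subseteq> E" for L k
    using E by (intro hyper_subset) (auto simp: subgroup.one_closed)
  \<comment> \<open>Each term is normalized by \<open>E\<close>, so commutation with any element of
    \<open>E\<close> stays inside it. A commutator with \<open>L1\<close> therefore lowers
    \<open>i\<close> while keeping \<open>j\<close>, and vice versa.\<close>
  have inv: "cm v l \<in> hyper G E L {\<one>} k" if "v \<in> hyper G E L {\<one>} k" "l \<in> E" "L \<subseteq> E" "E \<subseteq> nrm L" for v l L k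
  proof -
    have "v \<in> carrier G" "l \<in> carrier G" using that(1,2) 0 EC by blast+
    moreover have "cj l v \<in> hyper G E L {\<one>} k"
      using sub(2)[OF that(3,4)] that(1,2) by (intro nrmD) auto
    ultimately show ?thesis
      using sub(1)[OF that(3,4)] that(1)
      by (auto simp: cm_eq_cj intro: subgroup.m_closed subgroup.m_inv_closed)
  qed
  show ?case
  proof
    fix v assume v: "v \<in> hyper G E L1 {\<one>} i \<inter> hyper G E L2 {\<one>} j"
    have vE: "v \<in> E" using v 0 by blast
    have "cm v l \<in> hyper G E (L1 \<union> L2) {\<one>} n" if l: "l \<in> L1 \<union> L2" for l
    proof -
      have l_c: "l \<in> carrier G" "l \<in> E" using l L EC by auto
      have one: "\<one> \<in> hyper G E (L1 \<union> L2) {\<one>} n"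
      proof (rule subgroup.one_closed[OF sub(1)])
        show "E \<subseteq> nrm (L1 \<union> L2)" using L by (auto simp: nrm_def)
      qed (use L in auto)
      from l show ?thesis
      proof
        assume l: "l \<in> L1"
        show ?thesis
        proof (cases i)
          case 0
          then have "v = \<one>" using v by simp
          then show ?thesis using l_c one by simp
        next
          case (Suc i')
          have "cm v l \<in> hyper G E L1 {\<one>} i'" using v l Suc by simp
          moreover have "cm v l \<in> hyper G E L2 {\<one>} j"
            using v inv[OF _ l_c(2) L(2,4)] by blast
          moreover have n: "n = i' + j" using Suc.hyps(2) Suc by simp
          ultimately show ?thesis using Suc.hyps(1)[OF n] n by blast
        qed
      next
        assume l: "l \<in> L2"
        show ?thesis
        proof (cases j)
          case 0
          then have "v = \<one>" using v by simp
          then show ?thesis using l_c one by simp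
        next
          case (Suc j')
          have "cm v l \<in> hyper G E L2 {\<one>} j'" using v l Suc by simp
          moreover have "cm v l \<in> hyper G E L1 {\<one>} i"
            using v inv[OF _ l_c(2) L(1,3)] by blast
          moreover have n: "n = i + j'" using Suc.hyps(2) Suc by simp
          ultimately show ?thesis using Suc.hyps(1)[OF n] n by blast
        qed
      qed
    qed
    then show "v \<in> hyper G E (L1 \<union> L2) {\<one>} (i + j)"
      unfolding Suc.hyps(2)[symmetric] using vE by simp
  qed
qed

end

section \<open>Transfer and finite groups\<close>

text \<open>Additively \<open>\<delta> = f - 1\<close>. By induction \<open>n^k\<close> kills
  \<open>\<delta> (\<delta> v)\<close>, so \<open>f\<close> fixes \<open>n^k \<delta> v\<close> and
  \<open>f^i (n^k v) = n^k v + i n^k \<delta> v\<close>; the period \<open>i = n\<close> gives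
  \<open>n^(k+1) \<delta> v = 0\<close>.\<close>

lemma (in comm_group) unipotent_periodic_endo:
  fixes f :: "'a \<Rightarrow> 'a" and n k :: nat
  defines "\<delta> \<equiv> \<lambda>v. f v \<otimes> inv v"
  assumes f: "f \<in> hom G G"
    and per: "\<And>v. v \<in> carrier G \<Longrightarrow> (f ^^ n) v = v"
  shows "v \<in> carrier G \<Longrightarrow> (\<delta> ^^ k) v = \<one> \<Longrightarrow> \<delta> v [^] (n ^ k) = \<one>"
proof (induction k arbitrary: v)
  case 0
  interpret h: group_hom G G f using f by unfold_locales
  from 0 have "v = \<one>" by simp
  then show ?case by (simp add: \<delta>_def)
next
  case (Suc k)
  interpret h: group_hom G G f using f by unfold_locales
  let ?w = "\<delta> v" and ?N = "n ^ k"
  have wc: "?w \<in> carrier G" using Suc.prems by (simp add: \<delta>_def)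
  have "\<delta> ?w [^] ?N = \<one>"
    using Suc.IH[of ?w] Suc.prems wc by (simp add: funpow_swap1)
  then have "f ?w [^] ?N \<otimes> inv (?w [^] ?N) = \<one>"
    using wc by (simp add: \<delta>_def nat_pow_distrib nat_pow_inv)
  then have fw: "f ?w [^] ?N = ?w [^] ?N"
    using wc by (metis h.hom_closed nat_pow_closed inv_closed inv_equality inv_inv)
  have fv: "f v = v \<otimes> ?w" using Suc.prems by (simp add: \<delta>_def m_comm[of "f v"])
  have fc: "(f ^^ i) v \<in> carrier G" for i using Suc.prems by (induction i) auto
  have "((f ^^ i) v) [^] ?N = v [^] ?N \<otimes> (?w [^] ?N) [^] i" for i
  proof (induction i)
    case 0 then show ?case using Suc.prems by simp
  next
    case (Suc i)
    have "((f ^^ Suc i) v) [^] ?N = f (((f ^^ i) v) [^] ?N)" using fc by (simp add: h.hom_nat_pow)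
    also have "\<dots> = (f v [^] ?N) \<otimes> (f ?w [^] ?N) [^] i"
      using Suc.IH wc \<open>v \<in> carrier G\<close> by (simp add: h.hom_nat_pow)
    also have "\<dots> = v [^] ?N \<otimes> (?w [^] ?N) [^] Suc i"
      using \<open>v \<in> carrier G\<close> wc by (simp add: fv fw nat_pow_distrib m_ac)
    finally show ?case .
  qed
  from this[of n] have "v [^] ?N = v [^] ?N \<otimes> (?w [^] ?N) [^] n" using per Suc.prems by simp
  then have "(?w [^] ?N) [^] n = \<one>" using wc Suc.prems by (metis l_cancel nat_pow_closed one_closed r_one)
  then show ?case using wc by (simp add: nat_pow_pow mult.commute)
qed

text \<open>For prime \<open>p\<close> this reflects
  \<open>(1 + \<delta>)^(p^k) = 1 + \<delta>^(p^k)\<close>. The induction avoids binomials: for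
  \<open>g = f^(p^k)\<close> and \<open>w = g v - v\<close> the induction hypothesis makes
  \<open>g\<close> fix \<open>w\<close>, whence \<open>g^p v = v + p w = v\<close>.\<close>

lemma (in comm_group) unipotent_endo_exponent:
  fixes f :: "'a \<Rightarrow> 'a" and p k :: nat
  defines "\<delta> \<equiv> \<lambda>v. f v \<otimes> inv v"
  assumes f: "f \<in> hom G G"
    and exp: "\<And>v. v \<in> carrier G \<Longrightarrow> v [^] p = \<one>"
  shows "v \<in> carrier G \<Longrightarrow> (\<delta> ^^ k) v = \<one> \<Longrightarrow> (f ^^ (p ^ k)) v = v"
proof (induction k arbitrary: v)
  case 0
  interpret h: group_hom G G f using f by unfold_locales
  from 0 show ?case by simp
next
  case (Suc k)
  interpret h: group_hom G G f using f by unfold_locales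
  let ?g = "f ^^ (p ^ k)"
  have gh: "f ^^ i \<in> hom G G" for i
  proof (induction i)
    case (Suc i)
    then show ?case using f by (auto simp: hom_def Pi_iff)
  qed (auto simp: hom_def)
  have \<delta>c: "\<delta> u \<in> carrier G" if "u \<in> carrier G" for u using that by (simp add: \<delta>_def)
  have \<delta>cc: "(\<delta> ^^ i) u \<in> carrier G" if "u \<in> carrier G" for u i
    using that by (induction i) (auto simp: \<delta>c)
  have g\<delta>: "?g (\<delta> u) = \<delta> (?g u)" if "u \<in> carrier G" for u
  proof -
    interpret g: group_hom G G "?g" using gh by unfold_locales
    show ?thesis using that by (simp add: \<delta>_def g.hom_mult flip: funpow_swap1)
  qed
  define w where "w = ?g v \<otimes> inv v"
  have dmult: "\<delta> (a \<otimes> inv b) = \<delta> a \<otimes> inv (\<delta> b)" if "a \<in> carrier G" "b \<in> carrier G" for a b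
    using that by (simp add: \<delta>_def inv_mult_group m_ac)
  interpret g: group_hom G G "?g" using gh by unfold_locales
  \<comment> \<open>\<open>\<delta>\<close> commutes with \<open>?g\<close>, and \<open>f\<close>
    fixes \<open>(\<delta> ^^ k) v\<close>; so the case \<open>i = k\<close> yields
    \<open>(\<delta> ^^ k) w = \<one>\<close>.\<close>
  have "(\<delta> ^^ i) w = ?g ((\<delta> ^^ i) v) \<otimes> inv ((\<delta> ^^ i) v)" for i
  proof (induction i)
    case (Suc i)
    then show ?case using \<open>v \<in> carrier G\<close> g\<delta> by (simp add: dmult \<delta>cc)
  qed (simp add: w_def)
  moreover have "?g ((\<delta> ^^ k) v) = (\<delta> ^^ k) v"
  proof -
    let ?u = "(\<delta> ^^ k) v"
    have uc: "?u \<in> carrier G" using \<delta>cc Suc.prems by blast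
    have "f ?u \<otimes> inv ?u = \<one>" using Suc.prems by (simp add: \<delta>_def)
    then have "f ?u = ?u" using uc by (metis h.hom_closed inv_closed inv_equality inv_inv)
    then have "(f ^^ i) ?u = ?u" for i by (induction i) auto
    then show ?thesis .
  qed
  ultimately have "(\<delta> ^^ k) w = \<one>" using \<delta>cc Suc.prems by simp
  moreover have wc: "w \<in> carrier G" using Suc.prems by (simp add: w_def)
  ultimately have gw: "?g w = w" using Suc.IH by blast
  have gv: "?g v = v \<otimes> w" using Suc.prems by (simp add: w_def m_comm[of "?g v"])
  have "(?g ^^ i) v = v \<otimes> w [^] i" for i
  proof (induction i)
    case (Suc i)
    then show ?case using \<open>v \<in> carrier G\<close> wc gw gv by (simp add: g.hom_nat_pow m_ac)
  qed (use Suc.prems in simp)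
  from this[of p] have "(?g ^^ p) v = v" using exp wc Suc.prems by simp
  then show ?case by (simp add: funpow_mult mult.commute)
qed

section \<open>The transfer into an abelian subgroup of finite index\<close>

context group
begin

lemma m_inv_mem_if_coset:
  assumes "subgroup L G" "x \<in> carrier G" "y \<in> L #> x"
  shows "x \<otimes> inv y \<in> L" "y \<in> carrier G" "L #> y = L #> x"
proof -
  show y: "y \<in> carrier G" using assms by (meson r_coset_subset_G subgroup.subset subsetD)
  from assms show "L #> y = L #> x" using repr_independence by metis
  then have "x \<in> L #> y" using assms by (simp add: rcos_self)
  then show "x \<otimes> inv y \<in> L" using assms y by (simp add: subgroup.rcos_module_imp is_group)
qed

text \<open>Each orbit of \<open>d\<close> on the cosets contributes a conjugate of a power of \<open>d\<close> to the transfer, which by the fusion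
  hypothesis is that power itself.\<close>

theorem transfer_power:
  assumes L: "subgroup L G" and fin: "finite (rcosets L)"
    and comm: "\<And>x y. x \<in> L \<Longrightarrow> y \<in> L \<Longrightarrow> x \<otimes> y = y \<otimes> x"
    and d: "d \<in> generate G (commutator_set G)"
    and fusion: "\<And>x (j::nat). x \<in> carrier G \<Longrightarrow> x \<otimes> d [^] j \<otimes> inv x \<in> L \<Longrightarrow> x \<otimes> d [^] j \<otimes> inv x = d [^] j"
  shows "d [^] card (rcosets L) = \<one>"
proof -
  define A where "A = G\<lparr>carrier := L\<rparr>"
  have "group A" using L by (simp add: A_def subgroup.subgroup_is_group is_group)
  then interpret A: comm_group A
    by (rule group.group_comm_groupI) (use comm in \<open>simp_all add: A_def\<close>)
  have [simp]: "carrier A = L" "monoid.mult A = (\<otimes>)" "one A = \<one>" by (simp_all add: A_def)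
  note LC = subgroup.subset[OF L]
  \<comment> \<open>A transversal \<open>r\<close>, the factor \<open>t g C\<close> by which right
    multiplication by \<open>g\<close> deviates from it, and the transfer \<open>tf\<close> as the
    product of these factors in the abelian group \<open>L\<close>.\<close>
  define r where "r C = (SOME x. x \<in> C)" for C :: "'a set"
  define t where "t g C = r C \<otimes> g \<otimes> inv (r (C #> g))" for g C
  define tf where "tf g = finprod A (t g) (rcosets L)" for g
  have r: "r C \<in> carrier G" "L #> r C = C" if C: "C \<in> rcosets L" for C
  proof -
    obtain x where x: "x \<in> carrier G" "C = L #> x" using C by (auto simp: RCOSETS_def)
    then have "x \<in> C" using L by (simp add: rcos_self)
    then have "r C \<in> C" unfolding r_def by (rule someI)
    then show "r C \<in> carrier G" "L #> r C = C"
      using m_inv_mem_if_coset[OF L x(1)] x by auto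
  qed
  have shift: "C #> g \<in> rcosets L" "C #> g = L #> (r C \<otimes> g)" if "C \<in> rcosets L" "g \<in> carrier G" for C g
  proof -
    show "C #> g = L #> (r C \<otimes> g)"
      using r[OF that(1)] that(2) LC by (metis coset_mult_assoc)
    then show "C #> g \<in> rcosets L" using r[OF that(1)] that(2) LC by (simp add: rcosetsI)
  qed
  have t: "t g C \<in> L" if "C \<in> rcosets L" "g \<in> carrier G" for C g
  proof -
    have "r (C #> g) \<in> L #> (r C \<otimes> g)"
      using r[OF shift(1)[OF that]] shift(2)[OF that] by (metis L rcos_self)
    then show ?thesis
      unfolding t_def using m_inv_mem_if_coset(1)[OF L, of "r C \<otimes> g"] r that by simp
  qed
  have Csub: "C \<subseteq> carrier G" if "C \<in> rcosets L" for C
    using that LC by (auto simp: RCOSETS_def r_coset_def)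
  have act: "C #> g #> h = C #> (g \<otimes> h)" if "C \<in> rcosets L" "g \<in> carrier G" "h \<in> carrier G" for C g h
    using that Csub by (simp add: coset_mult_assoc)
  have bij: "inj_on (\<lambda>C. C #> g) (rcosets L)" "(\<lambda>C. C #> g) ` (rcosets L) = rcosets L"
    if "g \<in> carrier G" for g
  proof -
    have *: "C #> g #> inv g = C" "C #> inv g #> g = C" if "C \<in> rcosets L" for C
      using that \<open>g \<in> carrier G\<close> Csub by (simp_all add: act)
    show "inj_on (\<lambda>C. C #> g) (rcosets L)" by (rule inj_on_inverseI) (fact *(1))
    have "C \<in> (\<lambda>C. C #> g) ` (rcosets L)" if "C \<in> rcosets L" for C
      using *(2)[OF that] shift(1)[OF that] \<open>g \<in> carrier G\<close> by (metis image_eqI inv_closed)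
    then show "(\<lambda>C. C #> g) ` (rcosets L) = rcosets L" using shift(1) that by auto
  qed
  \<comment> \<open>The cocycle identity \<open>t (g h) C = t g C t h (C g)\<close>, multiplied over
    all cosets; right multiplication by \<open>g\<close> permutes them, so the second product can be
    reindexed.\<close>
  have tf_mult: "tf (g \<otimes> h) = tf g \<otimes> tf h" if gh: "g \<in> carrier G" "h \<in> carrier G" for g h
  proof -
    have "tf (g \<otimes> h) = finprod A (\<lambda>C. t g C \<otimes>\<^bsub>A\<^esub> t h (C #> g)) (rcosets L)"
      unfolding tf_def
    proof (rule A.finprod_cong')
      fix C assume C: "C \<in> rcosets L"
      show "t (g \<otimes> h) C = t g C \<otimes>\<^bsub>A\<^esub> t h (C #> g)"
        using C gh r(1) shift(1) by (simp add: t_def act m_assoc)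
    qed (use gh t shift(1) L in \<open>auto simp: subgroup.m_closed\<close>)
    also have "\<dots> = tf g \<otimes> finprod A (\<lambda>C. t h (C #> g)) (rcosets L)"
      unfolding tf_def using gh t shift(1) by (subst A.finprod_multf) auto
    also have "finprod A (\<lambda>C. t h (C #> g)) (rcosets L) = finprod A (t h) ((\<lambda>C. C #> g) ` (rcosets L))"
      using gh t shift(1) bij by (subst A.finprod_reindex) auto
    finally show ?thesis using bij gh by (simp add: tf_def)
  qed
  have tfL: "tf g \<in> L" if "g \<in> carrier G" for g
    unfolding tf_def using A.finprod_closed[of "t g" "rcosets L"] t that by auto
  then have "tf \<in> hom G A" using tf_mult by (auto simp: hom_def)
  then interpret tf: group_hom G A tf using is_group A.is_group by unfold_locales
  note [simp del] = tf.hom_inv tf.hom_mult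
  have cmc: "commutator_set G \<subseteq> carrier G" by (auto simp: commutator_set_def)
  have tf_one: "tf \<one> = \<one>" using tf.hom_one by simp
  have "tf d = \<one>"
    using d
  proof (induction rule: generate.induct)
    case one then show ?case by (fact tf_one)
  next
    case (incl h)
    then obtain x y where xy: "x \<in> carrier G" "y \<in> carrier G" "h = cm x y" by (auto simp: commutator_set_def)
    have c: "tf x \<in> carrier G" "tf y \<in> carrier G" "tf h \<in> carrier G" using tfL xy LC by auto
    have "tf x \<otimes> tf y = tf (y \<otimes> x \<otimes> h)"
      using tf_mult[OF xy(1,2)] mult_eq_cm[OF xy(1,2)] unfolding xy(3) by metis
    also have "\<dots> = tf x \<otimes> tf y \<otimes> tf h" using xy comm[OF tfL tfL, of x y] by (simp add: tf_mult)
    finally show ?case using c by (metis l_cancel_one' m_closed)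
  next
    case (inv h)
    then obtain x y where xy: "x \<in> carrier G" "y \<in> carrier G" "h = cm x y" by (auto simp: commutator_set_def)
    have c: "tf x \<in> carrier G" "tf y \<in> carrier G" "tf (inv h) \<in> carrier G" using tfL xy LC by auto
    have "tf y \<otimes> tf x = tf (x \<otimes> y \<otimes> inv h)"
      using tf_mult[OF xy(2,1)] mult_eq_cm[OF xy(2,1)] inv_cm[OF xy(1,2)] unfolding xy(3) by metis
    also have "\<dots> = tf y \<otimes> tf x \<otimes> tf (inv h)" using xy comm[OF tfL tfL, of x y] by (simp add: tf_mult)
    finally show ?case using c by (metis l_cancel_one' m_closed)
  next
    case (eng h1 h2)
    then show ?case using generate_in_carrier[OF cmc] by (simp add: tf_mult)
  qed
  have dc: "d \<in> carrier G" using d generate_in_carrier[OF cmc] by simp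
  \<comment> \<open>Stated for every \<open>d\<close>-invariant set of cosets, so that orbits of
    \<open>d\<close> can be removed one at a time.\<close>
  have "d [^] card Y \<in> L \<and> finprod A (t d) Y = d [^] card Y"
    if "Y \<subseteq> rcosets L" "\<And>C. C \<in> Y \<Longrightarrow> C #> d \<in> Y" for Y
    using that
  proof (induction "card Y" arbitrary: Y rule: less_induct)
    case less
    have finX: "finite Y" using fin less.prems finite_subset by blast
    show ?case
    proof (cases "Y = {}")
      case True then show ?thesis using L by (simp add: subgroup.one_closed)
    next
      case False
      then obtain C0 where C0: "C0 \<in> Y" by auto
      have C0r: "C0 \<in> rcosets L" using C0 less.prems by auto
      define F where "F j = C0 #> d [^] (j::nat)" for j
      have FX: "F j \<in> Y" for j
      proof (induction j)
        case 0 then show ?case using C0 Csub[OF C0r] by (simp add: F_def)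
      next
        case (Suc j)
        have "F (Suc j) = F j #> d" using dc C0r by (simp add: F_def act)
        then show ?case using less.prems Suc by simp
      qed
      have F0: "F 0 = C0" using Csub[OF C0r] by (simp add: F_def)
      have Fdiff: "F (j - i) = C0" if "F i = F j" "i \<le> j" for i j
      proof -
        have "F j = F (j - i) #> d [^] i"
          using dc C0r that by (simp add: F_def act nat_pow_mult)
        then have "F i #> inv (d [^] i) = F (j - i) #> d [^] i #> inv (d [^] i)" using that by simp
        moreover have "F (j - i) \<in> rcosets L" using FX less.prems by auto
        ultimately show ?thesis using dc C0r Csub[of "F (j - i)"] Csub[OF C0r] by (simp add: F_def act m_assoc)
      qed
      have "\<exists>l>0. F l = C0"
      proof -
        have "\<not> inj_on F (UNIV :: nat set)"
          using FX finX finite_subset[of "range F" Y] infinite_UNIV_nat by (auto dest: finite_imageD)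
        then obtain i j where "F i = F j" "i < j"
          unfolding inj_on_def by (metis linorder_neqE_nat)
        then show ?thesis using Fdiff[of i j] by (intro exI[of _ "j - i"]) auto
      qed
      \<comment> \<open>The orbit length, as the first positive return time to
        \<open>C0\<close>.\<close>
      define l where "l = (LEAST l. l > 0 \<and> F l = C0)"
      have l: "l > 0" "F l = C0" and lmin: "\<And>l'. l' > 0 \<Longrightarrow> F l' = C0 \<Longrightarrow> l \<le> l'"
        using LeastI_ex[OF \<open>\<exists>l>0. F l = C0\<close>] Least_le[of "\<lambda>l. l > 0 \<and> F l = C0"]
        unfolding l_def by auto
      have injF: "inj_on F {..<l}"
      proof (rule linorder_inj_onI)
        fix i j assume ij: "i < j" "i \<in> {..<l}" "j \<in> {..<l}"
        then show "F i \<noteq> F j" using Fdiff[of i j] lmin[of "j - i"] by auto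
      qed auto
      define Ob where "Ob = F ` {..<l}"
      have ObX: "Ob \<subseteq> Y" using FX by (auto simp: Ob_def)
      have cardOb: "card Ob = l" using injF by (simp add: Ob_def card_image)
      have Xmin: "C #> d \<in> Y - Ob" if "C \<in> Y - Ob" for C
      proof -
        have "C #> d \<notin> Ob"
        proof
          assume "C #> d \<in> Ob"
          then obtain j where j: "j < l" "C #> d = F j" by (auto simp: Ob_def)
          \<comment> \<open>The predecessor in the cyclic orbit; \<open>F 0\<close> is preceded by
            \<open>F (l - 1)\<close> because \<open>F l = C0\<close>.\<close>
          define j' where "j' = (if j = 0 then l - 1 else j - 1)"
          have j': "j' < l" "F (Suc j') = F j" using j l F0 by (auto simp: j'_def)
          have "F j' #> d = C #> d" using j j' dc C0r by (simp add: F_def act)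
          then have "F j' = C" using inj_onD[OF bij(1)[OF dc]] FX that less.prems by blast
          then show False using that j' by (auto simp: Ob_def)
        qed
        then show ?thesis using that less.prems by auto
      qed
      have "card (Y - Ob) < card Y"
        using ObX cardOb l finX by (metis FX F0 C0 Diff_subset card_Diff_subset card_gt_0_iff card_mono diff_less empty_iff finite_subset le_antisym not_le)
      then have IH: "d [^] card (Y - Ob) \<in> L" "finprod A (t d) (Y - Ob) = d [^] card (Y - Ob)"
        using less.hyps[of "Y - Ob"] less.prems(1) Xmin by auto
      \<comment> \<open>The representatives telescope along the orbit. For \<open>k = l\<close> both
        ends are \<open>r C0\<close>, which leaves a conjugate of \<open>d [^] l\<close> to which
        \<open>fusion\<close> applies.\<close>
      have tel: "finprod A (\<lambda>j. t d (F j)) {..<k} = r C0 \<otimes> d [^] k \<otimes> inv (r (F k))" for k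
      proof (induction k)
        case 0 then show ?case using F0 r[OF C0r] by simp
      next
        case (Suc k)
        have Fr: "F j \<in> rcosets L" for j using FX less.prems by auto
        have FS: "F k #> d = F (Suc k)" using dc C0r by (simp add: F_def act)
        have tc: "t d (F j) \<in> L" for j using t Fr dc by blast
        then have pc: "finprod A (\<lambda>j. t d (F j)) {..<k} \<in> L"
          using A.finprod_closed[of "\<lambda>j. t d (F j)" "{..<k}"] by auto
        have "finprod A (\<lambda>j. t d (F j)) {..<Suc k} = t d (F k) \<otimes> finprod A (\<lambda>j. t d (F j)) {..<k}"
          using tc by (simp add: lessThan_Suc)
        also have "\<dots> = r C0 \<otimes> d [^] k \<otimes> inv (r (F k)) \<otimes> t d (F k)"
          using comm[OF tc pc] Suc by simp
        also have "\<dots> = r C0 \<otimes> d [^] Suc k \<otimes> inv (r (F (Suc k)))"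
          using dc r(1)[OF C0r] r(1)[OF Fr] by (simp add: t_def FS m_assoc)
        finally show ?case .
      qed
      have Obp: "finprod A (t d) Ob = r C0 \<otimes> d [^] l \<otimes> inv (r C0)"
        unfolding Ob_def using injF tel[of l] l t dc FX less.prems(1)
        by (subst A.finprod_reindex) auto
      moreover have "finprod A (t d) Ob \<in> L"
        using A.finprod_closed[of "t d" Ob] t dc ObX less.prems(1) by auto
      ultimately have dl: "finprod A (t d) Ob = d [^] l" "d [^] l \<in> L"
        using fusion[of "r C0" l] r(1)[OF C0r] by auto
      have "finprod A (t d) Y = finprod A (t d) (Ob \<union> (Y - Ob))" using ObX by (simp add: Un_absorb1)
      also have "\<dots> = finprod A (t d) Ob \<otimes> finprod A (t d) (Y - Ob)"
        using finX ObX finite_subset[OF ObX] t dc less.prems(1) by (subst A.finprod_Un_disjoint) auto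
      also have "\<dots> = d [^] card Y"
        using IH dl dc cardOb finX ObX finite_subset[OF ObX] card_mono[OF finX ObX]
        by (simp add: nat_pow_mult card_Diff_subset)
      finally show ?thesis
        using IH dl L dc cardOb finX ObX finite_subset[OF ObX] card_mono[OF finX ObX]
          subgroup.m_closed[OF L dl(2) IH(1)]
        by (simp add: nat_pow_mult card_Diff_subset)
    qed
  qed
  from this[of "rcosets L"] show ?thesis
    using \<open>tf d = \<one>\<close> shift(1) dc by (auto simp: tf_def)
qed

end

section \<open>Finite groups whose commutators have prime power order\<close>

lemma nat_prime_part:
  fixes n p :: nat
  assumes "Factorial_Ring.prime p" "n > 0"
  shows "\<exists>a m. n = p ^ a * m \<and> \<not> p dvd m"
proof -
  from assms have "\<not> is_unit p" "n \<noteq> 0" by auto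
  then show ?thesis by (metis multiplicity_decompose')
qed

lemma nat_prime_power:
  fixes n p :: nat
  assumes "Factorial_Ring.prime p" "n > 0" "\<And>q. Factorial_Ring.prime q \<Longrightarrow> q dvd n \<Longrightarrow> q = p"
  shows "\<exists>k. n = p ^ k"
proof -
  obtain a m where m: "n = p ^ a * m" "\<not> p dvd m"
    using nat_prime_part assms(1,2) by blast
  have "m = 1"
    using m assms(3) by (metis dvd_mult prime_factor_nat)
  with m show ?thesis by auto
qed

context group
begin

lemma commutator_set_cj: "g \<in> carrier G \<Longrightarrow> c \<in> commutator_set G \<Longrightarrow> cj g c \<in> commutator_set G"
  unfolding commutator_set_def using cj_cm cj_closed by blast

lemma commutator_set_subset: "commutator_set G \<subseteq> carrier G"
  by (auto simp: commutator_set_def)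

lemma generate_normal_cj:
  assumes "S \<subseteq> carrier G" "\<And>g s. g \<in> carrier G \<Longrightarrow> s \<in> S \<Longrightarrow> cj g s \<in> S"
  shows "generate G S \<lhd> G"
proof (rule normal_generateI)
  fix h g assume "h \<in> S" "g \<in> carrier G"
  then show "g \<otimes> h \<otimes> inv g \<in> S" using assms(2)[of "inv g" h] by (simp add: cj_def)
qed (fact assms(1))

lemma generate_commutators_normal: "generate G (commutator_set G) \<lhd> G"
  using generate_normal_cj commutator_set_subset commutator_set_cj by blast

lemma subgroup_nat_pow: "subgroup S G \<Longrightarrow> x \<in> S \<Longrightarrow> x [^] (n::nat) \<in> S"
  by (induction n) (auto simp: subgroup.one_closed subgroup.m_closed)

lemma pow_coprime_one:
  assumes "x \<in> carrier G" "x [^] (m::nat) = \<one>" "x [^] (n::nat) = \<one>" "coprime m n"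
  shows "x = \<one>"
proof -
  have "ord x dvd m" "ord x dvd n" using assms pow_eq_id by auto
  then have "ord x dvd 1" using assms(4) coprime_common_divisor by blast
  then have "x [^] (1::nat) = \<one>" using assms(1) pow_eq_id by blast
  then show ?thesis using assms(1) by simp
qed

lemma subgroup_pow_card:
  assumes "subgroup S G" "finite S" "s \<in> S"
  shows "s [^] card S = \<one>"
proof -
  interpret S: group "G\<lparr>carrier := S\<rparr>" using assms subgroup.subgroup_is_group is_group by blast
  have "s [^]\<^bsub>G\<lparr>carrier := S\<rparr>\<^esub> card S = \<one>"
    using S.pow_order_eq_1[of s] assms by (simp add: order_def)
  then show ?thesis by (simp flip: nat_pow_consistent)
qed

text \<open>A Sylow subgroup for a prime \<open>q\<close> dividing the order contains a nontrivial
  element killed by a power of \<open>q\<close> and a power of \<open>p\<close>, which forces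
  \<open>q = p\<close>.\<close>

lemma prime_power_order:
  fixes p :: nat
  assumes fin: "finite (carrier G)" and p: "Factorial_Ring.prime p"
    and el: "\<And>x. x \<in> carrier G \<Longrightarrow> \<exists>j. x [^] (p ^ j) = \<one>"
  shows "\<exists>k. order G = p ^ k"
proof (rule nat_prime_power[OF p])
  show "order G > 0" using fin order_gt_0_iff_finite by simp
  fix q :: nat assume q: "Factorial_Ring.prime q" "q dvd order G"
  obtain a m where m: "order G = q ^ a * m" "\<not> q dvd m"
    using nat_prime_part[OF q(1) \<open>order G > 0\<close>] by blast
  obtain S where S: "subgroup S G" "card S = q ^ a"
    using sylow_thm[OF q(1) is_group m(1) fin] by blast
  have "a \<noteq> 0" using m q(2) by (intro notI) simp
  then have "card S > 1" using S(2) prime_gt_1_nat[OF q(1)] one_less_power[of q a] by simp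
  then have "\<not> S \<subseteq> {\<one>}" using card_mono[of "{\<one>}" S] by auto
  then obtain s where s: "s \<in> S" "s \<noteq> \<one>" by blast
  have sc: "s \<in> carrier G" "finite S" using s S fin subgroup.subset finite_subset by blast+
  obtain j where "s [^] (p ^ j) = \<one>" using el sc by blast
  moreover have "s [^] (q ^ a) = \<one>" using subgroup_pow_card[OF S(1) sc(2) s(1)] S(2) by simp
  ultimately have "\<not> coprime (p ^ j) (q ^ a)" using pow_coprime_one[OF sc(1)] s by blast
  then show "q = p" using primes_coprime[OF p q(1)] by auto
qed

text \<open>For a prime \<open>q \<noteq> p\<close>, a Sylow \<open>q\<close>-subgroup \<open>S\<close> contains no nontrivial commutator. So it is abelian without fusion,
  and the transfer to \<open>S\<close>, which kills the derived subgroup, is injective on \<open>S\<close>.\<close>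

theorem commutators_prime_power:
  fixes p :: nat
  assumes fin: "finite (carrier G)" and p: "Factorial_Ring.prime p"
    and el: "\<And>x y. x \<in> carrier G \<Longrightarrow> y \<in> carrier G \<Longrightarrow> \<exists>j. cm x y [^] (p ^ j) = \<one>"
  shows "\<exists>k. \<forall>d \<in> generate G (commutator_set G). d [^] (p ^ k) = \<one>"
proof -
  define D where "D = generate G (commutator_set G)"
  have Dn: "D \<lhd> G" unfolding D_def by (fact generate_commutators_normal)
  then have Ds: "subgroup D G" by (rule normal_imp_subgroup)
  have finD: "finite D" using Ds fin subgroup.subset finite_subset by blast
  have "card D > 0" using Ds finD subgroup.one_closed card_gt_0_iff by blast
  have "q = p" if q: "Factorial_Ring.prime q" "q dvd card D" for q :: nat
  proof (rule ccontr)
    assume "q \<noteq> p"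
    then have cop: "coprime (p ^ i) (q ^ j)" for i j using p q primes_coprime by auto
    have o0: "order G > 0" using fin order_gt_0_iff_finite by simp
    then obtain a m where m: "order G = q ^ a * m" "\<not> q dvd m"
      using nat_prime_part[OF q(1)] by blast
    obtain S where S: "subgroup S G" "card S = q ^ a"
      using sylow_thm[OF q(1) is_group m(1) fin] by blast
    have finS: "finite S" using S fin subgroup.subset finite_subset by blast
    have Sc: "s \<in> carrier G" if "s \<in> S" for s using that S subgroup.subset by blast
    have Sq: "s [^] (q ^ a) = \<one>" if "s \<in> S" for s using subgroup_pow_card[OF S(1) finS that] S(2) by simp
    \<comment> \<open>A commutator inside \<open>S\<close> is killed by a power of \<open>p\<close>
      and by a power of \<open>q\<close>.\<close>
    have cmS: "cm x y = \<one>" if "x \<in> carrier G" "y \<in> carrier G" "cm x y \<in> S" for x y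
      using el[OF that(1,2)] Sq[OF that(3)] pow_coprime_one[OF Sc[OF that(3)]] cop by blast
    have card: "card (rcosets S) = m"
      using lagrange[OF S(1)] m(1) S(2) prime_gt_0_nat[OF q(1)] by simp
    \<comment> \<open>The transfer gives \<open>d [^] m = \<one>\<close> with \<open>m\<close> prime
      to \<open>q\<close>, while \<open>d\<close> has \<open>q\<close>-power order. Fusion is
      excluded because \<open>d [^] j\<close> and a conjugate of it in \<open>S\<close> differ by a
      commutator in \<open>S\<close>.\<close>
    have SD: "d = \<one>" if d: "d \<in> S" "d \<in> D" for d
    proof -
      have "d [^] card (rcosets S) = \<one>"
      proof (rule transfer_power[OF S(1)])
        show "finite (rcosets S)" using fin by (simp add: RCOSETS_def)
        show "x \<otimes> y = y \<otimes> x" if "x \<in> S" "y \<in> S" for x y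
          using that Sc cmS subgroup_cm[OF S(1)] by (simp add: commute_iff_cm)
        show "d \<in> generate G (commutator_set G)" using d by (simp add: D_def)
        fix x and j :: nat assume x: "x \<in> carrier G" "x \<otimes> d [^] j \<otimes> inv x \<in> S"
        have dj: "d [^] j \<in> S" using S(1) d(1) by (rule subgroup_nat_pow)
        have "cm (d [^] j) (inv x) = inv (d [^] j) \<otimes> (x \<otimes> d [^] j \<otimes> inv x)"
          using x Sc dj by (simp add: word_simps)
        then have "cm (d [^] j) (inv x) \<in> S" using x dj S(1) by (simp add: subgroup.m_closed subgroup.m_inv_closed)
        then have "cm (d [^] j) (inv x) = \<one>" using cmS x Sc dj by auto
        then have "cj (inv x) (d [^] j) = d [^] j" using cj_eq_iff x Sc dj by auto
        then show "x \<otimes> d [^] j \<otimes> inv x = d [^] j" using x by (simp add: cj_def)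
      qed
      moreover have "coprime m (q ^ a)" using prime_imp_coprime[OF q(1) m(2)] by (simp add: coprime_commute)
      ultimately show "d = \<one>" using Sq[OF d(1)] pow_coprime_one[OF Sc[OF d(1)]] card by blast
    qed
    \<comment> \<open>As \<open>S\<close> meets \<open>D\<close> trivially, it embeds into
      \<open>G Mod D\<close>. The full \<open>q\<close>-part of the order of \<open>G\<close> then
      divides the index of \<open>D\<close>, so that \<open>q\<close> cannot divide
      \<open>card D\<close>.\<close>
    interpret D: normal D G by (fact Dn)
    interpret Q: group "G Mod D" by (rule D.factorgroup_is_group)
    interpret S: group "G\<lparr>carrier := S\<rparr>" using S subgroup.subgroup_is_group is_group by blast
    have "(\<lambda>x. D #> x) \<in> hom (G\<lparr>carrier := S\<rparr>) (G Mod D)"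
      using D.r_coset_hom_Mod Sc by (auto simp: hom_def)
    then interpret h: group_hom "G\<lparr>carrier := S\<rparr>" "G Mod D" "\<lambda>x. D #> x" by unfold_locales
    have "inj_on (\<lambda>x. D #> x) S"
      using h.inj_on_one_iff SD Sc D.rcos_const by (auto simp: coset_join1 D.subset Ds)
    then have "card ((\<lambda>x. D #> x) ` S) = q ^ a" using S card_image by metis
    moreover have "subgroup ((\<lambda>x. D #> x) ` S) (G Mod D)" using h.img_is_subgroup by simp
    moreover have cQ: "carrier (G Mod D) = rcosets D" by (simp add: FactGroup_def)
    moreover have "finite (rcosets D)" using fin by (simp add: RCOSETS_def)
    ultimately have "q ^ a dvd card (rcosets D)" using Q.lagrange by (metis dvd_triv_right order_def)
    then obtain l where "card (rcosets D) = q ^ a * l" by auto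
    then have "q ^ a * m = q ^ a * (l * card D)"
      using lagrange[OF Ds] m(1) by (simp only: mult.assoc)
    then have "m = l * card D" using prime_gt_0_nat[OF q(1)] by simp
    then have "card D dvd m" by simp
    then show False using q m by auto
  qed
  then obtain k where "card D = p ^ k" using nat_prime_power[OF p \<open>card D > 0\<close>] by blast
  then show ?thesis using subgroup_pow_card[OF Ds finD] D_def by metis
qed

lemma hom_commutator:
  assumes "group_hom G H h" "x \<in> carrier G" "y \<in> carrier G"
  shows "h (cm x y) = commutator H (h x) (h y)"
proof -
  interpret group_hom G H h by fact
  show ?thesis using assms by (simp add: commutator_def)
qed

lemma hom_commutator_set:
  assumes "group_hom G H h" "h ` carrier G = carrier H"
  shows "h ` commutator_set G = commutator_set H"
  unfolding commutator_set_def using hom_commutator[OF assms(1)] assms(2)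
  by (auto simp: image_iff simp flip: assms(2)) (metis cm_closed)+

lemma Mod_group_hom:
  assumes "N \<lhd> G"
  shows "group_hom G (G Mod N) (\<lambda>x. N #> x)" "(\<lambda>x. N #> x) ` carrier G = carrier (G Mod N)"
  using assms by (auto simp: group_hom_def group_hom_axioms_def normal.factorgroup_is_group
      normal.r_coset_hom_Mod is_group carrier_FactGroup)

lemma coset_eq_one_iff:
  assumes "N \<lhd> G" "x \<in> carrier G"
  shows "N #> x = N \<longleftrightarrow> x \<in> N"
  using assms coset_join1[of N x] coset_join2[of x N] normal_imp_subgroup subgroup.subset by blast

lemma commutators_prime_power_mod:
  fixes p :: nat
  assumes J: "J \<lhd> G" and fin: "finite (rcosets J)" and p: "Factorial_Ring.prime p"
    and el: "\<And>x y. x \<in> carrier G \<Longrightarrow> y \<in> carrier G \<Longrightarrow> \<exists>j. cm x y [^] (p ^ j) \<in> J"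
  shows "\<exists>k. \<forall>d \<in> generate G (commutator_set G). d [^] (p ^ k) \<in> J"
proof -
  let ?Q = "G Mod J" and ?h = "\<lambda>x. J #> x"
  interpret h: group_hom G ?Q ?h by (rule Mod_group_hom[OF J])
  note surj = Mod_group_hom(2)[OF J]
  have "\<exists>k. \<forall>d \<in> generate ?Q (commutator_set ?Q). d [^]\<^bsub>?Q\<^esub> (p ^ k) = \<one>\<^bsub>?Q\<^esub>"
  proof (rule h.H.commutators_prime_power[OF _ p])
    show "finite (carrier ?Q)" using fin by (simp add: FactGroup_def)
    fix u v assume "u \<in> carrier ?Q" "v \<in> carrier ?Q"
    then obtain x y where xy: "x \<in> carrier G" "y \<in> carrier G" "u = ?h x" "v = ?h y"
      unfolding surj[symmetric] by auto
    then obtain j where "cm x y [^] (p ^ j) \<in> J" using el by blast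
    then show "\<exists>j. commutator ?Q u v [^]\<^bsub>?Q\<^esub> (p ^ j) = \<one>\<^bsub>?Q\<^esub>"
      using xy coset_eq_one_iff[OF J, of "cm x y [^] (p ^ j)"]
      by (intro exI[of _ j]) (simp add: hom_commutator[OF h.group_hom_axioms, symmetric] flip: h.hom_nat_pow)
  qed
  then obtain k where k: "\<And>d. d \<in> generate ?Q (commutator_set ?Q) \<Longrightarrow> d [^]\<^bsub>?Q\<^esub> (p ^ k) = \<one>\<^bsub>?Q\<^esub>" by blast
  show ?thesis
  proof (intro exI ballI)
    fix d assume d: "d \<in> generate G (commutator_set G)"
    then have dc: "d \<in> carrier G" using generate_in_carrier[OF commutator_set_subset] by blast
    have "?h d \<in> generate ?Q (commutator_set ?Q)"
      using d h.generate_img[OF commutator_set_subset] hom_commutator_set[OF h.group_hom_axioms surj] by auto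
    then have "?h (d [^] (p ^ k)) = J" using k dc by (simp add: h.hom_nat_pow)
    then show "d [^] (p ^ k) \<in> J" using coset_eq_one_iff[OF J] dc by simp
  qed
qed

end

section \<open>Finite p-groups acting on abelian groups of exponent p\<close>

lemma (in group_action) prime_power_fixed_point:
  fixes p :: nat
  assumes p: "Factorial_Ring.prime p" and ord: "order G = p ^ k"
    and fin: "finite E" and dvd: "p dvd card E"
    and x0: "x0 \<in> E" "\<And>g. g \<in> carrier G \<Longrightarrow> \<phi> g x0 = x0"
  shows "\<exists>x \<in> E. x \<noteq> x0 \<and> (\<forall>g \<in> carrier G. \<phi> g x = x)"
proof (rule ccontr)
  assume no: "\<not> ?thesis"
  interpret G: group G using group_hom group_hom.axioms(1) by blast
  have orb_dvd: "card (orbit G \<phi> x) dvd p ^ k" if "x \<in> E" for x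
    using orbit_stabilizer_theorem[OF that] ord by (metis dvd_triv_left)
  have self: "x \<in> orbit G \<phi> x" if "x \<in> E" for x using orbit_refl that by blast
  have sub: "orbit G \<phi> x \<subseteq> E" if "x \<in> E" for x
    using element_image that by (auto simp: orbit_def)
  have orb0: "orbit G \<phi> x0 = {x0}" unfolding orbit_def using x0(2) x0(2)[OF G.one_closed, symmetric] G.one_closed by blast
  \<comment> \<open>Orbits have \<open>p\<close>-power size, and one of size 1 other than
    \<open>{x0}\<close> would be a second fixed point. So \<open>card E\<close> would be 1 modulo
    \<open>p\<close>.\<close>
  have "p dvd card Ob" if "Ob \<in> orbits G E \<phi> - {{x0}}" for Ob
  proof -
    from that obtain x where x: "x \<in> E" "Ob = orbit G \<phi> x" "Ob \<noteq> {x0}" by (auto simp: orbits_def)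
    then have "x \<noteq> x0" using orb0 by auto
    then obtain g where "g \<in> carrier G" "\<phi> g x \<noteq> x" using no x by auto
    then have "{x, \<phi> g x} \<subseteq> Ob" "x \<noteq> \<phi> g x" using self x by (auto simp: orbit_def)
    then have "card Ob \<noteq> 1" by (auto simp: card_1_singleton_iff)
    moreover obtain i where "card Ob = p ^ i" using orb_dvd x p by (metis divides_primepow_nat)
    ultimately show ?thesis by (cases i) auto
  qed
  then have 1: "p dvd (\<Sum>Ob\<in>orbits G E \<phi> - {{x0}}. card Ob)" by (rule dvd_sum)
  have "finite (orbits G E \<phi>)" using fin by (simp add: orbits_def)
  moreover have "{x0} \<in> orbits G E \<phi>" using x0(1) orb0 by (auto simp: orbits_def)
  moreover have "(\<Sum>Ob\<in>orbits G E \<phi>. card Ob) = card E"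
    using disjoint_sum[OF fin, of "\<lambda>_. 1::nat"] by simp
  ultimately have "card E = 1 + (\<Sum>Ob\<in>orbits G E \<phi> - {{x0}}. card Ob)"
    by (subst (asm) sum.remove[of _ "{x0}"]) auto
  with 1 dvd have "p dvd 1" by (metis dvd_add_left_iff)
  then show False using p by auto
qed

text \<open>By commutativity a further generator \<open>y\<close> contributes only a factor
  \<open>y [^] i\<close>, and \<open>i\<close> may be reduced modulo \<open>p\<close>.\<close>

lemma (in comm_group) finite_generate_exponent:
  assumes exp: "\<And>v. v \<in> carrier G \<Longrightarrow> v [^] (p::nat) = \<one>" and p: "p > 0"
    and Y: "finite Y" "Y \<subseteq> carrier G"
  shows "finite (generate G Y) \<and> card (generate G Y) \<le> p ^ card Y"
  using Y
proof (induction Y rule: finite_induct)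
  case empty
  then show ?case by (simp add: generate_empty)
next
  case (insert y Y)
  let ?A = "generate G Y"
  have A: "subgroup ?A G" using insert.prems generate_is_subgroup by auto
  have yc: "y \<in> carrier G" using insert.prems by auto
  define S where "S = (\<lambda>(a, i). a \<otimes> y [^] i) ` (?A \<times> {..<p})"
  have mem: "a \<otimes> y [^] (i::nat) \<in> S" if "a \<in> ?A" for a i
  proof -
    have "y [^] i = y [^] (i mod p) \<otimes> (y [^] p) [^] (i div p)"
      using yc by (simp add: nat_pow_pow nat_pow_mult)
    then have "y [^] i = y [^] (i mod p)" using exp yc by simp
    then show ?thesis unfolding S_def using that p by (intro image_eqI[of _ _ "(a, i mod p)"]) auto
  qed
  have "generate G (insert y Y) \<subseteq> S"
  proof (rule generate_subgroup_incl)
    show "insert y Y \<subseteq> S"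
    proof
      fix x assume "x \<in> insert y Y"
      then show "x \<in> S"
        using mem[OF subgroup.one_closed[OF A], of 1] mem[OF generate.incl[of x Y], of 0] yc insert.prems by auto
    qed
    show "subgroup S G"
    proof (rule subgroupI)
      show "S \<subseteq> carrier G" using A yc subgroup.subset by (auto simp: S_def)
      show "S \<noteq> {}" using mem[OF subgroup.one_closed[OF A]] by auto
      fix s assume "s \<in> S"
      then obtain a i where s: "a \<in> ?A" "i < p" "s = a \<otimes> y [^] i" by (auto simp: S_def)
      have ac: "a \<in> carrier G" using s A subgroup.subset by blast
      have "y [^] i \<otimes> y [^] (p - i) = \<one>" using s yc exp by (simp add: nat_pow_mult)
      then have "inv (y [^] i) = y [^] (p - i)" using yc by (simp add: inv_equality m_comm)
      then have "inv s = inv a \<otimes> y [^] (p - i)" using s ac yc by (simp add: inv_mult)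
      then show "inv s \<in> S" using mem subgroup.m_inv_closed[OF A s(1)] by simp
      fix t assume "t \<in> S"
      then obtain b j where t: "b \<in> ?A" "j < p" "t = b \<otimes> y [^] j" by (auto simp: S_def)
      have bc: "b \<in> carrier G" using t A subgroup.subset by blast
      have "s \<otimes> t = (a \<otimes> b) \<otimes> y [^] (i + j)" using s t ac bc yc by (simp add: m_ac flip: nat_pow_mult)
      then show "s \<otimes> t \<in> S" using mem subgroup.m_closed[OF A s(1) t(1)] by simp
    qed
  qed
  moreover have "finite S" "card S \<le> card ?A * p"
    unfolding S_def using insert card_image_le[of "?A \<times> {..<p}"] by (auto simp: card_cartesian_product)
  moreover have "card ?A * p \<le> p ^ card (insert y Y)" using insert by simp
  ultimately show ?case by (meson card_mono finite_subset le_trans)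
qed

text \<open>The subgroup generated by the orbit of \<open>v\<close> has at most \<open>p ^ |P|\<close> elements, which makes the length of the
  series independent of \<open>v\<close>.\<close>

lemma (in comm_group) prime_power_group_acts_nilpotently:
  fixes p :: nat and \<phi> :: "'p \<Rightarrow> 'a \<Rightarrow> 'a"
  assumes exp: "\<And>v. v \<in> carrier G \<Longrightarrow> v [^] p = \<one>" and p: "Factorial_Ring.prime p"
    and P: "group P" "order P = p ^ k"
    and act: "group_action P (carrier G) \<phi>" and hom: "\<And>g. g \<in> carrier P \<Longrightarrow> \<phi> g \<in> hom G G"
    and K0: "K 0 = {\<one>}"
    and KS: "\<And>i. K (Suc i) = {v \<in> carrier G. \<forall>g \<in> carrier P. \<phi> g v \<otimes> inv v \<in> K i}"
  shows "K (p ^ card (carrier P)) = carrier G"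
proof -
  interpret P: group P by fact
  interpret act: group_action P "carrier G" \<phi> by fact
  have p0: "p > 0" using p prime_gt_0_nat by blast
  have finP: "finite (carrier P)" using P p0 by (metis P.order_gt_0_iff_finite zero_less_power)
  have cl: "\<phi> g v \<in> carrier G" if "g \<in> carrier P" "v \<in> carrier G" for g v
    using act.element_image that by blast
  have hm1: "\<phi> g \<one> = \<one>" if "g \<in> carrier P" for g
  proof -
    interpret h: group_hom G G "\<phi> g" using hom that by unfold_locales
    show ?thesis by (rule h.hom_one)
  qed
  have hminv: "\<phi> g (inv v) = inv (\<phi> g v)" if "g \<in> carrier P" "v \<in> carrier G" for g v
  proof -
    interpret h: group_hom G G "\<phi> g" using hom that by unfold_locales
    show ?thesis using that by simp
  qed
  have hmm: "\<phi> g (v \<otimes> w) = \<phi> g v \<otimes> \<phi> g w"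
    if "g \<in> carrier P" "v \<in> carrier G" "w \<in> carrier G" for g v w
    using hom[OF that(1)] that by (auto simp: hom_def)
  note hm = hm1 hminv hmm
  have cmp: "\<phi> g (\<phi> h v) = \<phi> (g \<otimes>\<^bsub>P\<^esub> h) v" if "g \<in> carrier P" "h \<in> carrier P" "v \<in> carrier G" for g h v
    using act.composition_rule[of v g h] that by simp
  have phi1: "\<phi> \<one>\<^bsub>P\<^esub> v = v" if "v \<in> carrier G" for v
    using act.id_eq_one that by (metis restrict_apply')
  have Ksub: "subgroup (K i) G \<and> K i \<subseteq> K (Suc i)" for i
  proof (induction i)
    case 0
    then show ?case using hm by (auto simp: K0 KS triv_subgroup)
  next
    case (Suc i)
    then have s: "subgroup (K i) G" and i: "K i \<subseteq> K (Suc i)" by auto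
    have "subgroup (K (Suc i)) G"
    proof (rule subgroupI)
      show "K (Suc i) \<subseteq> carrier G" by (auto simp: KS)
      show "K (Suc i) \<noteq> {}" using hm subgroup.one_closed[OF s] by (auto simp: KS intro!: exI[of _ \<one>])
      fix a assume a: "a \<in> K (Suc i)"
      have "\<phi> g (inv a) \<otimes> inv (inv a) = inv (\<phi> g a \<otimes> inv a)" if "g \<in> carrier P" for g
        using that a cl by (simp add: KS hm inv_mult)
      then show "inv a \<in> K (Suc i)" using a subgroup.m_inv_closed[OF s] by (auto simp: KS)
      fix b assume b: "b \<in> K (Suc i)"
      have "\<phi> g (a \<otimes> b) \<otimes> inv (a \<otimes> b) = (\<phi> g a \<otimes> inv a) \<otimes> (\<phi> g b \<otimes> inv b)" if "g \<in> carrier P" for g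
        using that a b cl by (simp add: KS hm inv_mult m_ac)
      then show "a \<otimes> b \<in> K (Suc i)" using a b subgroup.m_closed[OF s] by (auto simp: KS)
    qed
    moreover have "K (Suc i) \<subseteq> K (Suc (Suc i))" using i by (auto simp: KS[of i] KS[of "Suc i"])
    ultimately show ?case by simp
  qed
  have Kinv: "\<phi> g v \<in> K i" if "g \<in> carrier P" "v \<in> K i" for g v i
  proof -
    have vc: "v \<in> carrier G" using Ksub that subgroup.subset by blast
    have "\<phi> g v \<otimes> inv v \<in> K i" using Ksub[of i] that by (auto simp: KS)
    then have "(\<phi> g v \<otimes> inv v) \<otimes> v \<in> K i" using Ksub that subgroup.m_closed by metis
    then show ?thesis using vc cl that by (simp add: m_assoc)
  qed
  have "v \<in> K (p ^ card (carrier P))" if v: "v \<in> carrier G" for v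
  proof -
    define Y where "Y = (\<lambda>g. \<phi> g v) ` carrier P"
    define A where "A = generate G Y"
    have Yc: "Y \<subseteq> carrier G" using cl v by (auto simp: Y_def)
    have "card Y \<le> card (carrier P)" using finP card_image_le by (auto simp: Y_def)
    then have cardA: "finite A" "card A \<le> p ^ card (carrier P)"
      using finite_generate_exponent[OF exp p0 _ Yc] finP p0 power_increasing[of "card Y" "card (carrier P)" p]
      by (auto simp: Y_def A_def)
    have A: "subgroup A G" unfolding A_def using Yc by (rule generate_is_subgroup)
    have Ainv: "\<phi> g a \<in> A" if "g \<in> carrier P" "a \<in> A" for g a
    proof -
      have "subgroup {a \<in> carrier G. \<phi> g a \<in> A} G"
        using that(1) A by (auto intro!: subgroupI simp: hm subgroup.m_closed subgroup.m_inv_closed subgroup.one_closed intro: exI[of _ \<one>])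
      moreover have "Y \<subseteq> {a \<in> carrier G. \<phi> g a \<in> A}"
        using that(1) v Yc cmp by (auto simp: Y_def A_def intro: generate.incl)
      ultimately show ?thesis using that(2) generate_subgroup_incl unfolding A_def by blast
    qed
    have "v \<in> Y" unfolding Y_def using phi1[OF v, symmetric] P.one_closed by blast
    then have vA: "v \<in> A" unfolding A_def by (rule generate.incl)
    interpret A: group "G\<lparr>carrier := A\<rparr>"
      using A is_group by (rule subgroup.subgroup_is_group)
    \<comment> \<open>\<open>P\<close> acts on the nontrivial \<open>p\<close>-group
      \<open>A / (A \<inter> K i)\<close> and fixes the trivial coset. A second fixed coset supplies
      \<open>u\<close>, which \<open>P\<close> moves only by elements of \<open>K i\<close>.\<close>
    have grow: "\<exists>u \<in> A - K i. u \<in> K (Suc i)" if ne: "\<not> A \<subseteq> K i" for i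
    proof -
      define B where "B = A \<inter> K i"
      have Ki: "subgroup (K i) G" using Ksub by simp
      have B: "subgroup B G" unfolding B_def using subgroups_Inter_pair[OF A Ki] .
      have BA: "subgroup B (G\<lparr>carrier := A\<rparr>)" using subgroup_incl[OF B A] by (auto simp: B_def)
      have Binv: "\<phi> g b \<in> B" if "g \<in> carrier P" "b \<in> B" for g b using that Ainv Kinv by (auto simp: B_def)
      define E where "E = (\<lambda>a. B #> a) ` A"
      have E: "E = rcosets\<^bsub>G\<lparr>carrier := A\<rparr>\<^esub> B" by (auto simp: E_def RCOSETS_def r_coset_def)
      have Ac: "a \<in> carrier G" if "a \<in> A" for a using that A subgroup.subset by blast
      have img: "\<phi> g ` (B #> a) = B #> \<phi> g a" if g: "g \<in> carrier P" and a: "a \<in> A" for g a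
      proof -
        have 1: "\<phi> g ` (B #> a) \<subseteq> B #> \<phi> g a" if "g \<in> carrier P" "a \<in> A" for g a
          using that hm Binv Ac A B by (auto simp: r_coset_def B_def) (metis IntI B_def Binv)
        have "inv\<^bsub>P\<^esub> g \<in> carrier P" using g by simp
        have "B #> \<phi> g a \<subseteq> \<phi> g ` (B #> a)"
        proof
          fix z assume z: "z \<in> B #> \<phi> g a"
          then have zc: "z \<in> carrier G" using Ac Ainv[OF g a] B r_coset_subset_G subgroup.subset by blast
          have "\<phi> (inv\<^bsub>P\<^esub> g) z \<in> B #> \<phi> (inv\<^bsub>P\<^esub> g) (\<phi> g a)"
            using 1[of "inv\<^bsub>P\<^esub> g" "\<phi> g a"] z Ainv[OF g a] g by auto
          also have "\<phi> (inv\<^bsub>P\<^esub> g) (\<phi> g a) = a" using cmp g Ac[OF a] phi1 by simp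
          finally have "\<phi> (inv\<^bsub>P\<^esub> g) z \<in> B #> a" .
          moreover have "\<phi> g (\<phi> (inv\<^bsub>P\<^esub> g) z) = z" using cmp g zc phi1 by simp
          ultimately show "z \<in> \<phi> g ` (B #> a)" by (metis image_eqI)
        qed
        with 1[OF g a] show ?thesis by auto
      qed
      \<comment> \<open>The restriction is there because \<open>BijGroup\<close> consists of
        extensional functions.\<close>
      define \<psi> where "\<psi> g = restrict (\<lambda>C. \<phi> g ` C) E" for g
      have \<psi>: "\<psi> g (B #> a) = B #> \<phi> g a" if "g \<in> carrier P" "a \<in> A" for g a
        using that img by (auto simp: \<psi>_def E_def)
      have \<psi>E: "\<psi> g C \<in> E" if "g \<in> carrier P" "C \<in> E" for g C
        using that \<psi> Ainv by (auto simp: E_def)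
      have \<psi>cmp: "\<psi> g (\<psi> h C) = \<psi> (g \<otimes>\<^bsub>P\<^esub> h) C" if "g \<in> carrier P" "h \<in> carrier P" "C \<in> E" for g h C
        using that \<psi> Ainv cmp Ac by (auto simp: E_def)
      have \<psi>1: "\<psi> \<one>\<^bsub>P\<^esub> C = C" if "C \<in> E" for C
        using that \<psi>[OF P.one_closed] Ac phi1 by (auto simp: E_def)
      have \<psi>Bij: "\<psi> g \<in> Bij E" if g: "g \<in> carrier P" for g
      proof -
        have "bij_betw (\<psi> g) E E"
          by (rule bij_betw_byWitness[where f' = "\<psi> (inv\<^bsub>P\<^esub> g)"])
            (use g \<psi>cmp \<psi>1 \<psi>E in \<open>auto simp: P.l_inv P.r_inv\<close>)
        then show ?thesis by (simp add: Bij_def \<psi>_def)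
      qed
      have "\<psi> \<in> hom P (BijGroup E)"
        using \<psi>Bij \<psi>cmp by (auto simp: hom_def BijGroup_def compose_def \<psi>_def restrict_def fun_eq_iff)
      then interpret \<psi>: group_action P E \<psi>
        unfolding group_action_def group_hom_def group_hom_axioms_def using P(1) group_BijGroup by blast
      have finE: "finite E" using cardA by (simp add: E_def)
      have ce: "card E * card B = card A"
        using A.lagrange[OF BA] E by (simp add: order_def)
      have "\<exists>j. card A = p ^ j"
        using A.prime_power_order[OF _ p] cardA exp Ac
        by (simp add: order_def flip: nat_pow_consistent) (metis power_one_right)
      then obtain j where j: "card A = p ^ j" by blast
      then obtain l where l: "card E = p ^ l"
        using ce divides_primepow_nat[OF p, of "card E" j] dvd_triv_left[of "card E" "card B"] by auto
      have "card E \<noteq> 1"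
      proof
        assume "card E = 1"
        then have "card B = card A" using ce by simp
        then have "B = A" using cardA card_subset_eq[of A B] by (auto simp: B_def)
        then show False using ne B_def by auto
      qed
      then have pE: "p dvd card E" using l by (cases l) auto
      have BE: "B \<in> E" unfolding E_def using A B
        by (intro image_eqI[of _ _ \<one>]) (auto simp: subgroup.one_closed subgroup.subset)
      have BB: "\<psi> g B = B" if "g \<in> carrier P" for g
        using \<psi>[OF that subgroup.one_closed[OF A]] hm1[OF that] subgroup.subset[OF B] by simp
      obtain C where C: "C \<in> E" "C \<noteq> B" "\<And>g. g \<in> carrier P \<Longrightarrow> \<psi> g C = C"
        using \<psi>.prime_power_fixed_point[OF p P(2) finE pE BE BB] by blast
      then obtain u where u: "u \<in> A" "C = B #> u" by (auto simp: E_def)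
      have "u \<notin> B" using C(2) u coset_join2[OF Ac[OF u(1)] B] by auto
      moreover have "\<phi> g u \<otimes> inv u \<in> K i" if "g \<in> carrier P" for g
      proof -
        have "B #> \<phi> g u = B #> u" using C(3)[OF that] u \<psi>[OF that u(1)] by simp
        then have "\<phi> g u \<in> B #> u" using rcos_self[OF Ac[OF Ainv[OF that u(1)]] B] by simp
        then have "\<phi> g u \<otimes> inv u \<in> B"
          using subgroup.rcos_module_imp[OF B is_group Ac[OF u(1)]] by blast
        then show ?thesis by (simp add: B_def)
      qed
      ultimately show ?thesis using u Ac by (auto simp: B_def KS)
    qed
    \<comment> \<open>As long as \<open>A\<close> is not exhausted, each step of the series gains at
      least one element of \<open>A\<close>.\<close>
    have "A \<subseteq> K i \<or> i < card (A \<inter> K i)" for i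
    proof (induction i)
      case 0
      have "\<one> \<in> A \<inter> K 0" using A K0 by (simp add: subgroup.one_closed)
      then have "card (A \<inter> K 0) > 0" using cardA card_gt_0_iff by blast
      then show ?case by simp
    next
      case (Suc i)
      show ?case
      proof (cases "A \<subseteq> K i")
        case True then show ?thesis using Ksub by blast
      next
        case False
        then obtain u where "u \<in> A - K i" "u \<in> K (Suc i)" using grow by blast
        then have "A \<inter> K i \<subset> A \<inter> K (Suc i)" using Ksub[of i] by blast
        then have "card (A \<inter> K i) < card (A \<inter> K (Suc i))" using cardA by (intro psubset_card_mono) auto
        then show ?thesis using Suc False by auto
      qed
    qed
    from this[of "p ^ card (carrier P)"] have "A \<subseteq> K (p ^ card (carrier P))"
      using cardA card_mono[of A "A \<inter> K (p ^ card (carrier P))"] by auto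
    then show ?thesis using vA by auto
  qed
  then show ?thesis using Ksub subgroup.subset by blast
qed

section \<open>The theorems of Dietzmann and Schur\<close>

context group
begin

abbreviation wprod :: "'a list \<Rightarrow> 'a" where
  "wprod w \<equiv> foldr (\<otimes>) w \<one>"

lemma wprod_closed: "set w \<subseteq> carrier G \<Longrightarrow> wprod w \<in> carrier G"
  by (induction w) auto

lemma wprod_append:
  "set u \<subseteq> carrier G \<Longrightarrow> set w \<subseteq> carrier G \<Longrightarrow> wprod (u @ w) = wprod u \<otimes> wprod w"
  by (induction u) (auto simp: m_assoc wprod_closed)

lemma wprod_replicate: "s \<in> carrier G \<Longrightarrow> wprod (replicate n s) = s [^] n"
proof (induction n)
  case (Suc n)
  then show ?case using nat_pow_Suc2[of s n] by simp
qed simp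

text \<open>A power of \<open>s\<close> moves left past a letter \<open>t\<close> at the price of
  conjugating \<open>t\<close>, and the conjugate is again a letter in \<open>S\<close>; so the
  total number of letters does not change.\<close>

lemma wprod_collect:
  assumes S: "S \<subseteq> carrier G" and conj: "\<And>s t. s \<in> S \<Longrightarrow> t \<in> S \<Longrightarrow> cj s t \<in> S"
    and s: "s \<in> S"
  shows "set w \<subseteq> S \<Longrightarrow> j \<le> count_list w s \<Longrightarrow>
    \<exists>w'. set w' \<subseteq> S \<and> length w' + j = length w \<and> wprod w = s [^] j \<otimes> wprod w'"
proof (induction w arbitrary: j)
  case Nil
  then show ?case by auto
next
  case (Cons t u)
  have sc: "s \<in> carrier G" "t \<in> carrier G" "set u \<subseteq> carrier G" using S s Cons.prems by auto
  show ?case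
  proof (cases j)
    case 0
    then show ?thesis using Cons.prems sc by (intro exI[of _ "t # u"]) (auto simp: wprod_closed)
  next
    case (Suc i)
    show ?thesis
    proof (cases "t = s")
      case True
      then have "i \<le> count_list u s" using Cons.prems Suc by simp
      then obtain u' where u': "set u' \<subseteq> S" "length u' + i = length u" "wprod u = s [^] i \<otimes> wprod u'"
        using Cons.IH[of i] Cons.prems by auto
      then have "wprod u' \<in> carrier G" using S wprod_closed by auto
      then have "wprod (t # u) = s [^] j \<otimes> wprod u'"
        using u' sc True Suc nat_pow_Suc2[of s i] by (simp add: m_assoc[symmetric])
      then show ?thesis using u' Suc by auto
    next
      case False
      then obtain u' where u': "set u' \<subseteq> S" "length u' + j = length u" "wprod u = s [^] j \<otimes> wprod u'"
        using Cons.IH[of j] Cons.prems by auto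
      have uc: "wprod u' \<in> carrier G" using u' S wprod_closed by auto
      have "cj (s [^] k) t \<in> S" for k :: nat
      proof (induction k)
        case 0 then show ?case using Cons.prems sc by simp
      next
        case (Suc k)
        have "cj (s [^] Suc k) t = cj s (cj (s [^] k) t)" using sc by (simp add: cj_cj)
        then show ?case using conj s Suc by simp
      qed
      moreover have "wprod (t # u) = s [^] j \<otimes> wprod (cj (s [^] j) t # u')"
        using sc uc u' by (simp add: m_assoc[symmetric] mult_cj)
      ultimately show ?thesis using u' by (intro exI[of _ "cj (s [^] j) t # u'"]) auto
    qed
  qed
qed

text \<open>Dietzmann's lemma: collecting \<open>n\<close> equal letters of a word to the front cancels them, so every
  element of the generated subgroup is represented by a word of bounded length.\<close>

theorem finite_generate_torsion:
  assumes fin: "finite S" and S: "S \<subseteq> carrier G" and conj: "\<And>s t. s \<in> S \<Longrightarrow> t \<in> S \<Longrightarrow> cj s t \<in> S"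
    and n: "n > 0" "\<And>s. s \<in> S \<Longrightarrow> s [^] (n::nat) = \<one>"
  shows "finite (generate G S)"
proof -
  let ?N = "card S * n"
  have short: "\<exists>w'. set w' \<subseteq> S \<and> length w' \<le> ?N \<and> wprod w' = wprod w" if "set w \<subseteq> S" for w
    using that
  proof (induction "length w" arbitrary: w rule: less_induct)
    case less
    show ?case
    proof (cases "length w \<le> ?N")
      case False
      \<comment> \<open>Pigeonhole: a word longer than \<open>?N\<close> repeats some letter at
        least \<open>n\<close> times.\<close>
      have "\<exists>s\<in>S. n \<le> count_list w s"
      proof (rule ccontr)
        assume "\<not> ?thesis"
        then have "(\<Sum>s\<in>S. count_list w s) \<le> (\<Sum>s\<in>S. n)" by (intro sum_mono) auto
        then show False using False sum_count_set[OF less.prems fin] by simp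
      qed
      then obtain s where s: "s \<in> S" "n \<le> count_list w s" by blast
      then obtain w' where w': "set w' \<subseteq> S" "length w' + n = length w" "wprod w = s [^] n \<otimes> wprod w'"
        using wprod_collect[OF S conj s(1) less.prems s(2)] by blast
      then have "wprod w = wprod w'" using n s S wprod_closed[of w'] by auto
      then show ?thesis using less.hyps[of w'] w' n by auto
    qed (use less.prems in auto)
  qed
  have "g \<in> wprod ` {w. set w \<subseteq> S}" if "g \<in> generate G S" for g
    using that
  proof (induction rule: generate.induct)
    case one
    then show ?case by (intro image_eqI[of _ _ "[]"]) auto
  next
    case (incl h)
    then show ?case using S by (intro image_eqI[of _ _ "[h]"]) auto
  next
    case (inv h)
    then have h: "h \<in> carrier G" using S by auto
    \<comment> \<open>The inverse of a letter is its power with exponent \<open>n - 1\<close>, so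
      words without inverses suffice.\<close>
    have "h [^] (n - 1) \<otimes> h = \<one>" using inv n h by (metis nat_pow_Suc Suc_diff_1)
    then have "inv h = wprod (replicate (n - 1) h)"
      unfolding wprod_replicate[OF h] using h by (intro inv_equality) auto
    then show ?case using inv by (intro image_eqI[of _ _ "replicate (n - 1) h"]) auto
  next
    case (eng h1 h2)
    then obtain u w where "set u \<subseteq> S" "set w \<subseteq> S" "h1 = wprod u" "h2 = wprod w" by auto
    then show ?case
      using S wprod_append[of u w] by (intro image_eqI[of _ _ "u @ w"]) (auto simp del: foldr_append)
  qed
  then have "generate G S \<subseteq> wprod ` {w. set w \<subseteq> S \<and> length w \<le> ?N}"
    using short by (fastforce simp: image_iff)
  then show ?thesis using finite_lists_length_le[OF fin] finite_subset by blast
qed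

section \<open>Schur's theorem in a relative form\<close>

lemma Mod_comm_group:
  assumes "N \<lhd> G" "\<And>x y. x \<in> carrier G \<Longrightarrow> y \<in> carrier G \<Longrightarrow> cm x y \<in> N"
  shows "comm_group (G Mod N)"
proof -
  interpret h: group_hom G "G Mod N" "\<lambda>x. N #> x" by (rule Mod_group_hom[OF assms(1)])
  note surj = Mod_group_hom(2)[OF assms(1)]
  show ?thesis
  proof (rule h.H.group_comm_groupI)
    fix u v assume "u \<in> carrier (G Mod N)" "v \<in> carrier (G Mod N)"
    then obtain x y where xy: "x \<in> carrier G" "y \<in> carrier G" "u = N #> x" "v = N #> y"
      unfolding surj[symmetric] by auto
    have "commutator (G Mod N) u v = \<one>\<^bsub>G Mod N\<^esub>"
      using hom_commutator[OF h.group_hom_axioms xy(1,2)] coset_eq_one_iff[OF assms(1), of "cm x y"] assms(2) xy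
      by simp
    then show "u \<otimes>\<^bsub>G Mod N\<^esub> v = v \<otimes>\<^bsub>G Mod N\<^esub> u"
      using h.H.commute_iff_cm[of u v] xy by simp
  qed
qed

text \<open>In the abelianization the power map is a homomorphism.\<close>

lemma pow_commutator_mem:
  assumes "a \<in> carrier G" "b \<in> carrier G"
  shows "inv (a [^] (n::nat)) \<otimes> b [^] n \<otimes> inv ((inv a \<otimes> b) [^] n) \<in> generate G (commutator_set G)"
proof -
  define D where "D = generate G (commutator_set G)"
  have D: "D \<lhd> G" unfolding D_def by (fact generate_commutators_normal)
  interpret h: group_hom G "G Mod D" "\<lambda>x. D #> x" by (rule Mod_group_hom[OF D])
  interpret Q: comm_group "G Mod D"
    by (rule Mod_comm_group[OF D]) (auto simp: D_def commutator_set_def intro: generate.incl)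
  let ?h = "\<lambda>x. D #> x"
  let ?x = "inv (a [^] n) \<otimes> b [^] n \<otimes> inv ((inv a \<otimes> b) [^] n)"
  have "?h ?x = (inv\<^bsub>G Mod D\<^esub> ?h a) [^]\<^bsub>G Mod D\<^esub> n \<otimes>\<^bsub>G Mod D\<^esub> ?h b [^]\<^bsub>G Mod D\<^esub> n
      \<otimes>\<^bsub>G Mod D\<^esub> inv\<^bsub>G Mod D\<^esub> ((inv\<^bsub>G Mod D\<^esub> ?h a \<otimes>\<^bsub>G Mod D\<^esub> ?h b) [^]\<^bsub>G Mod D\<^esub> n)"
    using assms by (simp add: h.hom_nat_pow h.H.nat_pow_inv del: mult_FactGroup one_FactGroup)
  also have "\<dots> = \<one>\<^bsub>G Mod D\<^esub>"
    using assms by (simp add: Q.nat_pow_distrib del: mult_FactGroup one_FactGroup)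
  finally show ?thesis using coset_eq_one_iff[OF D, of ?x] assms by (simp add: D_def)
qed

lemma subgroup_commutator: "subgroup H G \<Longrightarrow> x \<in> H \<Longrightarrow> y \<in> H \<Longrightarrow> commutator (G\<lparr>carrier := H\<rparr>) x y = cm x y"
  by (simp add: commutator_def m_inv_consistent)

text \<open>A relative form of Schur's theorem, in which a finite-index subgroup \<open>U\<close> replaces the centralizer of \<open>L\<close>.\<close>

theorem finite_commutators_central:
  assumes L: "L \<lhd> G" and Z: "subgroup Z G" "Z \<subseteq> L" and central: "\<And>z x. z \<in> Z \<Longrightarrow> x \<in> carrier G \<Longrightarrow> cm z x = \<one>"
    and finZ: "finite ((\<lambda>x. Z #> x) ` L)"
    and U: "subgroup U G" "finite (rcosets U)" and LU: "\<And>l u. l \<in> L \<Longrightarrow> u \<in> U \<Longrightarrow> cm l u = \<one>"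
  shows "finite (generate G {cm l x | l x. l \<in> L \<and> x \<in> carrier G})"
proof -
  let ?S = "{cm l x | l x. l \<in> L \<and> x \<in> carrier G}"
  have Ls: "subgroup L G" using L normal_imp_subgroup by blast
  have Lc: "l \<in> carrier G" if "l \<in> L" for l using that Ls subgroup.subset by blast
  have Zc: "z \<in> carrier G" if "z \<in> Z" for z using that Z Lc by blast
  have Uc: "u \<in> carrier G" if "u \<in> U" for u using that U subgroup.subset by blast
  have cmL: "cm l x \<in> L" if "l \<in> L" "x \<in> carrier G" for l x using normal_cm_left[OF L] that by blast
  \<comment> \<open>The commutator depends only on the cosets of \<open>l\<close> modulo
    \<open>Z\<close> and of \<open>x\<close> modulo \<open>U\<close>, which leaves finitely many
    values.\<close>
  have dep: "cm (z \<otimes> l) (u \<otimes> x) = cm l x" if "z \<in> Z" "l \<in> L" "u \<in> U" "x \<in> carrier G" for z l u x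
    using that Lc Zc Uc Z(2) LU central by (simp add: cm_mult_left cm_mult_right subset_iff)
  define r where "r C = (SOME x. x \<in> C)" for C :: "'a set"
  have "?S \<subseteq> (\<lambda>(C, C'). cm (r C) (r C')) ` (((\<lambda>x. Z #> x) ` L) \<times> rcosets U)"
  proof
    fix s assume "s \<in> ?S"
    then obtain l x where lx: "l \<in> L" "x \<in> carrier G" "s = cm l x" by blast
    have "r (Z #> l) \<in> Z #> l" unfolding r_def using rcos_self[OF Lc[OF lx(1)] Z(1)] by (rule someI)
    then obtain z where z: "z \<in> Z" "r (Z #> l) = z \<otimes> l" by (auto simp: r_coset_def)
    have "r (U #> x) \<in> U #> x" unfolding r_def using rcos_self[OF lx(2) U(1)] by (rule someI)
    then obtain u where u: "u \<in> U" "r (U #> x) = u \<otimes> x" by (auto simp: r_coset_def)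
    have "s = cm (r (Z #> l)) (r (U #> x))" using dep z u lx by simp
    then show "s \<in> (\<lambda>(C, C'). cm (r C) (r C')) ` (((\<lambda>x. Z #> x) ` L) \<times> rcosets U)"
      using lx subgroup.subset[OF U(1)] by (intro image_eqI[of _ _ "(Z #> l, U #> x)"]) (auto intro: rcosetsI)
  qed
  then have finS: "finite ?S" by (rule finite_subset) (use finZ U in auto)
  interpret L: group "G\<lparr>carrier := L\<rparr>" using Ls is_group by (rule subgroup.subgroup_is_group)
  let ?L = "G\<lparr>carrier := L\<rparr>"
  have rZ: "rcosets\<^bsub>?L\<^esub> Z = (\<lambda>x. Z #> x) ` L" by (auto simp: RCOSETS_def r_coset_def)
  have ZL: "subgroup Z ?L" using subgroup_incl[OF Z(1) Ls Z(2)] .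
  define n where "n = card ((\<lambda>x. Z #> x) ` L)"
  have n0: "n > 0" using finZ subgroup.one_closed[OF Ls] by (auto simp: n_def card_gt_0_iff)
  \<comment> \<open>Transfer from \<open>L\<close> to its central subgroup \<open>Z\<close>.
    Conjugation fixes \<open>Z\<close> pointwise, which is the fusion hypothesis; so the derived
    subgroup of \<open>L\<close> is killed by \<open>n\<close>.\<close>
  have D1: "d [^] n = \<one>" if d: "d \<in> generate ?L (commutator_set ?L)" for d
  proof -
    have "d [^]\<^bsub>?L\<^esub> card (rcosets\<^bsub>?L\<^esub> Z) = \<one>\<^bsub>?L\<^esub>"
    proof (rule L.transfer_power[OF ZL _ _ d])
      show "finite (rcosets\<^bsub>?L\<^esub> Z)" using rZ finZ by simp
      show "x \<otimes>\<^bsub>?L\<^esub> y = y \<otimes>\<^bsub>?L\<^esub> x" if "x \<in> Z" "y \<in> Z" for x y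
        using that central[of x y] Zc commute_iff_cm[of x y] by simp
      fix x and j :: nat
      assume "x \<in> carrier ?L" and m: "x \<otimes>\<^bsub>?L\<^esub> d [^]\<^bsub>?L\<^esub> j \<otimes>\<^bsub>?L\<^esub> inv\<^bsub>?L\<^esub> x \<in> Z"
      then have x: "x \<in> L" "x \<in> carrier G" using Lc by auto
      have dL: "d \<in> L" using L.generate_in_carrier[OF L.commutator_set_subset d] by simp
      then have dj: "d [^] j \<in> carrier G" using Lc by simp
      have m': "x \<otimes> d [^] j \<otimes> inv x \<in> Z"
        using m x Ls by (simp add: m_inv_consistent flip: nat_pow_consistent)
      have "cj x (x \<otimes> d [^] j \<otimes> inv x) = x \<otimes> d [^] j \<otimes> inv x"
        using central[OF m' x(2)] cj_eq_iff[of x "x \<otimes> d [^] j \<otimes> inv x"] x dj by simp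
      then have "x \<otimes> d [^] j \<otimes> inv x = d [^] j" using x dj by (simp add: cj_def m_assoc)
      then show "x \<otimes>\<^bsub>?L\<^esub> d [^]\<^bsub>?L\<^esub> j \<otimes>\<^bsub>?L\<^esub> inv\<^bsub>?L\<^esub> x = d [^]\<^bsub>?L\<^esub> j"
        using x Ls by (simp add: m_inv_consistent flip: nat_pow_consistent)
    qed
    then show ?thesis using rZ by (simp add: n_def flip: nat_pow_consistent)
  qed
  have powZ: "l [^] n \<in> Z" if l: "l \<in> L" for l
  proof -
    have nZ: "Z \<lhd> ?L"
    proof (rule L.normalI_cj[OF ZL])
      fix g x assume "g \<in> carrier ?L" "x \<in> Z"
      then show "L.cj g x \<in> Z"
        using central[of x g] Lc[of g] Zc[of x] Ls cj_eq_iff[of g x] by (simp add: L.cj_def cj_def m_inv_consistent)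
    qed
    interpret h: group_hom ?L "?L Mod Z" "\<lambda>x. Z #>\<^bsub>?L\<^esub> x" by (rule L.Mod_group_hom[OF nZ])
    have "(Z #>\<^bsub>?L\<^esub> l) [^]\<^bsub>?L Mod Z\<^esub> order (?L Mod Z) = \<one>\<^bsub>?L Mod Z\<^esub>"
      using l by (intro h.H.pow_order_eq_1) (simp add: carrier_FactGroup)
    moreover have "order (?L Mod Z) = n" using rZ by (simp add: order_def FactGroup_def n_def)
    ultimately have "Z #>\<^bsub>?L\<^esub> (l [^]\<^bsub>?L\<^esub> n) = Z"
      using h.hom_nat_pow[of l n] l by simp
    then show ?thesis
      using L.coset_eq_one_iff[OF nZ, of "l [^] n"] l Ls by (simp add: subgroup_nat_pow flip: nat_pow_consistent)
  qed
  \<comment> \<open>With \<open>s = l^-1 l^x\<close> and \<open>l^n\<close> central,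
    \<open>l\<close> and \<open>l^x\<close> have the same \<open>n\<close>-th power. Hence
    \<open>s^n\<close> lies in the derived subgroup of \<open>L\<close>, which the second factor
    \<open>n\<close> kills.\<close>
  have torsion: "s [^] (n * n) = \<one>" if "s \<in> ?S" for s
  proof -
    from that obtain l x where lx: "l \<in> L" "x \<in> carrier G" "s = cm l x" by blast
    define b where "b = cj x l"
    have b: "b \<in> L" "b \<in> carrier G" using lx normal_cj[OF L] Lc by (auto simp: b_def)
    have s: "s = inv l \<otimes> b" using lx Lc by (simp add: b_def cm_eq_cj)
    have sc: "s \<in> carrier G" "s \<in> L" using lx cmL Lc by auto
    have "b [^] n = cj x (l [^] n)" using lx Lc by (simp add: b_def cj_nat_pow)
    also have "\<dots> = l [^] n" using central[OF powZ[OF lx(1)] lx(2)] cj_eq_iff[of x "l [^] n"] lx Lc by simp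
    finally have bl: "b [^] n = l [^] n" .
    have "inv\<^bsub>?L\<^esub> (l [^]\<^bsub>?L\<^esub> n) \<otimes>\<^bsub>?L\<^esub> b [^]\<^bsub>?L\<^esub> n \<otimes>\<^bsub>?L\<^esub> inv\<^bsub>?L\<^esub> ((inv\<^bsub>?L\<^esub> l \<otimes>\<^bsub>?L\<^esub> b) [^]\<^bsub>?L\<^esub> n) \<in> generate ?L (commutator_set ?L)"
      using L.pow_commutator_mem[of l b n] lx b by simp
    then have "inv (l [^] n) \<otimes> b [^] n \<otimes> inv (s [^] n) \<in> generate ?L (commutator_set ?L)"
      using lx b Ls sc by (simp add: s m_inv_consistent subgroup_nat_pow flip: nat_pow_consistent)
    then have "inv (s [^] n) \<in> generate ?L (commutator_set ?L)"
      using lx Lc sc by (simp add: bl)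
    then have "inv (s [^] n) [^] n = \<one>" by (rule D1)
    then have "inv ((s [^] n) [^] n) = \<one>" using sc by (simp add: nat_pow_inv)
    then show ?thesis using sc by (metis inv_inv inv_one nat_pow_closed nat_pow_pow)
  qed
  show ?thesis
  proof (rule finite_generate_torsion[OF finS])
    show "?S \<subseteq> carrier G" using Lc by auto
    show "cj s t \<in> ?S" if "s \<in> ?S" "t \<in> ?S" for s t
    proof -
      from that obtain l x where lx: "l \<in> L" "x \<in> carrier G" "t = cm l x" by blast
      have sc: "s \<in> carrier G" using that Lc by auto
      have "cj s t = cm (cj s l) (cj s x)" using lx sc Lc by (simp add: cj_cm)
      then show ?thesis using lx sc normal_cj[OF L sc lx(1)] by auto
    qed
    show "n * n > 0" using n0 by simp
  qed (use torsion in blast)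
qed

lemma finite_commutators_central_mod:
  assumes R: "R \<lhd> G" and L: "L \<lhd> G" and Z: "subgroup Z G" "Z \<subseteq> L"
    and central: "\<And>z x. z \<in> Z \<Longrightarrow> x \<in> carrier G \<Longrightarrow> cm z x \<in> R"
    and finZ: "finite ((\<lambda>x. Z #> x) ` L)"
    and U: "subgroup U G" "finite (rcosets U)" and LU: "\<And>l u. l \<in> L \<Longrightarrow> u \<in> U \<Longrightarrow> cm l u \<in> R"
  shows "finite ((\<lambda>x. R #> x) ` generate G {cm l x | l x. l \<in> L \<and> x \<in> carrier G})"
proof -
  let ?Q = "G Mod R" and ?h = "\<lambda>x. R #> x"
  interpret h: group_hom G ?Q ?h by (rule Mod_group_hom[OF R])
  note surj = Mod_group_hom(2)[OF R]
  have Lc: "L \<subseteq> carrier G" "Z \<subseteq> carrier G" "U \<subseteq> carrier G"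
    using L Z U normal_imp_subgroup subgroup.subset by blast+
  have one: "commutator ?Q (?h x) (?h y) = \<one>\<^bsub>?Q\<^esub>" if "x \<in> carrier G" "y \<in> carrier G" "cm x y \<in> R" for x y
    using hom_commutator[OF h.group_hom_axioms that(1,2)] coset_eq_one_iff[OF R, of "cm x y"] that by simp
  have coset: "?h ` (H #> x) = (?h ` H) #>\<^bsub>?Q\<^esub> ?h x" if "H \<subseteq> carrier G" "x \<in> carrier G" for H x
  proof -
    have "?h (y \<otimes> x) = ?h y \<otimes>\<^bsub>?Q\<^esub> ?h x" if "y \<in> H" for y
      using that \<open>H \<subseteq> carrier G\<close> \<open>x \<in> carrier G\<close> by (intro h.hom_mult) auto
    then show ?thesis by (auto simp: r_coset_def image_iff simp del: mult_FactGroup)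
  qed
  have "finite (generate ?Q {commutator ?Q l x | l x. l \<in> ?h ` L \<and> x \<in> carrier ?Q})"
  proof (rule h.H.finite_commutators_central)
    show "?h ` L \<lhd> ?Q"
      using normal.surj_hom_normal_subgroup[OF L h.group_hom_axioms] surj by simp
    show "subgroup (?h ` Z) ?Q" using h.subgroup_img_is_subgroup[OF Z(1)] .
    show "?h ` Z \<subseteq> ?h ` L" using Z by auto
    show "commutator ?Q z x = \<one>\<^bsub>?Q\<^esub>" if "z \<in> ?h ` Z" "x \<in> carrier ?Q" for z x
      using that one central Lc unfolding surj[symmetric] by blast
    have "(\<lambda>x. (?h ` Z) #>\<^bsub>?Q\<^esub> x) ` (?h ` L) = (\<lambda>C. ?h ` C) ` ((\<lambda>x. Z #> x) ` L)"
      unfolding image_image using coset[OF Lc(2)] Lc(1) by (intro image_cong) auto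
    then show "finite ((\<lambda>x. (?h ` Z) #>\<^bsub>?Q\<^esub> x) ` (?h ` L))" using finZ by simp
    show "subgroup (?h ` U) ?Q" using h.subgroup_img_is_subgroup[OF U(1)] .
    have "rcosets\<^bsub>?Q\<^esub> (?h ` U) = (\<lambda>C. ?h ` C) ` (rcosets U)"
      using coset[OF Lc(3)] unfolding RCOSETS_def surj[symmetric] by auto
    then show "finite (rcosets\<^bsub>?Q\<^esub> (?h ` U))" using U by simp
    show "commutator ?Q l u = \<one>\<^bsub>?Q\<^esub>" if "l \<in> ?h ` L" "u \<in> ?h ` U" for l u
      using that one LU Lc by blast
  qed
  moreover have img: "{commutator ?Q l x | l x. l \<in> ?h ` L \<and> x \<in> carrier ?Q} = ?h ` {cm l x | l x. l \<in> L \<and> x \<in> carrier G}"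
  proof -
    have "commutator ?Q (?h l) (?h x) = ?h (cm l x)" if "l \<in> L" "x \<in> carrier G" for l x
      using hom_commutator[OF h.group_hom_axioms] that Lc(1) by (simp add: subsetD)
    then show ?thesis unfolding surj[symmetric] by blast
  qed
  moreover have "{cm l x | l x. l \<in> L \<and> x \<in> carrier G} \<subseteq> carrier G" using Lc by auto
  ultimately show ?thesis by (simp add: h.generate_img[symmetric])
qed

lemma hyper_mono_carrier: "E \<subseteq> E' \<Longrightarrow> hyper G E D B i \<subseteq> hyper G E' D B i"
  by (induction i) auto

end

section \<open>Actions on abelian sections\<close>

locale abelian_section = group +
  fixes V W
  assumes V: "V \<lhd> G" and W: "W \<lhd> G" and WV: "W \<subseteq> V"
    and VV: "v \<in> V \<Longrightarrow> v' \<in> V \<Longrightarrow> commutator G v v' \<in> W"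
begin

abbreviation "GV \<equiv> G\<lparr>carrier := V\<rparr>"
definition "Q = GV Mod W"
abbreviation "\<pi> v \<equiv> W #> v"

lemma V_sub: "subgroup V G" and W_sub: "subgroup W G"
  using V W normal_imp_subgroup by blast+

lemma V_carrier: "v \<in> V \<Longrightarrow> v \<in> carrier G" and W_carrier: "v \<in> W \<Longrightarrow> v \<in> carrier G"
  using V_sub W_sub subgroup.subset by blast+

sublocale GV: group GV
  using V_sub is_group by (rule subgroup.subgroup_is_group)

lemma W_normal_GV: "W \<lhd> GV"
  using normal_restrict_supergroup[OF V_sub W WV] .

sublocale Q: comm_group Q
  unfolding Q_def using VV
  by (intro GV.Mod_comm_group[OF W_normal_GV]) (simp add: subgroup_commutator[OF V_sub])

sublocale \<pi>: group_hom GV Q "\<lambda>v. W #> v"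
  using GV.Mod_group_hom(1)[OF W_normal_GV] by (simp add: Q_def)

lemma \<pi>_surj: "carrier Q = \<pi> ` V"
  using GV.Mod_group_hom(2)[OF W_normal_GV] by (simp add: Q_def)

lemma Q_one: "\<one>\<^bsub>Q\<^esub> = W"
  by (simp add: Q_def)

lemma \<pi>_closed [simp]: "v \<in> V \<Longrightarrow> \<pi> v \<in> carrier Q"
  by (simp add: \<pi>_surj)

lemma \<pi>_mult: "v \<in> V \<Longrightarrow> w \<in> V \<Longrightarrow> \<pi> (v \<otimes> w) = \<pi> v \<otimes>\<^bsub>Q\<^esub> \<pi> w"
  using \<pi>.hom_mult[of v w] by simp

lemma \<pi>_inv: "v \<in> V \<Longrightarrow> \<pi> (inv v) = inv\<^bsub>Q\<^esub> \<pi> v"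
  using \<pi>.hom_inv[of v] by (simp add: m_inv_consistent[OF V_sub])

lemma \<pi>_pow: "v \<in> V \<Longrightarrow> \<pi> (v [^] n) = \<pi> v [^]\<^bsub>Q\<^esub> (n::nat)"
  using \<pi>.hom_nat_pow[of v n] by (simp flip: nat_pow_consistent)

lemma \<pi>_one_iff: "v \<in> V \<Longrightarrow> \<pi> v = \<one>\<^bsub>Q\<^esub> \<longleftrightarrow> v \<in> W"
  using coset_eq_one_iff[OF W, of v] V_carrier by (simp add: Q_one)

lemma \<pi>_eq_iff: "v \<in> V \<Longrightarrow> w \<in> V \<Longrightarrow> \<pi> v = \<pi> w \<longleftrightarrow> inv v \<otimes> w \<in> W"
proof -
  assume vw: "v \<in> V" "w \<in> V"
  then have "inv v \<otimes> w \<in> V" using V_sub by (simp add: subgroup.m_closed subgroup.m_inv_closed)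
  then have "inv v \<otimes> w \<in> W \<longleftrightarrow> inv\<^bsub>Q\<^esub> \<pi> v \<otimes>\<^bsub>Q\<^esub> \<pi> w = \<one>\<^bsub>Q\<^esub>"
    using vw V_sub by (simp add: \<pi>_mult \<pi>_inv subgroup.m_inv_closed flip: \<pi>_one_iff)
  also have "\<dots> \<longleftrightarrow> \<pi> v = \<pi> w" using vw by (metis Q.inv_closed Q.inv_equality Q.inv_inv Q.l_inv \<pi>_closed)
  finally show ?thesis by simp
qed

text \<open>Conjugates whole cosets, so that no representative has to be chosen. It is a right
  action: \<open>act (g h)\<close> is \<open>act h\<close> after \<open>act g\<close>.\<close>

definition act :: "'a \<Rightarrow> 'a set \<Rightarrow> 'a set" where
  "act g C = cj g ` C"

lemma act_\<pi>: "g \<in> carrier G \<Longrightarrow> v \<in> V \<Longrightarrow> act g (\<pi> v) = \<pi> (cj g v)"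
proof -
  assume g: "g \<in> carrier G" and v: "v \<in> V"
  note vc = V_carrier[OF v]
  show ?thesis
  proof
    show "act g (\<pi> v) \<subseteq> \<pi> (cj g v)"
      using g vc W_carrier normal_cj[OF W g] by (auto simp: act_def r_coset_def cj_mult)
    show "\<pi> (cj g v) \<subseteq> act g (\<pi> v)"
    proof
      fix z assume "z \<in> \<pi> (cj g v)"
      then obtain w where w: "w \<in> W" "z = w \<otimes> cj g v" by (auto simp: r_coset_def)
      then have "z = cj g (cj (inv g) w \<otimes> v)" using g vc W_carrier by (simp add: cj_mult)
      moreover have "cj (inv g) w \<in> W" using normal_cj[OF W] g w by simp
      ultimately show "z \<in> act g (\<pi> v)" by (auto simp: act_def r_coset_def)
    qed
  qed
qed

lemma cj_V [simp]: "g \<in> carrier G \<Longrightarrow> v \<in> V \<Longrightarrow> cj g v \<in> V"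
  using normal_cj[OF V] .

lemma cm_V [simp]: "g \<in> carrier G \<Longrightarrow> v \<in> V \<Longrightarrow> cm v g \<in> V"
  using normal_cm_left[OF V] .

lemma act_hom: "g \<in> carrier G \<Longrightarrow> act g \<in> hom Q Q"
proof -
  assume g: "g \<in> carrier G"
  have "act g (\<pi> v \<otimes>\<^bsub>Q\<^esub> \<pi> w) = act g (\<pi> v) \<otimes>\<^bsub>Q\<^esub> act g (\<pi> w)" if "v \<in> V" "w \<in> V" for v w
    using that g V_carrier V_sub by (simp add: act_\<pi> cj_mult subgroup.m_closed flip: \<pi>_mult)
  then show ?thesis using g by (auto simp: hom_def \<pi>_surj act_\<pi>)
qed

lemma act_pow: "g \<in> carrier G \<Longrightarrow> v \<in> V \<Longrightarrow> (act g ^^ n) (\<pi> v) = \<pi> (cj (g [^] n) v)"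
  by (induction n) (auto simp: act_\<pi> cj_cj V_carrier)

lemma act_delta: "g \<in> carrier G \<Longrightarrow> v \<in> V \<Longrightarrow> act g (\<pi> v) \<otimes>\<^bsub>Q\<^esub> inv\<^bsub>Q\<^esub> \<pi> v = \<pi> (cm v g)"
  using V_carrier V_sub
  by (simp add: act_\<pi> Q.m_comm cm_eq_cj \<pi>_mult \<pi>_inv subgroup.m_inv_closed)

lemma act_delta_pow: "g \<in> carrier G \<Longrightarrow> v \<in> V \<Longrightarrow>
    ((\<lambda>u. act g u \<otimes>\<^bsub>Q\<^esub> inv\<^bsub>Q\<^esub> u) ^^ n) (\<pi> v) = \<pi> (((\<lambda>v. cm v g) ^^ n) v) \<and> ((\<lambda>v. cm v g) ^^ n) v \<in> V"
  by (induction n) (auto simp: act_delta)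

text \<open>Taking commutators with \<open>g\<close> induces the endomorphism \<open>g - 1\<close>
  of \<open>V / W\<close>, so the condition reads \<open>(g - 1)^k = 0\<close> there.\<close>

definition unip :: "'a \<Rightarrow> nat \<Rightarrow> bool" where
  "unip g k \<longleftrightarrow> (\<forall>v\<in>V. ((\<lambda>v. cm v g) ^^ k) v \<in> W)"

definition cent :: "'a set" where
  "cent = {g \<in> carrier G. \<forall>v\<in>V. cm v g \<in> W}"

lemma cent_iff: "g \<in> carrier G \<Longrightarrow> g \<in> cent \<longleftrightarrow> (\<forall>v\<in>V. act g (\<pi> v) = \<pi> v)"
proof -
  assume g: "g \<in> carrier G"
  have "act g (\<pi> v) = \<pi> v \<longleftrightarrow> cm v g \<in> W" if "v \<in> V" for v
    using \<pi>_eq_iff[OF that cj_V[OF g that]] g that V_carrier by (auto simp: act_\<pi> cm_eq_cj)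
  then show ?thesis using g by (simp add: cent_def)
qed

lemma Q_exponent:
  assumes "\<And>v. v \<in> V \<Longrightarrow> v [^] (p::nat) \<in> W" "u \<in> carrier Q"
  shows "u [^]\<^bsub>Q\<^esub> p = \<one>\<^bsub>Q\<^esub>"
proof -
  obtain v where v: "v \<in> V" "u = \<pi> v" using assms(2) \<pi>_surj by auto
  then show ?thesis
    using assms(1) \<pi>_one_iff[of "v [^] p"] \<pi>_pow[of v p] subgroup_nat_pow[OF V_sub] by simp
qed

lemma cent_normal: "cent \<lhd> G"
  unfolding cent_def using W V by (rule normal_commutator_right)

lemma unip_periodic:
  assumes g: "g \<in> carrier G" "unip g k" "g [^] (n::nat) \<in> cent" and v: "v \<in> V"
  shows "cm v g [^] (n ^ k) \<in> W"
proof -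
  let ?d = "\<lambda>u. act g u \<otimes>\<^bsub>Q\<^esub> inv\<^bsub>Q\<^esub> u"
  have "?d (\<pi> v) [^]\<^bsub>Q\<^esub> (n ^ k) = \<one>\<^bsub>Q\<^esub>"
  proof (rule Q.unipotent_periodic_endo[OF act_hom])
    show "(act g ^^ n) u = u" if "u \<in> carrier Q" for u
      using that g cent_iff[of "g [^] n"] by (auto simp: \<pi>_surj act_pow act_\<pi>)
    show "(?d ^^ k) (\<pi> v) = \<one>\<^bsub>Q\<^esub>"
      using act_delta_pow[OF g(1) v, of k] g(2) v \<pi>_one_iff by (auto simp: unip_def)
  qed (use g v in auto)
  then show ?thesis
    using act_delta[OF g(1) v] g v V_sub \<pi>_one_iff[of "cm v g [^] (n ^ k)"]
    by (simp add: subgroup_nat_pow flip: \<pi>_pow)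
qed

lemma unip_exponent:
  assumes g: "g \<in> carrier G" "unip g k" and exp: "\<And>v. v \<in> V \<Longrightarrow> v [^] (p::nat) \<in> W"
  shows "g [^] (p ^ k) \<in> cent"
proof -
  let ?d = "\<lambda>u. act g u \<otimes>\<^bsub>Q\<^esub> inv\<^bsub>Q\<^esub> u"
  have "(act g ^^ (p ^ k)) (\<pi> v) = \<pi> v" if v: "v \<in> V" for v
  proof (rule Q.unipotent_endo_exponent[OF act_hom])
    show "u [^]\<^bsub>Q\<^esub> p = \<one>\<^bsub>Q\<^esub>" if "u \<in> carrier Q" for u
      using Q_exponent[OF exp that] .
    show "(?d ^^ k) (\<pi> v) = \<one>\<^bsub>Q\<^esub>"
      using act_delta_pow[OF g(1) v, of k] g(2) v \<pi>_one_iff by (auto simp: unip_def)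
  qed (use g v in auto)
  then show ?thesis using g cent_iff[of "g [^] (p ^ k)"] by (simp add: act_pow act_\<pi>)
qed

text \<open>\<open>D\<close> acts on \<open>V / W\<close> through a finite group, because
  \<open>D \<inter> N\<close> acts trivially and \<open>N\<close> has finite index. By
  \<open>Dp\<close> this group is a \<open>p\<close>-group, and it acts on an abelian group killed
  by \<open>p\<close>.\<close>

lemma prime_section_nilpotent:
  fixes p :: nat
  assumes exp: "\<And>v. v \<in> V \<Longrightarrow> v [^] p \<in> W" and p: "Factorial_Ring.prime p"
    and D: "D \<lhd> G" and N: "subgroup N G" "finite (rcosets N)" "D \<inter> N \<subseteq> cent"
    and Dp: "\<And>d. d \<in> D \<Longrightarrow> \<exists>j. d [^] (p ^ j) \<in> cent"
  shows "\<exists>m. V \<subseteq> hyper G (carrier G) D W m"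
proof -
  have Ds: "subgroup D G" using D normal_imp_subgroup by blast
  have Dc: "d \<in> carrier G" if "d \<in> D" for d using that Ds subgroup.subset by blast
  let ?GD = "G\<lparr>carrier := D\<rparr>"
  interpret GD: group ?GD using Ds is_group by (rule subgroup.subgroup_is_group)
  \<comment> \<open>Inversion turns the right action \<open>act\<close> into the left action that
    \<open>group_action\<close> requires.\<close>
  define \<phi> where "\<phi> d = restrict (act (inv d)) (carrier Q)" for d
  have \<phi>: "\<phi> d (\<pi> v) = \<pi> (cj (inv d) v)" if "d \<in> D" "v \<in> V" for d v
    using that Dc by (simp add: \<phi>_def act_\<pi>)
  have \<phi>cl: "\<phi> d u \<in> carrier Q" if "d \<in> D" "u \<in> carrier Q" for d u
    using that \<phi> Dc by (auto simp: \<pi>_surj)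
  have \<phi>cmp: "\<phi> d (\<phi> e u) = \<phi> (d \<otimes> e) u" if "d \<in> D" "e \<in> D" "u \<in> carrier Q" for d e u
    using that \<phi> Dc V_carrier subgroup.m_closed[OF Ds] by (auto simp: \<pi>_surj cj_cj inv_mult_group)
  have \<phi>1: "\<phi> \<one> u = u" if "u \<in> carrier Q" for u
    using that \<phi>[OF subgroup.one_closed[OF Ds]] V_carrier by (auto simp: \<pi>_surj)
  have \<phi>Bij: "\<phi> d \<in> Bij (carrier Q)" if d: "d \<in> D" for d
  proof -
    have "bij_betw (\<phi> d) (carrier Q) (carrier Q)"
      by (rule bij_betw_byWitness[where f' = "\<phi> (inv d)"])
        (use d Dc Ds \<phi>cmp \<phi>1 \<phi>cl in \<open>auto simp: subgroup.m_inv_closed\<close>)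
    then show ?thesis by (simp add: Bij_def \<phi>_def)
  qed
  let ?B = "BijGroup (carrier Q)"
  have "\<phi> \<in> hom ?GD ?B"
    using \<phi>Bij \<phi>cmp by (auto simp: hom_def BijGroup_def compose_def \<phi>_def restrict_def fun_eq_iff)
  then interpret \<phi>: group_hom ?GD ?B \<phi>
    using group_BijGroup GD.is_group by (simp add: group_hom_def group_hom_axioms_def)
  define P where "P = ?B\<lparr>carrier := \<phi> ` D\<rparr>"
  have PB: "subgroup (\<phi> ` D) ?B" using \<phi>.img_is_subgroup by simp
  then have gP: "group P" unfolding P_def using group_BijGroup by (rule subgroup.subgroup_is_group)
  interpret P: group P by fact
  have cP: "carrier P = \<phi> ` D" by (simp add: P_def)
  have "(\<lambda>x. x) \<in> hom P ?B" using subgroup.subset[OF PB] by (auto simp: hom_def P_def)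
  then have act: "group_action P (carrier Q) (\<lambda>x. x)"
    using gP group_BijGroup by (simp add: group_action_def group_hom_def group_hom_axioms_def)
  have cent\<phi>: "\<phi> d = \<one>\<^bsub>?B\<^esub>" if "d \<in> D" "d \<in> cent" for d
  proof -
    have "inv d \<in> cent" using that subgroup.m_inv_closed[OF normal_imp_subgroup[OF cent_normal]] by blast
    then have "act (inv d) (\<pi> v) = \<pi> v" if "v \<in> V" for v
      using cent_iff that Dc \<open>d \<in> D\<close> by auto
    then show ?thesis by (auto simp: \<phi>_def BijGroup_def \<pi>_surj restrict_def fun_eq_iff)
  qed
  have same: "\<phi> d = \<phi> e" if "d \<in> D" "e \<in> D" "N #> d = N #> e" for d e
  proof -
    have "d \<in> N #> e" using rcos_self[OF Dc[OF that(1)] N(1)] that(3) by simp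
    then have "d \<otimes> inv e \<in> N" using subgroup.rcos_module_imp[OF N(1) is_group Dc[OF that(2)]] by simp
    moreover have de: "d \<otimes> inv e \<in> D" using that Ds by (simp add: subgroup.m_closed subgroup.m_inv_closed)
    ultimately have 1: "\<phi> (d \<otimes> inv e) = \<one>\<^bsub>?B\<^esub>" using N cent\<phi> by blast
    have "\<phi> d = \<phi> (d \<otimes> inv e \<otimes> e)" using that Dc by (simp add: m_assoc)
    also have "\<dots> = \<phi> (d \<otimes> inv e) \<otimes>\<^bsub>?B\<^esub> \<phi> e"
      using \<phi>.hom_mult[of "d \<otimes> inv e" e] de that by simp
    also have "\<dots> = \<phi> e" unfolding 1 using \<phi>.hom_closed[of e] that by simp
    finally show ?thesis .
  qed
  have finP: "finite (carrier P)"
  proof -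
    define r where "r C = (SOME e. e \<in> D \<and> N #> e = C)" for C
    have "\<phi> d \<in> (\<lambda>C. \<phi> (r C)) ` (rcosets N)" if d: "d \<in> D" for d
    proof (rule image_eqI)
      have "r (N #> d) \<in> D \<and> N #> r (N #> d) = N #> d"
        unfolding r_def by (rule someI[of _ d]) (use d in simp)
      then show "\<phi> d = \<phi> (r (N #> d))" using same[OF d] by simp
      show "N #> d \<in> rcosets N" using d Dc subgroup.subset[OF N(1)] by (intro rcosetsI) auto
    qed
    then show ?thesis unfolding cP using N(2) by (meson finite_imageI finite_subset image_subsetI)
  qed
  have "\<exists>k. order P = p ^ k"
  proof (rule P.prime_power_order[OF finP p])
    fix x assume "x \<in> carrier P"
    then obtain d where d: "d \<in> D" "x = \<phi> d" by (auto simp: cP)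
    then obtain j where j: "d [^] (p ^ j) \<in> cent" using Dp by blast
    have "x [^]\<^bsub>P\<^esub> (p ^ j) = \<phi> (d [^] (p ^ j))"
      using d \<phi>.hom_nat_pow[of d "p ^ j"] by (simp add: P_def flip: nat_pow_consistent \<phi>.H.nat_pow_consistent)
    also have "\<dots> = \<one>\<^bsub>P\<^esub>" using cent\<phi>[OF _ j] d Ds by (simp add: subgroup_nat_pow P_def)
    finally show "\<exists>j. x [^]\<^bsub>P\<^esub> (p ^ j) = \<one>\<^bsub>P\<^esub>" by blast
  qed
  then obtain k where k: "order P = p ^ k" by blast
  \<comment> \<open>The series required by \<open>prime_power_group_acts_nilpotently\<close>. Each
    term of \<open>hyper\<close> contains \<open>W\<close>, so membership of a coset can be tested
    on any representative.\<close>
  define K where "K i = \<pi> ` hyper G V D W i" for i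
  have nrmD: "D \<subseteq> carrier G" "V \<subseteq> nrm D" "V \<subseteq> nrm W" "D \<subseteq> nrm W"
    using D W V_carrier Dc by (auto simp: normal_iff_nrm)
  have hs: "subgroup (hyper G V D W i) G" for i
    using subgroup_hyper[OF V_sub W_sub WV] nrmD by blast
  have Wh: "W \<subseteq> hyper G V D W i" for i
    using hyper_mono_index[OF W_sub WV nrmD(4), of 0 i] by simp
  have hV: "hyper G V D W i \<subseteq> V" for i using hyper_subset[OF WV] .
  have sat: "\<pi> v \<in> K i \<longleftrightarrow> v \<in> hyper G V D W i" if v: "v \<in> V" for v i
  proof
    assume "\<pi> v \<in> K i"
    then obtain w where w: "w \<in> hyper G V D W i" "\<pi> v = \<pi> w" by (auto simp: K_def)
    then have "inv w \<otimes> v \<in> W" using \<pi>_eq_iff[of w v] v hV by auto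
    then have "w \<otimes> (inv w \<otimes> v) \<in> hyper G V D W i" using w Wh subgroup.m_closed[OF hs] by blast
    moreover have "w \<in> carrier G" using w(1) hV V_carrier by blast
    ultimately show "v \<in> hyper G V D W i" using V_carrier[OF v] by simp
  qed (auto simp: K_def)
  have "K (p ^ card (carrier P)) = carrier Q"
  proof (rule Q.prime_power_group_acts_nilpotently[OF _ p gP k act])
    show "u [^]\<^bsub>Q\<^esub> p = \<one>\<^bsub>Q\<^esub>" if "u \<in> carrier Q" for u
      using Q_exponent[OF exp that] .
    show "g \<in> hom Q Q" if g: "g \<in> carrier P" for g
    proof -
      obtain d where d: "d \<in> D" "g = \<phi> d" using g cP by auto
      then show ?thesis using act_hom[of "inv d"] Dc by (auto simp: hom_def \<phi>_def Pi_iff)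
    qed
    have "\<pi> w = W" if "w \<in> W" for w using coset_eq_one_iff[OF W] that W_carrier by auto
    then show "K 0 = {\<one>\<^bsub>Q\<^esub>}" using subgroup.one_closed[OF W_sub] by (auto simp: K_def Q_one)
    fix i
    have "\<pi> v \<in> K (Suc i) \<longleftrightarrow> (\<forall>g \<in> carrier P. g (\<pi> v) \<otimes>\<^bsub>Q\<^esub> inv\<^bsub>Q\<^esub> \<pi> v \<in> K i)" if v: "v \<in> V" for v
    proof -
      have "\<phi> d (\<pi> v) \<otimes>\<^bsub>Q\<^esub> inv\<^bsub>Q\<^esub> \<pi> v \<in> K i \<longleftrightarrow> cm v (inv d) \<in> hyper G V D W i" if "d \<in> D" for d
        using that v Dc act_delta[of "inv d" v] sat[of "cm v (inv d)"] by (simp add: \<phi> act_\<pi>)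
      \<comment> \<open>\<open>\<phi>\<close> acts through inverses, and \<open>D\<close> is closed
        under them.\<close>
      moreover have "(\<forall>d\<in>D. cm v (inv d) \<in> hyper G V D W i) \<longleftrightarrow> (\<forall>d\<in>D. cm v d \<in> hyper G V D W i)"
        using Ds Dc by (metis inv_inv subgroup.m_inv_closed)
      ultimately show ?thesis unfolding cP using sat[OF v, of "Suc i"] v by simp
    qed
    moreover have "K (Suc i) \<subseteq> carrier Q" using hV by (fastforce simp: K_def \<pi>_surj)
    ultimately show "K (Suc i) = {v \<in> carrier Q. \<forall>g \<in> carrier P. g v \<otimes>\<^bsub>Q\<^esub> inv\<^bsub>Q\<^esub> v \<in> K i}"
      by (auto simp: \<pi>_surj)
  qed
  then have "V \<subseteq> hyper G V D W (p ^ card (carrier P))" using sat by (auto simp: \<pi>_surj)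
  also have "\<dots> \<subseteq> hyper G (carrier G) D W (p ^ card (carrier P))"
    using V_carrier by (intro hyper_mono_carrier) auto
  finally show ?thesis by blast
qed

lemma pow_kernel_normal: "{v \<in> V. v [^] (n::nat) \<in> W} \<lhd> G"
proof (rule normalI_cj)
  have *: "v [^] n \<in> W \<longleftrightarrow> \<pi> v [^]\<^bsub>Q\<^esub> n = \<one>\<^bsub>Q\<^esub>" if "v \<in> V" for v
    using that \<pi>_one_iff[of "v [^] n"] subgroup_nat_pow[OF V_sub] by (simp add: \<pi>_pow)
  show "subgroup {v \<in> V. v [^] n \<in> W} G"
  proof (rule subgroupI)
    show "{v \<in> V. v [^] n \<in> W} \<subseteq> carrier G" using V_carrier by auto
    have "\<one> \<in> {v \<in> V. v [^] n \<in> W}" using V_sub W_sub by (simp add: subgroup.one_closed)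
    then show "{v \<in> V. v [^] n \<in> W} \<noteq> {}" by blast
    fix a assume a: "a \<in> {v \<in> V. v [^] n \<in> W}"
    then show "inv a \<in> {v \<in> V. v [^] n \<in> W}"
      using V_sub *[of a] *[of "inv a"] by (simp add: subgroup.m_inv_closed \<pi>_inv Q.nat_pow_inv)
    fix b assume b: "b \<in> {v \<in> V. v [^] n \<in> W}"
    show "a \<otimes> b \<in> {v \<in> V. v [^] n \<in> W}"
      using a b V_sub *[of a] *[of b] *[of "a \<otimes> b"] by (simp add: subgroup.m_closed \<pi>_mult Q.nat_pow_distrib)
  qed
  show "cj g v \<in> {v \<in> V. v [^] n \<in> W}" if "g \<in> carrier G" "v \<in> {v \<in> V. v [^] n \<in> W}" for g v
    using that normal_cj[OF W that(1)] V_carrier by (auto simp flip: cj_nat_pow)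
qed

end

section \<open>Nilpotent action of the derived subgroup on an abelian section\<close>

context group
begin

lemma subset_set_mult:
  assumes "subgroup H G" "subgroup K G"
  shows "H \<subseteq> H <#> K" "K \<subseteq> H <#> K"
proof -
  have "h = h \<otimes> \<one>" if "h \<in> H" for h using that assms(1) subgroup.mem_carrier[of H G h] by simp
  then show "H \<subseteq> H <#> K" using subgroup.one_closed[OF assms(2)] by (auto simp: set_mult_def)
  have "k = \<one> \<otimes> k" if "k \<in> K" for k using that assms(2) subgroup.mem_carrier[of K G k] by simp
  then show "K \<subseteq> H <#> K" using subgroup.one_closed[OF assms(1)] unfolding set_mult_def by blast
qed

lemma abelian_sectionI:
  assumes "V \<lhd> G" "W \<lhd> G" "W \<subseteq> V" "\<And>v v'. v \<in> V \<Longrightarrow> v' \<in> V \<Longrightarrow> cm v v' \<in> W"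
  shows "abelian_section G V W"
  using assms by (simp add: abelian_section_def abelian_section_axioms_def is_group)

lemma pow_index_mem:
  assumes N: "N \<lhd> G" "finite (rcosets N)" and x: "x \<in> carrier G"
  shows "x [^] card (rcosets N) \<in> N"
proof -
  interpret h: group_hom G "G Mod N" "\<lambda>x. N #> x" by (rule Mod_group_hom[OF N(1)])
  have "order (G Mod N) = card (rcosets N)" by (simp add: order_def FactGroup_def)
  then have "(N #> x) [^]\<^bsub>G Mod N\<^esub> card (rcosets N) = \<one>\<^bsub>G Mod N\<^esub>"
    using h.H.pow_order_eq_1[OF h.hom_closed[OF x]] by simp
  then have "N #> (x [^] card (rcosets N)) = N" using h.hom_nat_pow[OF x, of "card (rcosets N)"] by simp
  then show ?thesis using coset_eq_one_iff[OF N(1)] x by simp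
qed

lemma finite_rcosets_mono:
  assumes N: "subgroup N G" and fin: "finite (rcosets N)" and J: "subgroup J G" "N \<subseteq> J"
  shows "finite (rcosets J)"
proof -
  have "J #> x = J <#> (N #> x)" if x: "x \<in> carrier G" for x
  proof -
    have "J <#> (N #> x) = (J <#> N) #> x"
      using setmult_rcos_assoc[OF subgroup.subset[OF J(1)] subgroup.subset[OF N] x] .
    also have "J <#> N = J"
      using J N by (auto simp: set_mult_def subgroup.m_closed subset_iff intro!: bexI[of _ \<one>] simp: subgroup.one_closed subgroup.mem_carrier)
    finally show ?thesis by simp
  qed
  then have "rcosets J \<subseteq> (\<lambda>C. J <#> C) ` (rcosets N)" by (auto simp: RCOSETS_def)
  then show ?thesis using fin finite_subset by blast
qed

text \<open>Induction on the exponent of \<open>V / W\<close>, splitting off one prime at a time.\<close>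

lemma section_nilpotent_exponent:
  assumes N: "N \<lhd> G" "finite (rcosets N)"
  shows "n > 0 \<Longrightarrow> abelian_section G V W \<Longrightarrow>
    (\<And>d v. d \<in> generate G (commutator_set G) \<Longrightarrow> d \<in> N \<Longrightarrow> v \<in> V \<Longrightarrow> cm v d \<in> W) \<Longrightarrow>
    (\<And>v. v \<in> V \<Longrightarrow> v [^] (n::nat) \<in> W) \<Longrightarrow>
    (\<And>x y v. x \<in> carrier G \<Longrightarrow> y \<in> carrier G \<Longrightarrow> v \<in> V \<Longrightarrow> ((\<lambda>v. cm v (cm x y)) ^^ k) v \<in> W) \<Longrightarrow>
    \<exists>m. V \<subseteq> hyper G (carrier G) (commutator_set G) W m"
proof (induction n arbitrary: V W rule: less_induct)
  case (less n)
  interpret S: abelian_section G V W by fact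
  let ?D = "generate G (commutator_set G)"
  show ?case
  proof (cases "n = 1")
    case True
    then have "V \<subseteq> hyper G (carrier G) (commutator_set G) W 0" using less.prems(4) S.V_carrier by auto
    then show ?thesis by blast
  next
    case False
    then obtain p where p: "Factorial_Ring.prime p" "p dvd n" using prime_factor_nat by blast
    then obtain n' where n': "n = p * n'" by auto
    \<comment> \<open>\<open>V1 / W\<close> is the part of \<open>V / W\<close> killed by
      \<open>n'\<close>. So \<open>V / V1\<close> is killed by \<open>p\<close>, and
      \<open>V1 / W\<close> falls under the induction hypothesis.\<close>
    define V1 where "V1 = {v \<in> V. v [^] n' \<in> W}"
    have V1n: "V1 \<lhd> G" unfolding V1_def by (rule S.pow_kernel_normal)
    have WV1: "W \<subseteq> V1" using S.WV subgroup_nat_pow[OF S.W_sub] by (auto simp: V1_def)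
    interpret S1: abelian_section G V V1
      using S.V V1n S.VV WV1 by (intro abelian_sectionI) (auto simp: V1_def)
    interpret S2: abelian_section G V1 W
      using S.W V1n S.VV WV1 by (intro abelian_sectionI) (auto simp: V1_def)
    have D: "?D \<lhd> G" by (fact generate_commutators_normal)
    have Ds: "subgroup ?D G" using D normal_imp_subgroup by blast
    have exp1: "v [^] p \<in> V1" if "v \<in> V" for v
      using that less.prems(4)[OF that] S.V_carrier S.V_sub n' by (simp add: V1_def subgroup_nat_pow nat_pow_pow)
    define C where "C = ?D \<inter> S1.cent"
    have Cn: "C \<lhd> G" unfolding C_def using D S1.cent_normal by (rule normal_subgroup_intersect)
    \<comment> \<open>\<open>C\<close> consists of the elements of \<open>?D\<close> acting
      trivially on \<open>V / V1\<close>; adding \<open>N\<close> makes the quotient finite. Modulo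
      \<open>J\<close> all commutators have \<open>p\<close>-power order, since they act unipotently
      on a section killed by \<open>p\<close>.\<close>
    define J where "J = C <#> N"
    have Jn: "J \<lhd> G" unfolding J_def using Cn N(1) by (rule normal_subgroup_set_mult_closed)
    have CJ: "C \<subseteq> J" "N \<subseteq> J"
      unfolding J_def using subset_set_mult normal_imp_subgroup Cn N(1) by blast+
    have "\<exists>j. \<forall>d \<in> ?D. d [^] (p ^ j) \<in> J"
    proof (rule commutators_prime_power_mod[OF Jn _ p(1)])
      show "finite (rcosets J)"
        using finite_rcosets_mono[OF normal_imp_subgroup[OF N(1)] N(2) normal_imp_subgroup[OF Jn] CJ(2)] .
      fix x y assume xy: "x \<in> carrier G" "y \<in> carrier G"
      then have cD: "cm x y \<in> ?D" by (auto simp: commutator_set_def intro: generate.incl)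
      have "S1.unip (cm x y) k" using less.prems(5)[OF xy] WV1 by (auto simp: S1.unip_def)
      then have "cm x y [^] (p ^ k) \<in> S1.cent" using S1.unip_exponent[OF _ _ exp1] xy by simp
      then show "\<exists>j. cm x y [^] (p ^ j) \<in> J"
        using subgroup_nat_pow[OF Ds cD] CJ(1) C_def by blast
    qed
    then obtain j where j: "\<And>d. d \<in> ?D \<Longrightarrow> d [^] (p ^ j) \<in> J" by blast
    have NC: "?D \<inter> N \<subseteq> S1.cent"
      using less.prems(3) WV1 S.V_carrier subgroup.subset[OF Ds] by (auto simp: S1.cent_def)
    have "\<exists>m. V \<subseteq> hyper G (carrier G) ?D V1 m"
    proof (rule S1.prime_section_nilpotent[OF exp1 p(1) D normal_imp_subgroup[OF N(1)] N(2) NC])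
      fix d assume d: "d \<in> ?D"
      obtain c n where cn: "c \<in> C" "n \<in> N" "d [^] (p ^ j) = c \<otimes> n" using j[OF d] by (auto simp: J_def set_mult_def)
      have cc: "c \<in> carrier G" "n \<in> carrier G"
        using cn Cn N(1) normal_imp_subgroup subgroup.mem_carrier by metis+
      \<comment> \<open>Dividing by \<open>c\<close> puts the factor \<open>n\<close> into
        \<open>?D \<inter> N\<close>, which acts trivially; so the passage from \<open>C\<close> to
        \<open>J\<close> does no harm.\<close>
      have "c \<in> ?D" using cn by (simp add: C_def)
      then have "inv c \<otimes> d [^] (p ^ j) \<in> ?D"
        using subgroup_nat_pow[OF Ds d] Ds subgroup.m_closed subgroup.m_inv_closed by metis
      then have "n \<in> S1.cent" using NC cn cc by auto
      then show "\<exists>j. d [^] (p ^ j) \<in> S1.cent"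
        using cn subgroup.m_closed[OF normal_imp_subgroup[OF S1.cent_normal]] by (metis C_def IntD2)
    qed
    then obtain m1 where m1: "V \<subseteq> hyper G (carrier G) ?D V1 m1" by blast
    have "commutator_set G \<subseteq> ?D" by (auto intro: generate.incl)
    then have m1': "V \<subseteq> hyper G (carrier G) (commutator_set G) V1 m1"
      using m1 hyper_antimono by blast
    have "n' < n" "n' > 0" using n' p less.prems(1) prime_gt_1_nat[of p] by auto
    then have "\<exists>m. V1 \<subseteq> hyper G (carrier G) (commutator_set G) W m"
      using less.prems by (intro less.IH[of n' V1 W]) (auto simp: V1_def S2.abelian_section_axioms[unfolded V1_def])
    then show ?thesis using hyper_trans[OF m1'] by blast
  qed
qed

text \<open>A commutator acts with period dividing the index of \<open>N\<close> and unipotently, so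
  by \<open>unip_periodic\<close> every \<open>[v, [x, y]]\<close> is killed modulo \<open>W\<close>
  by \<open>n\<close>, the \<open>k\<close>-th power of that index. One step thus leads from
  \<open>V\<close> into the torsion part \<open>T\<close>, to which the case of bounded exponent
  applies.\<close>

theorem section_nilpotent:
  assumes S: "abelian_section G V W" and N: "N \<lhd> G" "finite (rcosets N)"
    and triv: "\<And>d v. d \<in> generate G (commutator_set G) \<Longrightarrow> d \<in> N \<Longrightarrow> v \<in> V \<Longrightarrow> cm v d \<in> W"
    and unip: "\<And>x y v. x \<in> carrier G \<Longrightarrow> y \<in> carrier G \<Longrightarrow> v \<in> V \<Longrightarrow> ((\<lambda>v. cm v (cm x y)) ^^ k) v \<in> W"
  shows "\<exists>m. V \<subseteq> hyper G (carrier G) (commutator_set G) W m"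
proof -
  interpret S: abelian_section G V W by fact
  define n where "n = card (rcosets N) ^ k"
  have "rcosets N \<noteq> {}" by (auto simp: RCOSETS_def)
  then have n0: "n > 0" using N(2) by (simp add: n_def card_gt_0_iff)
  define T where "T = {v \<in> V. v [^] n \<in> W}"
  have Tn: "T \<lhd> G" unfolding T_def by (rule S.pow_kernel_normal)
  have WT: "W \<subseteq> T" using S.WV subgroup_nat_pow[OF S.W_sub] by (auto simp: T_def)
  interpret S2: abelian_section G T W
    using S.W Tn S.VV WT by (intro abelian_sectionI) (auto simp: T_def)
  have "cm v (cm x y) \<in> T" if v: "v \<in> V" and xy: "x \<in> carrier G" "y \<in> carrier G" for v x y
  proof -
    have cD: "cm x y \<in> generate G (commutator_set G)" using xy by (auto simp: commutator_set_def intro: generate.incl)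
    have "cm x y [^] card (rcosets N) \<in> S.cent"
      using triv pow_index_mem[OF N] subgroup_nat_pow[OF normal_imp_subgroup[OF generate_commutators_normal] cD] xy
      by (simp add: S.cent_def)
    moreover have "S.unip (cm x y) k" using unip[OF xy] by (simp add: S.unip_def)
    ultimately have "cm v (cm x y) [^] n \<in> W"
      using S.unip_periodic[OF _ _ _ v, of "cm x y" k "card (rcosets N)"] xy by (simp add: n_def)
    then show ?thesis using v xy by (simp add: T_def)
  qed
  then have 1: "V \<subseteq> hyper G (carrier G) (commutator_set G) T 1"
    using S.V_carrier by (auto simp: commutator_set_def)
  have "\<exists>m. T \<subseteq> hyper G (carrier G) (commutator_set G) W m"
    using triv unip by (intro section_nilpotent_exponent[OF N n0 S2.abelian_section_axioms, of k]) (auto simp: T_def)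
  then show ?thesis using hyper_trans[OF 1] by blast
qed

text \<open>From \<open>s^u = s [s, u]\<close> it follows that \<open>K\<close> is mapped into
  itself. For \<open>inv u\<close>, the hypothesis is applied to the conjugate of the element by
  \<open>inv u\<close>, which still lies in \<open>V\<close>.\<close>

lemma trivial_action_nrm:
  assumes V: "V \<lhd> G" and K: "subgroup K G" "K \<subseteq> V" and u: "u \<in> carrier G" "\<And>v. v \<in> V \<Longrightarrow> cm v u \<in> K"
  shows "u \<in> nrm K" "v \<in> V \<Longrightarrow> cm v (inv u) \<in> K"
proof -
  have Vc: "v \<in> carrier G" if "v \<in> V" for v using that V normal_imp_subgroup subgroup.subset by blast
  have inv1: "cj (inv u) v = v \<otimes> inv (cm (cj (inv u) v) u)" if "v \<in> V" for v
    using Vc[OF that] u(1) by (simp add: word_simps)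
  have inv2: "cj (inv u) v \<in> V" if "v \<in> V" for v
    using normal_cj[OF V _ that] u(1) by simp
  show "u \<in> nrm K"
  proof (rule nrmI)
    fix s assume s: "s \<in> K"
    then have sV: "s \<in> V" using K by auto
    show "cj u s \<in> K" using s u(1) u(2)[OF sV] Vc[OF sV] K(1) by (simp add: cj_eq_cm subgroup.m_closed)
    show "cj (inv u) s \<in> K"
      using u(2)[OF inv2[OF sV]] s K(1) inv1[OF sV] subgroup.m_closed subgroup.m_inv_closed by metis
  qed (fact u(1))
  show "cm v (inv u) \<in> K" if v: "v \<in> V"
  proof -
    have "cm v (inv u) = inv (cm (cj (inv u) v) u)" using Vc[OF v] u(1) by (simp add: word_simps)
    then show ?thesis using u(2)[OF inv2[OF v]] K(1) by (simp add: subgroup.m_inv_closed)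
  qed
qed

text \<open>The last term \<open>K\<close> of the Engel series of \<open>c\<close> that is reached inside \<open>H\<close> contains the commutators of \<open>V\<close> with
  \<open>x\<close> conjugated by \<open>y\<close> and with \<open>y\<close> conjugated by \<open>x\<close>. Hence \<open>x\<close> and \<open>y\<close> normalize \<open>K\<close>, so \<open>x\<close> itself, and with it
  \<open>c = [x, y]\<close>, acts trivially on \<open>V / K\<close>.\<close>

theorem commutator_unipotent:
  assumes S: "abelian_section G V W" and xy: "x \<in> carrier G" "y \<in> carrier G"
    and H: "subgroup H G" "H \<subseteq> hyper G (carrier G) H {\<one>} k" and cH: "cm x y \<in> H"
    and u: "\<And>v. v \<in> V \<Longrightarrow> cm (cj y x) v \<in> H" and w: "\<And>v. v \<in> V \<Longrightarrow> cm (cj x y) v \<in> H"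
    and v: "v \<in> V"
  shows "((\<lambda>v. cm v (cm x y)) ^^ Suc k) v \<in> W"
proof -
  interpret S: abelian_section G V W by fact
  define c where "c = cm x y"
  have c: "c \<in> carrier G" "c \<in> H" using xy cH by (auto simp: c_def)
  \<comment> \<open>The coset \<open>cV\<close> in place of \<open>c\<close> alone: \<open>V\<close>
    normalizes it, which makes the terms of the series subgroups, and modulo \<open>W\<close> its
    elements act on \<open>V\<close> like \<open>c\<close>.\<close>
  define D where "D = (\<lambda>v. c \<otimes> v) ` V"
  have Dc: "D \<subseteq> carrier G" using c S.V_carrier by (auto simp: D_def)
  have cjD: "cj g s \<in> D" if g: "g \<in> carrier G" "cm c g \<in> V" and s: "s \<in> D" for g s
  proof -
    obtain v where v: "v \<in> V" "s = c \<otimes> v" using s by (auto simp: D_def)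
    have "cj g s = c \<otimes> (cm c g \<otimes> cj g v)" using v g c S.V_carrier by (simp add: cj_mult cj_eq_cm[of c g] m_assoc)
    moreover have "cm c g \<otimes> cj g v \<in> V" using g v S.V_sub by (simp add: subgroup.m_closed)
    ultimately show ?thesis by (auto simp: D_def)
  qed
  have VD: "e \<in> nrm D" if e: "e \<in> V" for e
    using e S.V_carrier S.V_sub c cjD normal_cm_right[OF S.V]
    by (intro nrmI) (auto simp: subgroup.m_inv_closed)
  have cD: "c \<in> nrm D"
    using c cjD S.V_sub by (intro nrmI) (auto simp: subgroup.one_closed cm_inv_right)
  define K where "K i = hyper G V D W i" for i
  have nW: "nrm W = carrier G" "nrm V = carrier G" using S.W S.V normal_iff_nrm by auto
  have Ks: "subgroup (K i) G" for i
    unfolding K_def using subgroup_hyper[OF S.V_sub S.W_sub S.WV _ Dc] VD nW S.V_carrier by blast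
  have KV: "K i \<subseteq> V" for i unfolding K_def using hyper_subset[OF S.WV] .
  have nK: "g \<in> nrm (K i)" if "g \<in> nrm D" for g i
    unfolding K_def using that nW nrm_subset S.V_carrier Dc by (intro nrm_hyper) auto
  have WK: "W \<subseteq> K i" for i
    unfolding K_def using hyper_mono_index[OF S.W_sub S.WV, of D 0 i] nW Dc by simp
  \<comment> \<open>Depth in the nilpotent group \<open>H\<close> bounds depth in the series, since
    \<open>c\<close> lies in \<open>H\<close> and the factor \<open>v\<close> of \<open>c v\<close>
    acts trivially on \<open>V / W\<close>.\<close>
  have HK: "H \<inter> V \<inter> hyper G (carrier G) H {\<one>} i \<subseteq> K i" for i
  proof (induction i)
    case 0
    then show ?case using subgroup.one_closed[OF S.W_sub] by (auto simp: K_def)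
  next
    case (Suc i)
    show ?case
    proof
      fix a assume a: "a \<in> H \<inter> V \<inter> hyper G (carrier G) H {\<one>} (Suc i)"
      then have ac: "a \<in> carrier G" by simp
      have "cm a (c \<otimes> v) \<in> K i" if v: "v \<in> V" for v
      proof -
        have "cm a c \<in> H" using a c H by (simp add: subgroup_cm)
        moreover have "cm a c \<in> V" using a c by simp
        ultimately have "cm a c \<in> K i" using Suc a c by auto
        then have "cj v (cm a c) \<in> K i" using nrmD(1)[OF nK[OF VD[OF v]]] by blast
        moreover have "cm a v \<in> K i" using S.VV a v WK by auto
        ultimately show ?thesis using ac c S.V_carrier[OF v] subgroup.m_closed[OF Ks] by (simp add: cm_mult_right)
      qed
      then show "a \<in> K (Suc i)" using a by (auto simp: K_def D_def)
    qed
  qed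
  have actK: "cm v g \<in> K k" if "g \<in> carrier G" "cm g v \<in> H" "v \<in> V" for g v
  proof -
    have "cm v g = inv (cm g v)" using that S.V_carrier by (simp add: inv_cm)
    then have "cm v g \<in> H" using that H by (simp add: subgroup.m_inv_closed)
    then show ?thesis using HK[of k] H(2) that by auto
  qed
  let ?u = "cj y x" and ?w = "cj x y"
  have uw: "?u \<in> carrier G" "?w \<in> carrier G" using xy by auto
  note tu = trivial_action_nrm[OF S.V Ks KV uw(1) actK[OF uw(1) u]]
  note tw = trivial_action_nrm[OF S.V Ks KV uw(2) actK[OF uw(2) w]]
  have sn: "subgroup (nrm (K k)) G" using subgroup_nrm KV S.V_carrier by (metis subsetD subsetI)
  \<comment> \<open>\<open>x\<close> and \<open>y\<close> are products of \<open>x^y\<close>,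
    \<open>y^x\<close> and powers of \<open>c\<close>, all of which normalize
    \<open>K k\<close>.\<close>
  have "y = ?w \<otimes> c" "x = ?u \<otimes> inv c" using xy by (simp_all add: c_def word_simps)
  then have nx: "x \<in> nrm (K k)" and ny: "y \<in> nrm (K k)"
    using tu(1) tw(1) nK[OF cD, of k] sn by (metis subgroup.m_closed subgroup.m_inv_closed)+
  \<comment> \<open>As \<open>y\<close> normalizes \<open>K k\<close>, the trivial action of
    \<open>x^y\<close> transfers to \<open>x\<close>.\<close>
  have xK: "cm v x \<in> K k" if v: "v \<in> V" for v
  proof -
    have "cm (cj y v) ?u \<in> K k" using actK[OF uw(1) u] v xy by simp
    then have "cj (inv y) (cm (cj y v) ?u) \<in> K k" using nrmD(2)[OF ny] by blast
    then show ?thesis using v xy S.V_carrier by (simp flip: cj_cm)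
  qed
  have cK: "cm v c \<in> K k" if v: "v \<in> V" for v
  proof -
    have "c = inv x \<otimes> ?u" using xy by (simp add: c_def word_simps)
    then have "cm v c = cm v ?u \<otimes> cj ?u (cm v (inv x))" using v xy S.V_carrier by (simp add: cm_mult_right)
    moreover have "cm v (inv x) \<in> K k" using trivial_action_nrm(2)[OF S.V Ks KV xy(1) xK v] .
    ultimately show ?thesis
      using actK[OF uw(1) u[OF v] v] nrmD(1)[OF tu(1)] subgroup.m_closed[OF Ks] by simp
  qed
  have "((\<lambda>v. cm v c) ^^ i) a \<in> W" if "a \<in> K i" for i a
    using that
  proof (induction i arbitrary: a)
    case 0 then show ?case by (simp add: K_def)
  next
    case (Suc i)
    have "c \<in> D" unfolding D_def using c S.V_sub by (intro image_eqI[of _ _ \<one>]) (auto simp: subgroup.one_closed)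
    then have "cm a c \<in> K i" using Suc.prems by (simp add: K_def)
    then show ?case using Suc.IH by (simp add: funpow_Suc_right del: funpow.simps)
  qed
  \<comment> \<open>The first commutator leads into \<open>K k\<close>, and \<open>k\<close> more
    lead into \<open>W\<close>; hence \<open>Suc k\<close>.\<close>
  from this[OF cK[OF v]] show ?thesis by (simp add: funpow_Suc_right c_def del: funpow.simps)
qed

text \<open>The quotient of the values \<open>[x', y]\<close> and \<open>[x', y n]\<close> in
  \<open>H\<close> is \<open>[x'^y, n]\<close>; the element \<open>x'\<close> in the coset of
  \<open>x\<close> is chosen so that \<open>x'^y = x^y m\<close>.\<close>

lemma commutator_coset_pair:
  assumes M: "M \<lhd> G" and xy: "x \<in> carrier G" "y \<in> carrier G" and H: "subgroup H G"
    and good: "\<And>m n. m \<in> M \<Longrightarrow> n \<in> M \<Longrightarrow> cm (x \<otimes> m) (y \<otimes> n) \<in> H"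
    and mn: "m \<in> M" "n \<in> M"
  shows "cm (cj y x \<otimes> m) n \<in> H"
proof -
  have Mc: "m \<in> carrier G" "n \<in> carrier G" using mn M normal_imp_subgroup subgroup.subset by blast+
  define x' where "x' = x \<otimes> cj (inv y) m"
  have x': "x' \<in> carrier G" "cj y x' = cj y x \<otimes> m" using xy Mc by (simp_all add: x'_def cj_mult)
  have m': "cj (inv y) m \<in> M" using normal_cj[OF M] xy mn by simp
  have one: "\<one> \<in> M" using M normal_imp_subgroup subgroup.one_closed by blast
  have "inv (cm x' y) \<otimes> cm x' (y \<otimes> n) = cm (cj y x') n" using xy Mc x'(1) by (simp add: word_simps)
  moreover have "cm x' y \<in> H" using good[OF m' one] xy by (simp add: x'_def)
  moreover have "cm x' (y \<otimes> n) \<in> H" using good[OF m' mn(2)] by (simp add: x'_def)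
  ultimately show ?thesis using H x' by (metis subgroup.m_closed subgroup.m_inv_closed)
qed

lemma commutator_coset_pair_swap:
  assumes M: "M \<lhd> G" and xy: "x \<in> carrier G" "y \<in> carrier G" and H: "subgroup H G"
    and good: "\<And>m n. m \<in> M \<Longrightarrow> n \<in> M \<Longrightarrow> cm (x \<otimes> m) (y \<otimes> n) \<in> H"
    and mn: "m \<in> M" "n \<in> M"
  shows "cm (cj x y \<otimes> m) n \<in> H"
proof (rule commutator_coset_pair[OF M xy(2,1) H _ mn])
  fix m n assume "m \<in> M" "n \<in> M"
  moreover from this have "m \<in> carrier G" "n \<in> carrier G" using M normal_imp_subgroup subgroup.subset by blast+
  ultimately show "cm (y \<otimes> m) (x \<otimes> n) \<in> H"
    using subgroup.m_inv_closed[OF H good[of n m]] xy by (simp add: inv_cm)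
qed

text \<open>With \<open>u = x^y\<close>, \<open>[u m, n] = [u, n]^m [m, n]\<close>. The factor
  \<open>[u, n]^m\<close> equals \<open>[u [u, m], n^m]\<close>, and since \<open>[u, m]\<close>
  lies in \<open>M\<close>, \<open>commutator_coset_pair\<close> covers it too.\<close>

lemma commutator_coset_pair_subgroup:
  assumes M: "M \<lhd> G" and xy: "x \<in> carrier G" "y \<in> carrier G" and H: "subgroup H G"
    and good: "\<And>m n. m \<in> M \<Longrightarrow> n \<in> M \<Longrightarrow> cm (x \<otimes> m) (y \<otimes> n) \<in> H"
    and mn: "m \<in> M" "n \<in> M"
  shows "cm m n \<in> H"
proof -
  have Mc: "m \<in> carrier G" "n \<in> carrier G" using mn M normal_imp_subgroup subgroup.subset by blast+
  let ?u = "cj y x"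
  have uc: "?u \<in> carrier G" using xy by simp
  have "cm ?u m \<in> M" using normal_cm_right[OF M uc mn(1)] .
  then have "cm (?u \<otimes> cm ?u m) (cj m n) \<in> H"
    using commutator_coset_pair[OF M xy H good] normal_cj[OF M Mc(1) mn(2)] by blast
  then have 1: "cj m (cm ?u n) \<in> H" using uc Mc by (simp add: cj_cm cj_eq_cm[OF uc Mc(1)])
  have 2: "cm (?u \<otimes> m) n \<in> H" using commutator_coset_pair[OF M xy H good mn] .
  have "cm m n = inv (cj m (cm ?u n)) \<otimes> cm (?u \<otimes> m) n" using uc Mc by (simp add: cm_mult_left)
  then show ?thesis using 1 2 H by (simp add: subgroup.m_closed subgroup.m_inv_closed)
qed

end

section \<open>Profinite groups and Baire category\<close>

context topological_group
begin

lemma cont_mult: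
  assumes "continuous_map Y T f" "continuous_map Y T g"
  shows "continuous_map Y T (\<lambda>x. f x \<otimes> g x)"
proof -
  have "continuous_map Y (prod_topology T T) (\<lambda>x. (f x, g x))"
    using assms by (simp add: continuous_map_paired)
  from continuous_map_compose[OF this continuous_mult] show ?thesis by (simp add: o_def)
qed

lemma cont_inv: "continuous_map Y T f \<Longrightarrow> continuous_map Y T (\<lambda>x. inv (f x))"
  using continuous_map_compose[OF _ continuous_inv] by (simp add: o_def)

lemma cont_const: "a \<in> carrier G \<Longrightarrow> continuous_map Y T (\<lambda>x. a)"
  by (simp add: continuous_map_const topspace_eq)

lemma cont_id: "continuous_map T T (\<lambda>x. x)"
  using continuous_map_id by (simp add: id_def)

lemma cont_commutator:
  "continuous_map Y T f \<Longrightarrow> continuous_map Y T g \<Longrightarrow> continuous_map Y T (\<lambda>x. commutator G (f x) (g x))"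
  unfolding commutator_def by (intro cont_mult cont_inv)

lemma cont_cj:
  "continuous_map Y T f \<Longrightarrow> continuous_map Y T g \<Longrightarrow> continuous_map Y T (\<lambda>x. cj (f x) (g x))"
  unfolding cj_def by (intro cont_mult cont_inv)

lemma openin_preimage:
  "continuous_map T T f \<Longrightarrow> openin T U \<Longrightarrow> openin T {x \<in> carrier G. f x \<in> U}"
  using openin_continuous_map_preimage[of T T f U] by (simp add: topspace_eq)

lemma closedin_preimage:
  "continuous_map T T f \<Longrightarrow> closedin T U \<Longrightarrow> closedin T {x \<in> carrier G. f x \<in> U}"
  using closedin_continuous_map_preimage[of T T f U] by (simp add: topspace_eq)

lemma openin_coset:
  assumes "subgroup N G" "openin T N" "x \<in> carrier G"
  shows "openin T (N #> x)"
proof -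
  have "N #> x = {y \<in> carrier G. y \<otimes> inv x \<in> N}"
    using assms(1,3) subgroup.rcos_module[OF assms(1) is_group assms(3)]
      r_coset_subset_G[OF subgroup.subset[OF assms(1)] assms(3)] by auto
  moreover have "openin T {y \<in> carrier G. y \<otimes> inv x \<in> N}"
    using assms by (intro openin_preimage cont_mult cont_id cont_const) auto
  ultimately show ?thesis by simp
qed

lemma open_subgroup_closed:
  assumes N: "subgroup N G" "openin T N"
  shows "closedin T N"
proof -
  have "carrier G - N = \<Union>((\<lambda>x. N #> x) ` (carrier G - N))"
  proof (intro subset_antisym subsetI)
    fix x assume "x \<in> carrier G - N"
    then show "x \<in> \<Union>((\<lambda>x. N #> x) ` (carrier G - N))" using rcos_self[OF _ N(1)] by blast
  next
    fix x assume "x \<in> \<Union>((\<lambda>x. N #> x) ` (carrier G - N))"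
    then obtain y where y: "y \<in> carrier G" "y \<notin> N" "x \<in> N #> y" by auto
    then obtain n where n: "n \<in> N" "x = n \<otimes> y" by (auto simp: r_coset_def)
    have nc: "n \<in> carrier G" using n N subgroup.mem_carrier by metis
    have "y = inv n \<otimes> x" using n nc y by simp
    then have "x \<notin> N" using y n N by (metis subgroup.m_closed subgroup.m_inv_closed)
    then show "x \<in> carrier G - N" using n nc y by simp
  qed
  moreover have "openin T (\<Union>((\<lambda>x. N #> x) ` (carrier G - N)))"
    using openin_coset[OF N] by auto
  ultimately show ?thesis using subgroup.subset[OF N(1)] by (simp add: closedin_def topspace_eq)
qed

lemma open_subgroup_finite_index:
  assumes N: "subgroup N G" "openin T N" and comp: "compact_space T"
  shows "finite (rcosets N)"
proof -
  have "compactin T (carrier G)" using comp by (simp add: compact_space_def topspace_eq)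
  moreover have "\<And>C. C \<in> rcosets N \<Longrightarrow> openin T C" using openin_coset[OF N] by (auto simp: RCOSETS_def)
  moreover have "carrier G \<subseteq> \<Union>(rcosets N)" using rcosets_part_G[OF N(1)] by simp
  ultimately obtain F where F: "finite F" "F \<subseteq> rcosets N" "carrier G \<subseteq> \<Union>F"
    using compactinD[of T "carrier G" "rcosets N"] by blast
  have "C \<in> F" if C: "C \<in> rcosets N" for C
  proof -
    obtain x where x: "x \<in> carrier G" "C = N #> x" using C by (auto simp: RCOSETS_def)
    then have "x \<in> C" using rcos_self N by blast
    then obtain C' where C': "C' \<in> F" "x \<in> C'" using F x by auto
    then have "\<not> disjnt C' C" "C' \<in> rcosets N" using \<open>x \<in> C\<close> F by (auto simp: disjnt_def)
    then have "C' = C" using pairwiseD[OF rcos_disjoint[OF N(1)], of C' C] C by argo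
    then show ?thesis using C' by simp
  qed
  then have "rcosets N \<subseteq> F" by (rule subsetI)
  then show ?thesis using F(1) by (rule finite_subset)
qed

lemma closedin_hyper:
  assumes E: "closedin T E" and B: "closedin T B" and D: "D \<subseteq> carrier G"
  shows "closedin T (hyper G E D B i)"
proof (induction i)
  case 0 then show ?case using B by simp
next
  case (Suc i)
  have "hyper G E D B (Suc i) = E \<inter> (carrier G \<inter> (\<Inter>d\<in>D. {a \<in> carrier G. commutator G a d \<in> hyper G E D B i}))"
    using closedin_subset[OF E] by (auto simp: topspace_eq)
  moreover have "closedin T (carrier G \<inter> (\<Inter>d\<in>D. {a \<in> carrier G. commutator G a d \<in> hyper G E D B i}))"
  proof (cases "D = {}")
    case True
    then show ?thesis using closedin_topspace[of T] by (simp add: topspace_eq)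
  next
    case False
    have "closedin T {a \<in> carrier G. commutator G a d \<in> hyper G E D B i}" if "d \<in> D" for d
      using that D Suc by (intro closedin_preimage cont_commutator cont_id cont_const) auto
    then have "closedin T (\<Inter>d\<in>D. {a \<in> carrier G. commutator G a d \<in> hyper G E D B i})"
      using False by (intro closedin_INT) auto
    then show ?thesis using closedin_topspace[of T] by (simp add: topspace_eq closedin_Int)
  qed
  ultimately show ?case using E by (simp add: closedin_Int)
qed

lemma closure_subgroup:
  assumes H: "subgroup H G"
  shows "subgroup (T closure_of H) G"
proof (rule subgroupI)
  note HC = subgroup.subset[OF H]
  show sub: "T closure_of H \<subseteq> carrier G" using closure_of_subset_topspace[of T H] by (simp add: topspace_eq)
  have Hcl: "H \<subseteq> T closure_of H" using HC by (simp add: closure_of_subset topspace_eq)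
  then show "T closure_of H \<noteq> {}" using subgroup.one_closed[OF H] by blast
  fix a assume a: "a \<in> T closure_of H"
  have "(\<lambda>x. inv x) ` (T closure_of H) \<subseteq> T closure_of ((\<lambda>x. inv x) ` H)"
    using continuous_inv by (rule continuous_map_image_closure_subset)
  also have "(\<lambda>x. inv x) ` H \<subseteq> H" using subgroup.m_inv_closed[OF H] by auto
  then have "T closure_of ((\<lambda>x. inv x) ` H) \<subseteq> T closure_of H" by (rule closure_of_mono)
  finally show "inv a \<in> T closure_of H" using a by auto
  fix b assume b: "b \<in> T closure_of H"
  have "(\<lambda>(x, y). x \<otimes> y) ` (prod_topology T T closure_of (H \<times> H)) \<subseteq> T closure_of ((\<lambda>(x, y). x \<otimes> y) ` (H \<times> H))"
    using continuous_mult by (rule continuous_map_image_closure_subset)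
  also have "(\<lambda>(x, y). x \<otimes> y) ` (H \<times> H) \<subseteq> H" using subgroup.m_closed[OF H] by auto
  then have "T closure_of ((\<lambda>(x, y). x \<otimes> y) ` (H \<times> H)) \<subseteq> T closure_of H" by (rule closure_of_mono)
  finally show "a \<otimes> b \<in> T closure_of H" using a b by (force simp: closure_of_Times)
qed

text \<open>For fixed \<open>a\<close>, the elements \<open>d\<close> with \<open>[a, d]\<close> in
  a closed set form a closed set, so the condition extends from \<open>D\<close> to its
  closure.\<close>

lemma hyper_closure:
  assumes D: "D \<subseteq> carrier G" and one: "closedin T {\<one>}"
  shows "hyper G (carrier G) (T closure_of D) {\<one>} i = hyper G (carrier G) D {\<one>} i"
proof (induction i)
  case (Suc i)
  have cl: "closedin T (hyper G (carrier G) D {\<one>} i)"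
    using closedin_hyper[OF _ one D, of "carrier G"] closedin_topspace[of T] by (simp add: topspace_eq)
  have "commutator G a d \<in> hyper G (carrier G) D {\<one>} i"
    if a: "a \<in> carrier G" "\<And>d. d \<in> D \<Longrightarrow> commutator G a d \<in> hyper G (carrier G) D {\<one>} i" and d: "d \<in> T closure_of D" for a d
  proof -
    have "closedin T {d \<in> carrier G. commutator G a d \<in> hyper G (carrier G) D {\<one>} i}"
      using a cl by (intro closedin_preimage cont_commutator cont_id cont_const) auto
    then have "T closure_of D \<subseteq> {d \<in> carrier G. commutator G a d \<in> hyper G (carrier G) D {\<one>} i}"
      using a D by (intro closure_of_minimal) auto
    then show ?thesis using d by auto
  qed
  moreover have "D \<subseteq> T closure_of D" using D by (simp add: closure_of_subset topspace_eq)
  ultimately show ?case using Suc by auto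
qed simp

end

section \<open>Open normal subgroups of profinite groups\<close>

context profinite_group
begin

lemma closed_one: "closedin T {\<one>}"
  using Hausdorff by (intro closedin_Hausdorff_singleton) (auto simp: topspace_eq)

text \<open>In a compact Hausdorff space a compact and a closed set that no connected set meets
  simultaneously can be separated by clopen sets; here connected sets have at most one
  point.\<close>

lemma clopen_neighbourhood:
  assumes U: "openin T U" "\<one> \<in> U"
  shows "\<exists>K. openin T K \<and> closedin T K \<and> \<one> \<in> K \<and> K \<subseteq> U"
proof -
  have "separated_between T {\<one>} (topspace T - U)"
  proof (rule cut_wire_fence_theorem_gen[OF compact])
    show "Hausdorff_space T \<or> regular_space T \<or> normal_space T" using Hausdorff by simp
    show "compactin T {\<one>}" by (simp add: topspace_eq)
    show "closedin T (topspace T - U)" using U by (simp add: closedin_diff)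
    show "disjnt C {\<one>} \<or> disjnt C (topspace T - U)" if C: "connectedin T C" for C
    proof -
      obtain a where "C \<subseteq> {a}" using C totally_disconnected unfolding totally_disconnected_space_def by blast
      then show ?thesis using U by (cases "a = \<one>") (auto simp: disjnt_def)
    qed
  qed
  then obtain K K' where K: "openin T K" "openin T K'" "K \<union> K' = topspace T" "disjnt K K'"
    "{\<one>} \<subseteq> K" "topspace T - U \<subseteq> K'"
    unfolding separated_between_def by blast
  then have "K = topspace T - K'" using openin_subset by (auto simp: disjnt_def)
  then have "closedin T K" using K by (metis closedin_diff closedin_topspace)
  moreover have "K \<subseteq> U" using K openin_subset[of T K] by (auto simp: disjnt_def)
  ultimately show ?thesis using K by auto
qed

text \<open>Projection along a compact factor is a closed map, so quantifying universally over the
  group preserves openness. Both open sets in the construction of an open normal subgroup arise in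
  this way.\<close>

lemma closedin_projection:
  assumes "closedin (prod_topology T T) S"
  shows "openin T {g \<in> carrier G. \<forall>k. (k, g) \<notin> S}"
proof -
  have "closed_map (prod_topology T T) T snd" using closed_map_snd[OF compact] .
  then have "closedin T (snd ` S)" using assms by (simp add: closed_map_def)
  moreover have "{g \<in> carrier G. \<forall>k. (k, g) \<notin> S} = topspace T - snd ` S" by (force simp: topspace_eq)
  ultimately show ?thesis by (simp add: openin_diff)
qed

lemma closedin_prod_preimage:
  "continuous_map (prod_topology T T) T f \<Longrightarrow> closedin T C \<Longrightarrow>
    closedin (prod_topology T T) {z \<in> carrier G \<times> carrier G. f z \<in> C}"
  using closedin_continuous_map_preimage[of "prod_topology T T" T f C] by (simp add: topspace_eq)

lemma cont_fst_snd: "continuous_map (prod_topology T T) T fst" "continuous_map (prod_topology T T) T snd"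
  by (simp_all add: continuous_map_fst continuous_map_snd)

theorem open_normal_subgroup:
  assumes U: "openin T U" "\<one> \<in> U"
  shows "\<exists>N. N \<lhd> G \<and> openin T N \<and> N \<subseteq> U"
proof -
  obtain K where K: "openin T K" "closedin T K" "\<one> \<in> K" "K \<subseteq> U" using clopen_neighbourhood[OF U] by blast
  have KC: "K \<subseteq> carrier G" using openin_subset[OF K(1)] by (simp add: topspace_eq)
  define S where "S = {z \<in> carrier G \<times> carrier G. fst z \<in> K} \<inter> {z \<in> carrier G \<times> carrier G. fst z \<otimes> snd z \<in> topspace T - K}"
  have "closedin (prod_topology T T) S"
    unfolding S_def using K
    by (intro closedin_Int closedin_prod_preimage cont_mult cont_fst_snd) (auto intro: closedin_diff)
  then have oV: "openin T {g \<in> carrier G. \<forall>k. (k, g) \<notin> S}" by (rule closedin_projection)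
  \<comment> \<open>The elements whose right translation maps the clopen set \<open>K\<close> into
    itself. Those whose inverses also do form a subgroup, contained in \<open>K\<close> because
    \<open>\<one>\<close> lies in \<open>K\<close>.\<close>
  define V where "V = {g \<in> carrier G. \<forall>k\<in>K. k \<otimes> g \<in> K}"
  have VS: "V = {g \<in> carrier G. \<forall>k. (k, g) \<notin> S}" using KC by (fastforce simp: V_def S_def topspace_eq)
  define H where "H = V \<inter> {g \<in> carrier G. inv g \<in> V}"
  have oH: "openin T H" unfolding H_def by (intro openin_Int openin_preimage cont_inv cont_id) (use oV VS in simp_all)
  have Hs: "subgroup H G"
  proof (rule subgroupI)
    show "H \<subseteq> carrier G" by (auto simp: H_def)
    have "\<one> \<in> H" using KC by (auto simp: H_def V_def subset_iff)
    then show "H \<noteq> {}" by auto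
    fix a assume a: "a \<in> H"
    then show "inv a \<in> H" by (auto simp: H_def)
    fix b assume b: "b \<in> H"
    have V2: "x \<otimes> y \<in> V" if "x \<in> V" "y \<in> V" for x y
      using that KC by (auto simp: V_def m_assoc[symmetric] subset_iff)
    show "a \<otimes> b \<in> H" using a b V2[of a b] V2[of "inv b" "inv a"] by (auto simp: H_def inv_mult_group)
  qed
  have HK: "H \<subseteq> K" using K(3) by (auto simp: H_def V_def)
  \<comment> \<open>The normal core of \<open>H\<close>, which is open by compactness.\<close>
  define N where "N = {g \<in> carrier G. \<forall>x\<in>carrier G. cj x g \<in> H}"
  have "closedin (prod_topology T T) {z \<in> carrier G \<times> carrier G. cj (fst z) (snd z) \<in> topspace T - H}"
    using oH by (intro closedin_prod_preimage cont_cj cont_fst_snd) (auto intro: closedin_diff)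
  then have "openin T {g \<in> carrier G. \<forall>k. (k, g) \<notin> {z \<in> carrier G \<times> carrier G. cj (fst z) (snd z) \<in> topspace T - H}}"
    by (rule closedin_projection)
  also have "{g \<in> carrier G. \<forall>k. (k, g) \<notin> {z \<in> carrier G \<times> carrier G. cj (fst z) (snd z) \<in> topspace T - H}} = N"
    by (auto simp: N_def topspace_eq)
  finally have oN: "openin T N" .
  have "N \<lhd> G"
  proof (rule normalI_cj)
    show "subgroup N G"
    proof (rule subgroupI)
      show "N \<subseteq> carrier G" by (auto simp: N_def)
      have "\<one> \<in> N" using subgroup.one_closed[OF Hs] by (simp add: N_def)
      then show "N \<noteq> {}" by auto
      fix a assume a: "a \<in> N"
      then show "inv a \<in> N" using subgroup.m_inv_closed[OF Hs] by (simp add: N_def cj_inv)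
      fix b assume b: "b \<in> N"
      show "a \<otimes> b \<in> N" using a b subgroup.m_closed[OF Hs] by (simp add: N_def cj_mult)
    qed
    show "cj g x \<in> N" if "g \<in> carrier G" "x \<in> N" for g x
      using that by (simp add: N_def cj_cj)
  qed
  moreover have "N \<subseteq> U"
  proof
    fix g assume "g \<in> N"
    then have "cj \<one> g \<in> H" "g \<in> carrier G" by (auto simp: N_def)
    then show "g \<in> U" using HK K(4) by auto
  qed
  ultimately show ?thesis using oN by blast
qed

end

text \<open>\<open>H\<close> and its class bound \<open>k\<close> are chosen separately for each
  pair, as the cover has no common bound on the classes.\<close>

definition (in group) good_pair :: "'a set \<Rightarrow> 'a \<Rightarrow> 'a \<Rightarrow> bool" where
  "good_pair M x y \<longleftrightarrow> (\<exists>H k. subgroup H G \<and> H \<subseteq> hyper G (carrier G) H {\<one>} k \<and>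
    (\<forall>m\<in>M. \<forall>n\<in>M. cm (x \<otimes> m) (y \<otimes> n) \<in> H))"

lemma (in group) good_pair_antimono: "good_pair M x y \<Longrightarrow> M' \<subseteq> M \<Longrightarrow> good_pair M' x y"
  unfolding good_pair_def by (meson subsetD)

section \<open>Baire category and good pairs\<close>

context profinite_group
begin

text \<open>The compact set \<open>aN \<times> bN\<close> is a countable union of closed sets, on
  each of which the commutator stays in the closure of one member of the cover. By Baire one of them
  has an interior point, and a box around it yields \<open>x\<close>, \<open>y\<close> and
  \<open>M\<close>. The closure satisfies the same nilpotency bound.\<close>

lemma good_pair_in_cosets:
  assumes F: "countable \<F>" "\<And>H. H \<in> \<F> \<Longrightarrow> subgroup H G" "\<And>H. H \<in> \<F> \<Longrightarrow> \<exists>k. H \<subseteq> hyper G (carrier G) H {\<one>} k"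
    and cover: "commutator_set G \<subseteq> \<Union>\<F>"
    and N: "N \<lhd> G" "openin T N" and ab: "a \<in> carrier G" "b \<in> carrier G"
  shows "\<exists>x y M. x \<in> carrier G \<and> y \<in> carrier G \<and> inv a \<otimes> x \<in> N \<and> inv b \<otimes> y \<in> N \<and>
    M \<lhd> G \<and> openin T M \<and> good_pair M x y"
proof -
  let ?P = "prod_topology T T"
  have Ns: "subgroup N G" using N normal_imp_subgroup by blast
  have clN: "closedin T N" using open_subgroup_closed[OF Ns N(2)] .
  define B where "B = {z \<in> carrier G \<times> carrier G. inv a \<otimes> fst z \<in> N} \<inter> {z \<in> carrier G \<times> carrier G. inv b \<otimes> snd z \<in> N}"
  have ctm: "continuous_map ?P T (\<lambda>z. inv a \<otimes> fst z)" "continuous_map ?P T (\<lambda>z. inv b \<otimes> snd z)"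
    by (intro cont_mult cont_fst_snd cont_const inv_closed ab)+
  have clB: "closedin ?P B" unfolding B_def
    using closedin_prod_preimage[OF ctm(1) clN] closedin_prod_preimage[OF ctm(2) clN] by (rule closedin_Int)
  have opB: "openin ?P B" unfolding B_def
    using openin_Int[OF openin_continuous_map_preimage[OF ctm(1) N(2)] openin_continuous_map_preimage[OF ctm(2) N(2)]]
    by (simp add: topspace_eq)
  have abB: "(a, b) \<in> B" using ab subgroup.one_closed[OF Ns] by (auto simp: B_def)
  define C where "C H = B \<inter> {z \<in> carrier G \<times> carrier G. cm (fst z) (snd z) \<in> T closure_of H}" for H
  have clC: "closedin ?P (C H)" for H
    unfolding C_def
    by (rule closedin_Int[OF clB closedin_prod_preimage[OF cont_commutator[OF cont_fst_snd] closedin_closure_of]])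
  have UC: "\<Union>(C ` \<F>) = B"
  proof (rule subset_antisym)
    show "B \<subseteq> \<Union>(C ` \<F>)"
    proof (rule subsetI)
      fix z assume z: "z \<in> B"
      then have "fst z \<in> carrier G" "snd z \<in> carrier G" by (auto simp: B_def)
      then have "cm (fst z) (snd z) \<in> commutator_set G" unfolding commutator_set_def by blast
      then obtain H where H: "H \<in> \<F>" "cm (fst z) (snd z) \<in> H" using cover by blast
      then have "cm (fst z) (snd z) \<in> T closure_of H"
        using closure_of_subset[of H T] subgroup.subset[OF F(2)[OF H(1)]] by (auto simp: topspace_eq)
      then show "z \<in> \<Union>(C ` \<F>)" using z H by (auto simp: C_def B_def)
    qed
  qed (auto simp: C_def)
  have "compact_space ?P" "Hausdorff_space ?P"
    using compact Hausdorff by (simp_all add: compact_space_prod_topology Hausdorff_space_prod_topology)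
  then have lc: "locally_compact_space ?P \<and> regular_space ?P"
    using compact_Hausdorff_or_regular_imp_normal_space compact_Hausdorff_imp_regular_space compact_imp_locally_compact_space by blast
  have "\<exists>H\<in>\<F>. ?P interior_of (C H) \<noteq> {}"
  proof (rule ccontr)
    assume "\<not> ?thesis"
    then have "?P interior_of \<Union>(C ` \<F>) = {}"
      using F(1) clC lc by (intro Baire_category_alt) auto
    then show False using UC opB abB by (simp add: interior_of_openin)
  qed
  then obtain H z where H: "H \<in> \<F>" "z \<in> ?P interior_of (C H)" by auto
  obtain x y where z: "z = (x, y)" by (cases z)
  have zC: "(x, y) \<in> C H" using H(2) z subsetD[OF interior_of_subset[of ?P "C H"]] by simp
  then have xy: "x \<in> carrier G" "y \<in> carrier G" "inv a \<otimes> x \<in> N" "inv b \<otimes> y \<in> N" by (auto simp: C_def B_def)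
  obtain U U' where U: "openin T U" "openin T U'" "x \<in> U" "y \<in> U'" "U \<times> U' \<subseteq> ?P interior_of (C H)"
  proof -
    have "openin ?P (?P interior_of (C H))" by (rule openin_interior_of)
    then have "\<exists>U U'. openin T U \<and> openin T U' \<and> x \<in> U \<and> y \<in> U' \<and> U \<times> U' \<subseteq> ?P interior_of (C H)"
      using H(2) z unfolding openin_prod_topology_alt by blast
    then show ?thesis using that by blast
  qed
  define O1 where "O1 = {m \<in> carrier G. x \<otimes> m \<in> U} \<inter> {m \<in> carrier G. y \<otimes> m \<in> U'}"
  have "openin T O1" unfolding O1_def using U xy
    by (intro openin_Int openin_preimage cont_mult cont_id cont_const) auto
  moreover have "\<one> \<in> O1" using U xy by (simp add: O1_def)
  ultimately obtain M where M: "M \<lhd> G" "openin T M" "M \<subseteq> O1" using open_normal_subgroup by blast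
  have cls: "subgroup (T closure_of H) G" using closure_subgroup F H by blast
  obtain k where k: "H \<subseteq> hyper G (carrier G) H {\<one>} k" using F H by blast
  have HC: "H \<subseteq> carrier G" using F(2)[OF H(1)] by (rule subgroup.subset)
  have "closedin T (hyper G (carrier G) H {\<one>} k)"
    using closedin_hyper[OF _ closed_one HC, of "carrier G"] closedin_topspace[of T] by (simp add: topspace_eq)
  then have "T closure_of H \<subseteq> hyper G (carrier G) H {\<one>} k" using k by (rule closure_of_minimal[rotated])
  then have kcl: "T closure_of H \<subseteq> hyper G (carrier G) (T closure_of H) {\<one>} k"
    using hyper_closure[OF HC closed_one] by simp
  have "cm (x \<otimes> m) (y \<otimes> n) \<in> T closure_of H" if "m \<in> M" "n \<in> M" for m n
  proof -
    have "(x \<otimes> m, y \<otimes> n) \<in> U \<times> U'" using that M by (auto simp: O1_def)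
    then have "(x \<otimes> m, y \<otimes> n) \<in> C H" using U(5) interior_of_subset[of ?P "C H"] by blast
    then show ?thesis by (simp add: C_def)
  qed
  then have "good_pair M x y" unfolding good_pair_def using cls kcl by blast
  then show ?thesis using xy M by blast
qed

lemma open_normal_finite_Int:
  assumes "finite I" "\<And>i. i \<in> I \<Longrightarrow> M i \<lhd> G \<and> openin T (M i)" "N \<lhd> G" "openin T N"
  shows "N \<inter> (\<Inter>i\<in>I. M i) \<lhd> G \<and> openin T (N \<inter> (\<Inter>i\<in>I. M i))"
  using assms
proof (induction I rule: finite_induct)
  case (insert i I)
  then have "N \<inter> (\<Inter>i\<in>I. M i) \<lhd> G" "openin T (N \<inter> (\<Inter>i\<in>I. M i))" "M i \<lhd> G" "openin T (M i)" by auto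
  moreover have "N \<inter> (\<Inter>j\<in>insert i I. M j) = M i \<inter> (N \<inter> (\<Inter>i\<in>I. M i))" by auto
  ultimately show ?case by (simp add: normal_subgroup_intersect openin_Int)
qed simp

text \<open>\<open>N\<close> has finite index, so finitely many pairs of representatives suffice,
  and goodness survives passing to the intersection of the subgroups obtained for them.\<close>

theorem uniform_good_pairs:
  assumes F: "countable \<F>" "\<And>H. H \<in> \<F> \<Longrightarrow> subgroup H G" "\<And>H. H \<in> \<F> \<Longrightarrow> \<exists>k. H \<subseteq> hyper G (carrier G) H {\<one>} k"
    and cover: "commutator_set G \<subseteq> \<Union>\<F>" and N: "N \<lhd> G" "openin T N"
  shows "\<exists>M. M \<lhd> G \<and> openin T M \<and> M \<subseteq> N \<and>
    (\<forall>a\<in>carrier G. \<forall>b\<in>carrier G. \<exists>x\<in>carrier G. \<exists>y\<in>carrier G. inv a \<otimes> x \<in> N \<and> inv b \<otimes> y \<in> N \<and> good_pair M x y)"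
proof -
  have Ns: "subgroup N G" using N normal_imp_subgroup by blast
  have finN: "finite (rcosets N)" using open_subgroup_finite_index[OF Ns N(2) compact] .
  define r where "r C = (SOME x. x \<in> C)" for C :: "'a set"
  define A where "A = r ` (rcosets N)"
  have rep: "\<exists>a\<in>A. a \<in> carrier G \<and> inv a \<otimes> g \<in> N" if g: "g \<in> carrier G" for g
  proof -
    have C: "N #> g \<in> rcosets N" using g subgroup.subset[OF Ns] by (intro rcosetsI) auto
    have "r (N #> g) \<in> N #> g" unfolding r_def using rcos_self[OF g Ns] by (rule someI)
    then obtain n where n: "n \<in> N" "r (N #> g) = n \<otimes> g" by (auto simp: r_coset_def)
    have nc: "n \<in> carrier G" using n Ns subgroup.mem_carrier by metis
    have "inv (n \<otimes> g) \<otimes> g = cj g (inv n)" using g nc by (simp add: word_simps)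
    also have "\<dots> \<in> N" using normal_cj[OF N(1) g] n Ns by (simp add: subgroup.m_inv_closed)
    finally show ?thesis using n nc g C unfolding A_def by (metis imageI m_closed)
  qed
  define P where "P = (A \<inter> carrier G) \<times> (A \<inter> carrier G)"
  have finP: "finite P" using finN by (simp add: P_def A_def)
  have "\<forall>p\<in>P. \<exists>M. \<exists>x y. x \<in> carrier G \<and> y \<in> carrier G \<and> inv (fst p) \<otimes> x \<in> N \<and> inv (snd p) \<otimes> y \<in> N \<and>
    M \<lhd> G \<and> openin T M \<and> good_pair M x y"
  proof
    fix p assume "p \<in> P"
    then have "fst p \<in> carrier G" "snd p \<in> carrier G" by (auto simp: P_def)
    from good_pair_in_cosets[OF F cover N this]
    show "\<exists>M. \<exists>x y. x \<in> carrier G \<and> y \<in> carrier G \<and> inv (fst p) \<otimes> x \<in> N \<and> inv (snd p) \<otimes> y \<in> N \<and>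
      M \<lhd> G \<and> openin T M \<and> good_pair M x y" by blast
  qed
  then obtain M where M: "\<And>p. p \<in> P \<Longrightarrow> \<exists>x y. x \<in> carrier G \<and> y \<in> carrier G \<and> inv (fst p) \<otimes> x \<in> N \<and> inv (snd p) \<otimes> y \<in> N \<and>
    M p \<lhd> G \<and> openin T (M p) \<and> good_pair (M p) x y"
    by metis
  define M' where "M' = N \<inter> (\<Inter>p\<in>P. M p)"
  have M': "M' \<lhd> G \<and> openin T M'"
    unfolding M'_def using M by (intro open_normal_finite_Int finP N) blast
  have tr: "inv g \<otimes> x \<in> N" if "inv a \<otimes> g \<in> N" "inv a \<otimes> x \<in> N" "a \<in> carrier G" "g \<in> carrier G" "x \<in> carrier G" for a g x
  proof -
    have "inv g \<otimes> x = inv (inv a \<otimes> g) \<otimes> (inv a \<otimes> x)" using that by (simp add: word_simps)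
    then show ?thesis using that Ns by (simp add: subgroup.m_closed subgroup.m_inv_closed)
  qed
  have "\<exists>x\<in>carrier G. \<exists>y\<in>carrier G. inv g \<otimes> x \<in> N \<and> inv h \<otimes> y \<in> N \<and> good_pair M' x y"
    if g: "g \<in> carrier G" and h: "h \<in> carrier G" for g h
  proof -
    obtain a where a: "a \<in> A" "a \<in> carrier G" "inv a \<otimes> g \<in> N" using rep[OF g] by blast
    obtain b where b: "b \<in> A" "b \<in> carrier G" "inv b \<otimes> h \<in> N" using rep[OF h] by blast
    have p: "(a, b) \<in> P" using a b by (simp add: P_def)
    obtain x y where xy: "x \<in> carrier G" "y \<in> carrier G" "inv a \<otimes> x \<in> N" "inv b \<otimes> y \<in> N" "good_pair (M (a, b)) x y"
      using M[OF p] by auto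
    have "M' \<subseteq> M (a, b)" using p by (auto simp: M'_def)
    then have "good_pair M' x y" using xy good_pair_antimono by blast
    then show ?thesis using xy tr a b g h by blast
  qed
  then show ?thesis using M' by (intro exI[of _ M']) (auto simp: M'_def)
qed

end

section \<open>Baer's theorem\<close>

context group
begin

text \<open>Modulo \<open>Y\<close> the factor \<open>a\<close> is central and \<open>b\<close>
  commutes with \<open>l\<close> and \<open>[l, x]\<close>, so neither affects the commutator. Used
  for the calculus of central series and for replacing a pair by a good one.\<close>

lemma commutator_congruent:
  assumes Y: "Y \<lhd> G" and c: "l \<in> carrier G" "x \<in> carrier G" "a \<in> carrier G" "b \<in> carrier G"
    and a: "\<And>g. g \<in> carrier G \<Longrightarrow> cm a g \<in> Y" and b: "cm l b \<in> Y" "cm (cm l x) b \<in> Y"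
  shows "inv (cm l x) \<otimes> cm (l \<otimes> a) (x \<otimes> b) \<in> Y"
proof -
  have Ys: "subgroup Y G" using Y normal_imp_subgroup by blast
  have Yc: "y \<in> carrier G" if "y \<in> Y" for y using that Ys subgroup.mem_carrier by metis
  let ?w = "x \<otimes> b"
  have "cm (cm l ?w) a \<in> Y"
    using a[of "cm l ?w"] inv_cm[of a "cm l ?w"] c subgroup.m_inv_closed[OF Ys, of "cm a (cm l ?w)"] by simp
  then have 1: "cm (cm l ?w) a \<otimes> cm a ?w \<in> Y" using a[of ?w] c subgroup.m_closed[OF Ys] by simp
  have "cj (cj b (cm l x)) (cm l b) \<in> Y" using normal_cj[OF Y _ b(1)] c by simp
  then have 2: "cm (cm l x) b \<otimes> cj (cj b (cm l x)) (cm l b) \<in> Y" using b subgroup.m_closed[OF Ys] by simp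
  have "cm l ?w = cm l x \<otimes> (cm (cm l x) b \<otimes> cj (cj b (cm l x)) (cm l b))"
  proof -
    have "cm l ?w = cm l b \<otimes> cj b (cm l x)" using c by (simp add: cm_mult_right)
    also have "\<dots> = cj b (cm l x) \<otimes> cj (cj b (cm l x)) (cm l b)" using c by (simp add: mult_cj)
    also have "\<dots> = (cm l x \<otimes> cm (cm l x) b) \<otimes> cj (cj b (cm l x)) (cm l b)"
      using cj_eq_cm[of "cm l x" b] c by simp
    finally show ?thesis using c by (simp add: m_assoc)
  qed
  moreover have "cm (l \<otimes> a) ?w = cm l ?w \<otimes> (cm (cm l ?w) a \<otimes> cm a ?w)"
    using c by (simp add: cm_mult_left cj_eq_cm m_assoc)
  ultimately have "inv (cm l x) \<otimes> cm (l \<otimes> a) ?w =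
      (cm (cm l x) b \<otimes> cj (cj b (cm l x)) (cm l b)) \<otimes> (cm (cm l ?w) a \<otimes> cm a ?w)"
    using c by (simp add: m_assoc)
  then show ?thesis using 1 2 subgroup.m_closed[OF Ys] by simp
qed

abbreviation "uc i \<equiv> hyper G (carrier G) (carrier G) {\<one>} i"

lemma nrm_carrier: "nrm (carrier G) = carrier G"
  by (auto simp: nrm_def)

lemma hyper_carrier_normal: "B \<lhd> G \<Longrightarrow> D \<subseteq> carrier G \<Longrightarrow> nrm D = carrier G \<Longrightarrow> hyper G (carrier G) D B i \<lhd> G"
proof -
  assume B: "B \<lhd> G" and D: "D \<subseteq> carrier G" "nrm D = carrier G"
  have n: "nrm B = carrier G" "subgroup B G" using B normal_iff_nrm by auto
  have "subgroup (hyper G (carrier G) D B i) G"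
    using n D subgroup.subset[OF n(2)] by (intro subgroup_hyper subgroup_self) auto
  moreover have "g \<in> nrm (hyper G (carrier G) D B i)" if "g \<in> carrier G" for g
    using that n D nrm_carrier by (intro nrm_hyper) auto
  ultimately show "hyper G (carrier G) D B i \<lhd> G"
    using nrm_subset unfolding normal_iff_nrm by blast
qed

lemma uc_normal: "uc i \<lhd> G"
  by (intro hyper_carrier_normal one_is_normal nrm_carrier order_refl)

lemma upper_central_eq: "upper_central G i = uc i"
proof (induction i)
  case (Suc i)
  let ?Z = "uc i" and ?Q = "G Mod uc i" and ?h = "\<lambda>x. uc i #> x"
  interpret h: group_hom G ?Q ?h by (rule Mod_group_hom[OF uc_normal])
  have surj: "carrier ?Q = ?h ` carrier G" using Mod_group_hom(2)[OF uc_normal] by simp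
  have "?h x \<in> center ?Q \<longleftrightarrow> (\<forall>y\<in>carrier G. cm x y \<in> ?Z)" if x: "x \<in> carrier G" for x
  proof -
    have "?h x \<otimes>\<^bsub>?Q\<^esub> ?h y = ?h y \<otimes>\<^bsub>?Q\<^esub> ?h x \<longleftrightarrow> cm x y \<in> ?Z" if y: "y \<in> carrier G" for y
      using h.H.commute_iff_cm[OF h.hom_closed[OF x] h.hom_closed[OF y]]
        hom_commutator[OF h.group_hom_axioms x y] coset_eq_one_iff[OF uc_normal, of "cm x y" i] x y by simp
    then show ?thesis using x by (simp add: center_def surj del: mult_FactGroup)
  qed
  then show ?case using Suc by auto
qed simp

section \<open>Central series of subgroups and quotients\<close>

lemma hyper_subgroup_eq:
  assumes D: "subgroup D G" and B: "B \<subseteq> D"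
  shows "hyper (G\<lparr>carrier := D\<rparr>) D D B i = hyper G D D B i"
  using D by (induction i) (auto simp: subgroup_commutator)

lemma upper_central_subgroup:
  assumes D: "subgroup D G"
  shows "upper_central (G\<lparr>carrier := D\<rparr>) i = hyper G D D {\<one>} i"
proof -
  interpret D: group "G\<lparr>carrier := D\<rparr>" using D is_group by (rule subgroup.subgroup_is_group)
  show ?thesis using D.upper_central_eq[of i] hyper_subgroup_eq[OF D, of "{\<one>}" i] subgroup.one_closed[OF D] by simp
qed

text \<open>The ambient set is \<open>carrier G\<close> and not \<open>H\<close>, so that only the
  acting set changes when \<open>H\<close> is replaced by its closure; intersecting with
  \<open>H\<close> recovers the upper central series of \<open>H\<close>.\<close>

lemma nilpotent_subgroup_iff:
  assumes H: "subgroup H G"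
  shows "nilpotent_group (G\<lparr>carrier := H\<rparr>) \<longleftrightarrow> (\<exists>k. H \<subseteq> hyper G (carrier G) H {\<one>} k)"
proof -
  have sub: "hyper G H H {\<one>} i \<subseteq> H" for i using hyper_subset[of "{\<one>}" H] subgroup.one_closed[OF H] by simp
  have 1: "hyper G H H {\<one>} i \<subseteq> hyper G (carrier G) H {\<one>} i" for i
    using subgroup.subset[OF H] by (rule hyper_mono_carrier)
  have 2: "H \<inter> hyper G (carrier G) H {\<one>} i \<subseteq> hyper G H H {\<one>} i" for i
    by (induction i) (auto simp: subgroup_cm[OF H] subset_iff)
  show ?thesis
    unfolding nilpotent_group_def using upper_central_subgroup[OF H] subgroup.subgroup_is_group[OF H is_group] sub 1 2
    by simp blast
qed

lemma hyper_Mod: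
  assumes K: "K \<lhd> G" and x: "x \<in> carrier G"
  shows "K #> x \<in> hyper (G Mod K) (carrier (G Mod K)) (carrier (G Mod K)) {\<one>\<^bsub>G Mod K\<^esub>} i \<longleftrightarrow>
    x \<in> hyper G (carrier G) (carrier G) K i"
  using x
proof (induction i arbitrary: x)
  case 0
  then show ?case using coset_eq_one_iff[OF K] by simp
next
  case (Suc i)
  interpret h: group_hom G "G Mod K" "\<lambda>x. K #> x" by (rule Mod_group_hom[OF K])
  have surj: "carrier (G Mod K) = (\<lambda>x. K #> x) ` carrier G" using Mod_group_hom(2)[OF K] by simp
  have "commutator (G Mod K) (K #> x) (K #> y) = K #> cm x y" if "y \<in> carrier G" for y
    using hom_commutator[OF h.group_hom_axioms] Suc.prems that by simp
  then show ?case using Suc by (simp add: surj)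
qed

lemma nilpotent_Mod_iff:
  assumes K: "K \<lhd> G"
  shows "nilpotent_group (G Mod K) \<longleftrightarrow> (\<exists>n. carrier G \<subseteq> hyper G (carrier G) (carrier G) K n)"
proof -
  interpret h: group_hom G "G Mod K" "\<lambda>x. K #> x" by (rule Mod_group_hom[OF K])
  have surj: "carrier (G Mod K) = (\<lambda>x. K #> x) ` carrier G" using Mod_group_hom(2)[OF K] by simp
  have sub: "h.H.uc n \<subseteq> carrier (G Mod K)" for n using h.H.one_closed by (intro h.H.hyper_subset) blast
  have "h.H.uc n = carrier (G Mod K) \<longleftrightarrow> carrier G \<subseteq> hyper G (carrier G) (carrier G) K n" for n
  proof -
    have "h.H.uc n = carrier (G Mod K) \<longleftrightarrow> (\<forall>x\<in>carrier G. K #> x \<in> h.H.uc n)"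
      using sub[of n] unfolding surj by blast
    then show ?thesis using hyper_Mod[OF K, of _ n] by blast
  qed
  then show ?thesis using h.H.is_group by (simp add: nilpotent_group_def h.H.upper_central_eq)
qed

lemma finite_by_nilpotent_iff:
  "finite_by_nilpotent G \<longleftrightarrow> (\<exists>K n. K \<lhd> G \<and> finite K \<and> carrier G \<subseteq> hyper G (carrier G) (carrier G) K n)"
  unfolding finite_by_nilpotent_def using nilpotent_Mod_iff by blast

text \<open>The lower central series with indices shifted by one: \<open>lcs 1\<close> is the
  derived subgroup.\<close>

primrec lcs :: "nat \<Rightarrow> 'a set" where
  "lcs 0 = carrier G"
| "lcs (Suc i) = generate G {cm l x | l x. l \<in> lcs i \<and> x \<in> carrier G}"

lemma lcs_normal: "lcs i \<lhd> G"
proof (induction i)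
  case 0
  then show ?case by (simp add: normalI_cj subgroup_self)
next
  case (Suc i)
  have lc: "lcs i \<subseteq> carrier G" using Suc normal_imp_subgroup subgroup.subset by blast
  show ?case unfolding lcs.simps
  proof (rule generate_normal_cj)
    show "{cm l x | l x. l \<in> lcs i \<and> x \<in> carrier G} \<subseteq> carrier G" using lc by auto
    fix g s assume g: "g \<in> carrier G" and "s \<in> {cm l x | l x. l \<in> lcs i \<and> x \<in> carrier G}"
    then obtain l x where lx: "l \<in> lcs i" "x \<in> carrier G" "s = cm l x" by blast
    have "cj g s = cm (cj g l) (cj g x)" using lx g lc by (auto simp: cj_cm)
    moreover have "cj g l \<in> lcs i" using normal_cj[OF Suc g lx(1)] .
    ultimately show "cj g s \<in> {cm l x | l x. l \<in> lcs i \<and> x \<in> carrier G}" using lx g by auto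
  qed
qed

lemma lcs_carrier: "l \<in> lcs i \<Longrightarrow> l \<in> carrier G"
  using normal_carrier[OF lcs_normal] .

text \<open>The classical relation between the two central series, proved on generators
  \<open>s = [l, x]\<close>: the conjugate \<open>s^z = [l [l, z], x [x, z]]\<close> agrees with
  \<open>s\<close> modulo the required term by \<open>commutator_congruent\<close>. Truncated
  subtraction turns the case \<open>j \<le> Suc i\<close> into
  \<open>[l, z] = \<one>\<close>.\<close>

lemma lcs_uc_commutator: "l \<in> lcs i \<Longrightarrow> z \<in> uc j \<Longrightarrow> cm l z \<in> uc (j - Suc i)"
proof (induction i arbitrary: l z j)
  case 0
  show ?case
  proof (cases j)
    case 0
    then show ?thesis using \<open>l \<in> lcs 0\<close> \<open>z \<in> uc j\<close> by simp
  next
    case (Suc j')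
    then have "cm z l \<in> uc j'" "z \<in> carrier G" using 0 by auto
    then show ?thesis
      using \<open>l \<in> lcs 0\<close> Suc inv_cm[of z l] subgroup.m_inv_closed[OF normal_imp_subgroup[OF uc_normal], of "cm z l"]
      by simp
  qed
next
  case (Suc i)
  have ucs: "subgroup (uc k) G" for k using uc_normal normal_imp_subgroup by blast
  have ucc: "z \<in> carrier G" if "z \<in> uc k" for z k using that ucs subgroup.mem_carrier by metis
  let ?S = "{g \<in> carrier G. \<forall>j. \<forall>z\<in>uc j. cm g z \<in> uc (j - Suc (Suc i))}"
  have "lcs (Suc i) \<subseteq> ?S"
    unfolding lcs.simps
  proof (rule generate_subgroup_incl)
    show "subgroup ?S G"
    proof (rule subgroupI)
      have "\<one> \<in> ?S" using ucc subgroup.one_closed[OF ucs] by simp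
      then show "?S \<noteq> {}" by blast
      fix a assume a: "a \<in> ?S"
      then show "inv a \<in> ?S"
        using ucc subgroup.m_inv_closed[OF ucs] normal_cj[OF uc_normal, of "inv a"] by (auto simp: cm_inv_left)
      fix b assume b: "b \<in> ?S"
      show "a \<otimes> b \<in> ?S"
        using a b ucc subgroup.m_closed[OF ucs] normal_cj[OF uc_normal, of b] by (auto simp: cm_mult_left)
    qed auto
    show "{cm l x | l x. l \<in> lcs i \<and> x \<in> carrier G} \<subseteq> ?S"
    proof
      fix s assume "s \<in> {cm l x | l x. l \<in> lcs i \<and> x \<in> carrier G}"
      then obtain l x where lx: "l \<in> lcs i" "x \<in> carrier G" "s = cm l x" by blast
      have lc: "l \<in> carrier G" using lx lcs_carrier by blast
      have "cm s z \<in> uc (j - Suc (Suc i))" if z: "z \<in> uc j" for z j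
      proof (cases j)
        case 0
        then show ?thesis using z lx lc by simp
      next
        case (Suc j')
        have zc: "z \<in> carrier G" using z ucc by blast
        let ?Y = "uc (j - Suc (Suc i))"
        have "cm l z \<in> uc (j - Suc i)" using Suc.IH lx z by blast
        then have a: "cm (cm l z) g \<in> ?Y" if "g \<in> carrier G" for g
        proof (cases "j - Suc i")
          case 0
          then show ?thesis using \<open>cm l z \<in> uc (j - Suc i)\<close> that subgroup.one_closed[OF ucs] by simp
        next
          case (Suc n)
          then have "n = j - Suc (Suc i)" by simp
          then show ?thesis using \<open>cm l z \<in> uc (j - Suc i)\<close> Suc that by simp
        qed
        have "cm z x \<in> uc j'" using z Suc lx by simp
        then have "cm x z \<in> uc j'" using inv_cm[of z x] zc lx subgroup.m_inv_closed[OF ucs] by metis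
        moreover have "cm l x \<in> lcs i" using normal_cm_left[OF lcs_normal] lx by blast
        moreover have "j' - Suc i = j - Suc (Suc i)" using Suc by simp
        ultimately have b: "cm l (cm x z) \<in> ?Y" "cm (cm l x) (cm x z) \<in> ?Y" using Suc.IH lx by metis+
        have "inv (cm l x) \<otimes> cm (l \<otimes> cm l z) (x \<otimes> cm x z) \<in> ?Y"
          using commutator_congruent[OF uc_normal lc lx(2) _ _ a b] lc lx zc by simp
        moreover have "cm (l \<otimes> cm l z) (x \<otimes> cm x z) = cj z (cm l x)"
          using cj_eq_cm[of l z] cj_eq_cm[of x z] cj_cm[of l x z] lc lx zc by simp
        ultimately show ?thesis using lx lc zc by (simp add: cm_eq_cj[of "cm l x" z])
      qed
      then show "s \<in> ?S" using lx lc by simp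
    qed
  qed
  then show ?case using Suc.prems by blast
qed

lemma uc_mono: "i \<le> j \<Longrightarrow> uc i \<subseteq> uc j"
  using triv_subgroup by (intro hyper_mono_index) (auto simp: nrm_def)

text \<open>By the relative Schur theorem, \<open>lcs i\<close> is finite modulo its intersection with \<open>uc (m - i)\<close>, for every \<open>i \<le> m\<close>.\<close>

theorem finite_lcs:
  assumes fin: "finite (rcosets (uc m))"
  shows "finite (lcs m)"
proof -
  have ucs: "subgroup (uc k) G" for k using uc_normal normal_imp_subgroup by blast
  have ucc: "z \<in> carrier G" if "z \<in> uc k" for z k using that ucs subgroup.mem_carrier by metis
  have "i \<le> m \<Longrightarrow> finite ((\<lambda>x. uc (m - i) #> x) ` lcs i)" for i
  proof (induction i)
    case 0
    have "(\<lambda>x. uc m #> x) ` carrier G = rcosets (uc m)" by (auto simp: RCOSETS_def)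
    then show ?case using fin by simp
  next
    case (Suc i)
    obtain j where j: "m - i = Suc j" "m - Suc i = j" using Suc.prems by (metis Suc_diff_Suc Suc_le_lessD)
    let ?Z = "uc (Suc j)" and ?R = "uc j"
    \<comment> \<open>\<open>lcs i\<close> is enlarged by \<open>?Z\<close> in order to contain it;
      \<open>?Z\<close> is central modulo \<open>?R\<close>. The finite-index subgroup in Schur's
      theorem is \<open>uc m\<close>, because \<open>[lcs i, uc m]\<close> lies in
      \<open>uc (m - Suc i)\<close>.\<close>
    define L where "L = lcs i <#> ?Z"
    have Ln: "L \<lhd> G" unfolding L_def using lcs_normal uc_normal by (rule normal_subgroup_set_mult_closed)
    have sub: "lcs i \<subseteq> L" "?Z \<subseteq> L"
      unfolding L_def by (rule subset_set_mult[OF normal_imp_subgroup[OF lcs_normal] ucs])+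
    have fin1: "finite ((\<lambda>x. ?R #> x) ` generate G {cm l x | l x. l \<in> L \<and> x \<in> carrier G})"
    proof (rule finite_commutators_central_mod[OF uc_normal Ln ucs sub(2), where U = "uc m"])
      show "cm z x \<in> ?R" if "z \<in> ?Z" "x \<in> carrier G" for z x using that by simp
      have "?Z #> x \<in> (\<lambda>x. ?Z #> x) ` lcs i" if x: "x \<in> L" for x
      proof -
        obtain g z where gz: "g \<in> lcs i" "z \<in> ?Z" "x = g \<otimes> z" using x unfolding L_def set_mult_def by blast
        have c: "g \<in> carrier G" "z \<in> carrier G" using gz lcs_carrier ucc by blast+
        have "x = cj (inv g) z \<otimes> g" using gz c by (simp add: word_simps)
        moreover have "cj (inv g) z \<in> ?Z" using normal_cj[OF uc_normal _ gz(2), of "inv g"] c by simp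
        ultimately have "x \<in> ?Z #> g" unfolding r_coset_def by blast
        then have "?Z #> x = ?Z #> g" using repr_independence[OF _ c(1) ucs] by metis
        then show ?thesis using gz(1) by blast
      qed
      then have "(\<lambda>x. ?Z #> x) ` L \<subseteq> (\<lambda>x. ?Z #> x) ` lcs i" by blast
      then show "finite ((\<lambda>x. ?Z #> x) ` L)" using Suc j finite_subset by auto
      show "subgroup (uc m) G" by (rule ucs)
      show "cm l u \<in> ?R" if l: "l \<in> L" and u: "u \<in> uc m" for l u
      proof -
        obtain g z where gz: "g \<in> lcs i" "z \<in> ?Z" "l = g \<otimes> z" using l unfolding L_def set_mult_def by blast
        have c: "g \<in> carrier G" "z \<in> carrier G" "u \<in> carrier G"
          using lcs_carrier[OF gz(1)] ucc[OF gz(2)] ucc[OF u] by this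
        have "cm g u \<in> ?R" using lcs_uc_commutator[OF gz(1) u] j by simp
        then have "cj z (cm g u) \<in> ?R" by (rule normal_cj[OF uc_normal c(2)])
        moreover have "cm z u \<in> ?R" using gz(2) c(3) by simp
        ultimately have "cj z (cm g u) \<otimes> cm z u \<in> ?R" by (rule subgroup.m_closed[OF ucs])
        then show ?thesis unfolding gz(3) cm_mult_left[OF c] .
      qed
    qed (fact fin)
    have "lcs (Suc i) \<subseteq> generate G {cm l x | l x. l \<in> L \<and> x \<in> carrier G}"
      unfolding lcs.simps using sub(1) by (intro mono_generate) blast
    from finite_subset[OF image_mono[OF this] fin1] show ?case unfolding j(2) .
  qed
  \<comment> \<open>At \<open>i = m\<close> the modulus is the trivial group \<open>uc 0\<close>, so
    cosets are single elements.\<close>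
  from this[of m] have "finite ((\<lambda>x. {\<one>} #> x) ` lcs m)" by simp
  moreover have "inj_on (\<lambda>x. {\<one>} #> x) (lcs m)"
    using lcs_carrier by (auto simp: inj_on_def r_coset_def)
  ultimately show ?thesis using finite_imageD by blast
qed

text \<open>The finite normal subgroup is \<open>lcs m\<close>; modulo it the lower central series
  vanishes after \<open>m\<close> steps.\<close>

theorem finite_index_uc_imp_finite_by_nilpotent:
  assumes fin: "finite (rcosets (uc m))"
  shows "finite_by_nilpotent G"
proof -
  have "i \<le> m \<Longrightarrow> lcs (m - i) \<subseteq> hyper G (carrier G) (carrier G) (lcs m) i" for i
  proof (induction i)
    case (Suc i)
    have "cm l x \<in> lcs (m - i)" if "l \<in> lcs (m - Suc i)" "x \<in> carrier G" for l x
    proof -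
      have "m - i = Suc (m - Suc i)" using Suc.prems by simp
      then show ?thesis using that by (auto intro: generate.incl)
    qed
    then show ?case using Suc lcs_carrier by auto
  qed simp
  from this[of m] have "carrier G \<subseteq> hyper G (carrier G) (carrier G) (lcs m) m" by simp
  then show ?thesis unfolding finite_by_nilpotent_iff using lcs_normal finite_lcs[OF fin] by blast
qed

text \<open>The nilpotent subgroups are the full preimages of the cyclic subgroups of the quotient by the \<open>m\<close>-th centre.\<close>

theorem finite_index_uc_nilpotent_cover:
  assumes fin: "finite (rcosets (uc m))"
  shows "\<exists>\<F>. finite \<F> \<and> (\<forall>H\<in>\<F>. subgroup H G \<and> nilpotent_group (G\<lparr>carrier := H\<rparr>)) \<and> carrier G \<subseteq> \<Union>\<F>"
proof -
  let ?Z = "uc m" let ?Q = "G Mod ?Z" let ?h = "\<lambda>x. ?Z #> x"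
  have Zs: "subgroup ?Z G" using uc_normal normal_imp_subgroup by blast
  interpret h: group_hom G ?Q ?h by (rule Mod_group_hom[OF uc_normal])
  define H where "H x = {g \<in> carrier G. ?h g \<in> generate ?Q {?h x}}" for x
  have gs: "subgroup (generate ?Q {?h x}) ?Q" if "x \<in> carrier G" for x
    using that h.H.generate_is_subgroup by simp
  have Hs: "subgroup (H x) G" if x: "x \<in> carrier G" for x
  proof (rule subgroupI)
    show "H x \<subseteq> carrier G" by (auto simp: H_def)
    have "\<one> \<in> H x" using subgroup.one_closed[OF gs[OF x]] h.hom_one by (simp add: H_def)
    then show "H x \<noteq> {}" by blast
    fix a assume a: "a \<in> H x"
    then show "inv a \<in> H x" using subgroup.m_inv_closed[OF gs[OF x]] by (simp add: H_def)
    fix b assume b: "b \<in> H x"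
    show "a \<otimes> b \<in> H x"
      using a b subgroup.m_closed[OF gs[OF x]] by (simp add: H_def del: mult_FactGroup)
  qed
  have Hn: "nilpotent_group (G\<lparr>carrier := H x\<rparr>)" if x: "x \<in> carrier G" for x
  proof -
    have "cm a b \<in> ?Z" if a: "a \<in> H x" and b: "b \<in> H x" for a b
    proof -
      have c: "a \<in> carrier G" "b \<in> carrier G" using a b by (auto simp: H_def)
      obtain i j :: int where "?h a = ?h x [^]\<^bsub>?Q\<^esub> i" "?h b = ?h x [^]\<^bsub>?Q\<^esub> j"
        using a b h.H.generate_pow[OF h.hom_closed[OF x]] by (auto simp: H_def)
      then have "?h a \<otimes>\<^bsub>?Q\<^esub> ?h b = ?h b \<otimes>\<^bsub>?Q\<^esub> ?h a"
        using h.H.int_pow_mult[OF h.hom_closed[OF x]] by (metis add.commute)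
      then have "?h (cm a b) = \<one>\<^bsub>?Q\<^esub>"
        using h.H.commute_iff_cm[OF h.hom_closed[OF c(1)] h.hom_closed[OF c(2)]]
          hom_commutator[OF h.group_hom_axioms c] by simp
      then show ?thesis using coset_eq_one_iff[OF uc_normal] c by simp
    qed
    moreover have "?Z \<subseteq> hyper G (carrier G) (H x) {\<one>} m"
      using hyper_antimono[OF subgroup.subset[OF Hs[OF x]]] .
    ultimately have "H x \<subseteq> hyper G (carrier G) (H x) {\<one>} (Suc m)"
      using subgroup.subset[OF Hs[OF x]] by auto
    then show ?thesis using nilpotent_subgroup_iff[OF Hs[OF x]] by blast
  qed
  \<comment> \<open>Each \<open>H x\<close> is a union of some of the finitely many cosets of
    \<open>?Z\<close>, so only finitely many different subgroups occur.\<close>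
  have "H x = \<Union>{C \<in> rcosets ?Z. C \<subseteq> H x}" if x: "x \<in> carrier G" for x
  proof (rule subset_antisym; rule subsetI)
    fix g assume g: "g \<in> H x"
    then have gc: "g \<in> carrier G" by (simp add: H_def)
    have "?Z #> g \<subseteq> H x"
    proof
      fix y assume y: "y \<in> ?Z #> g"
      then have "?Z #> g = ?Z #> y" using repr_independence[OF _ gc Zs] by blast
      moreover have "y \<in> carrier G" using y r_coset_subset_G[OF subgroup.subset[OF Zs] gc] by blast
      ultimately show "y \<in> H x" using g by (simp add: H_def)
    qed
    moreover have "?Z #> g \<in> rcosets ?Z" using gc subgroup.subset[OF Zs] by (intro rcosetsI) auto
    ultimately show "g \<in> \<Union>{C \<in> rcosets ?Z. C \<subseteq> H x}" using rcos_self[OF gc Zs] by blast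
  qed blast
  then have "H ` carrier G \<subseteq> Union ` Pow (rcosets ?Z)" by blast
  then have "finite (H ` carrier G)" using fin by (meson finite_Pow_iff finite_imageI finite_subset)
  moreover have "carrier G \<subseteq> \<Union>(H ` carrier G)"
    by (auto simp: H_def intro: generate.incl)
  ultimately show ?thesis using Hs Hn by blast
qed

end

section \<open>The commutator subgroup acts nilpotently\<close>

context abelian_section
begin

lemma iterated_commutator_cong:
  assumes g: "g \<in> carrier G" and r: "r \<in> cent" and v: "v \<in> V"
  shows "\<pi> (((\<lambda>v. cm v (g \<otimes> r)) ^^ n) v) = \<pi> (((\<lambda>v. cm v g) ^^ n) v)"
proof -
  have rc: "r \<in> carrier G" using r by (simp add: cent_def)
  have "act (g \<otimes> r) (\<pi> w) = act g (\<pi> w)" if w: "w \<in> V" for w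
  proof -
    have "act (g \<otimes> r) (\<pi> w) = act r (\<pi> (cj g w))" using g rc w V_carrier by (simp add: act_\<pi> cj_cj)
    also have "\<dots> = \<pi> (cj g w)" using cent_iff[OF rc] r g w by simp
    finally show ?thesis using g w by (simp add: act_\<pi>)
  qed
  then have *: "\<pi> (cm w (g \<otimes> r)) = act g (\<pi> w) \<otimes>\<^bsub>Q\<^esub> inv\<^bsub>Q\<^esub> \<pi> w" if "w \<in> V" for w
    using act_delta[of "g \<otimes> r" w] g rc that by simp
  have in1: "((\<lambda>v. cm v (g \<otimes> r)) ^^ n) v \<in> V" for n using act_delta_pow[of "g \<otimes> r" v n] g rc v by simp
  have in2: "((\<lambda>v. cm v g) ^^ n) v \<in> V" for n using act_delta_pow[of g v n] g v by simp
  show ?thesis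
    by (induction n) (use *[OF in1] act_delta[OF g in2] in simp_all)
qed

lemma unip_mult_cent:
  assumes "g \<in> carrier G" "r \<in> cent" "unip (g \<otimes> r) k"
  shows "unip g k"
proof -
  have rc: "r \<in> carrier G" using assms by (simp add: cent_def)
  have "((\<lambda>v. cm v g) ^^ k) v \<in> W" if v: "v \<in> V" for v
    using iterated_commutator_cong[OF assms(1,2) v, of k] assms(3) v
      act_delta_pow[of g v k] act_delta_pow[of "g \<otimes> r" v k] assms(1) rc
      \<pi>_one_iff[of "((\<lambda>v. cm v g) ^^ k) v"] \<pi>_one_iff[of "((\<lambda>v. cm v (g \<otimes> r)) ^^ k) v"]
    by (simp add: unip_def)
  then show ?thesis by (simp add: unip_def)
qed

lemma unip_mono: "unip g k \<Longrightarrow> k \<le> k' \<Longrightarrow> g \<in> carrier G \<Longrightarrow> unip g k'"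
proof -
  assume a: "unip g k" "k \<le> k'" "g \<in> carrier G"
  have W: "((\<lambda>v. cm v g) ^^ i) w \<in> W" if "w \<in> W" for i w
    using that normal_cm_left[OF W a(3)] by (induction i) auto
  have "((\<lambda>v. cm v g) ^^ ((k' - k) + k)) v \<in> W" if "v \<in> V" for v
    using a(1) W that by (simp only: funpow_add o_apply unip_def)
  then show "unip g k'" using a(2) by (simp add: unip_def)
qed

end

section \<open>Subgroups and coset commutators attached to good pairs\<close>

context group
begin

text \<open>The nilpotent subgroup belonging to the given pair already contains all commutators of
  elements of \<open>M\<close>.\<close>

lemma good_pair_subgroup:
  assumes M: "M \<lhd> G" and good: "good_pair M x y" and xy: "x \<in> carrier G" "y \<in> carrier G"
  shows "m \<in> M \<Longrightarrow> n \<in> M \<Longrightarrow> good_pair M m n"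
proof -
  assume mn: "m \<in> M" "n \<in> M"
  obtain H k where H: "subgroup H G" "H \<subseteq> hyper G (carrier G) H {\<one>} k"
    "\<And>m n. m \<in> M \<Longrightarrow> n \<in> M \<Longrightarrow> cm (x \<otimes> m) (y \<otimes> n) \<in> H"
    using good unfolding good_pair_def by blast
  have "cm (m \<otimes> a) (n \<otimes> b) \<in> H" if "a \<in> M" "b \<in> M" for a b
    using commutator_coset_pair_subgroup[OF M xy H(1,3)] that mn subgroup.m_closed[OF normal_imp_subgroup[OF M]]
    by blast
  then show ?thesis unfolding good_pair_def using H by blast
qed

text \<open>The set \<open>[xM, M]\<close>. It depends only on the coset \<open>xM\<close>, and it
  serves as an acting set of \<open>hyper\<close> without any subgroup being generated.\<close>

definition commutators_coset :: "'a set \<Rightarrow> 'a \<Rightarrow> 'a set" where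
  "commutators_coset M x = {cm (x \<otimes> m) n | m n. m \<in> M \<and> n \<in> M}"

lemma commutators_coset_subset:
  assumes M: "M \<lhd> G" and x: "x \<in> carrier G"
  shows "commutators_coset M x \<subseteq> M"
proof -
  have "m \<in> carrier G" if "m \<in> M" for m using normal_carrier M that by blast
  then show ?thesis unfolding commutators_coset_def using normal_cm_right[OF M] x by auto
qed

lemma commutators_coset_conj:
  assumes M: "M \<lhd> G" and x: "x \<in> carrier G" and g: "g \<in> carrier G" and l: "l \<in> commutators_coset M x"
  shows "cj g l \<in> commutators_coset M (cj g x)"
proof -
  have Mc: "m \<in> carrier G" if "m \<in> M" for m using normal_carrier M that by blast
  obtain m n where mn: "m \<in> M" "n \<in> M" "l = cm (x \<otimes> m) n" using l by (auto simp: commutators_coset_def)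
  then have "cj g l = cm (cj g x \<otimes> cj g m) (cj g n)" using x g Mc by (simp add: cj_cm cj_mult)
  then show ?thesis using normal_cj[OF M g] mn unfolding commutators_coset_def by blast
qed

lemma commutators_coset_mult_subset:
  assumes M: "M \<lhd> G" and x: "x \<in> carrier G" and m: "m \<in> M"
  shows "commutators_coset M (x \<otimes> m) \<subseteq> commutators_coset M x"
proof -
  have Mc: "m \<in> carrier G" if "m \<in> M" for m using normal_carrier M that by blast
  have "cm (x \<otimes> m \<otimes> a) b = cm (x \<otimes> (m \<otimes> a)) b" if "a \<in> M" for a b
    using x Mc m that by (simp add: m_assoc)
  then show ?thesis
    using subgroup.m_closed[OF normal_imp_subgroup[OF M] m] unfolding commutators_coset_def by blast
qed

text \<open>For \<open>g\<close> in \<open>M\<close> the conjugate \<open>x^g = x [x, g]\<close>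
  stays in the coset \<open>xM\<close>.\<close>

lemma commutators_coset_nrm:
  assumes M: "M \<lhd> G" and x: "x \<in> carrier G" and e: "e \<in> M"
  shows "e \<in> nrm (commutators_coset M x)"
proof -
  have Ms: "subgroup M G" using M normal_imp_subgroup by blast
  have ec: "e \<in> carrier G" using e Ms subgroup.mem_carrier by metis
  have *: "cj g l \<in> commutators_coset M x" if g: "g \<in> M" and l: "l \<in> commutators_coset M x" for g l
  proof -
    have gc: "g \<in> carrier G" using g Ms subgroup.mem_carrier by metis
    have "cj g x = x \<otimes> cm x g" using x gc by (simp add: cj_eq_cm)
    then have "commutators_coset M (cj g x) \<subseteq> commutators_coset M x"
      using commutators_coset_mult_subset[OF M x normal_cm_right[OF M x g]] by simp
    then show ?thesis using commutators_coset_conj[OF M x gc l] by blast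
  qed
  then show ?thesis using e ec subgroup.m_inv_closed[OF Ms e] by (intro nrmI) auto
qed

lemma finite_commutators_coset:
  assumes M: "M \<lhd> G" and fin: "finite (rcosets M)"
  shows "finite (commutators_coset M ` carrier G)"
proof -
  have Ms: "subgroup M G" using M normal_imp_subgroup by blast
  define r where "r C = (SOME y. y \<in> C)" for C :: "'a set"
  have "commutators_coset M x \<in> (\<lambda>C. commutators_coset M (r C)) ` (rcosets M)" if x: "x \<in> carrier G" for x
  proof -
    have "r (M #> x) \<in> M #> x" unfolding r_def using rcos_self[OF x Ms] by (rule someI)
    then obtain m where m: "m \<in> M" "r (M #> x) = m \<otimes> x" by (auto simp: r_coset_def)
    have mc: "m \<in> carrier G" using m Ms subgroup.mem_carrier by metis
    have "m \<otimes> x = x \<otimes> cj x m" using x mc by (simp add: mult_cj)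
    then have "commutators_coset M (m \<otimes> x) \<subseteq> commutators_coset M x" using commutators_coset_mult_subset[OF M x normal_cj[OF M x m(1)]] by simp
    moreover have "commutators_coset M x \<subseteq> commutators_coset M (m \<otimes> x)"
    proof -
      have i: "cj (m \<otimes> x) (inv m) \<in> M"
        using normal_cj[OF M _ subgroup.m_inv_closed[OF Ms m(1)], of "m \<otimes> x"] x mc by simp
      have "(m \<otimes> x) \<otimes> cj (m \<otimes> x) (inv m) = x" using x mc by (simp add: word_simps)
      moreover have "commutators_coset M ((m \<otimes> x) \<otimes> cj (m \<otimes> x) (inv m)) \<subseteq> commutators_coset M (m \<otimes> x)"
        using commutators_coset_mult_subset[OF M _ i] x mc by simp
      ultimately show ?thesis by simp
    qed
    ultimately have "commutators_coset M x = commutators_coset M (r (M #> x))" using m(2) by simp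
    moreover have "M #> x \<in> rcosets M" using x subgroup.subset[OF Ms] by (intro rcosetsI) auto
    ultimately show ?thesis by (rule image_eqI)
  qed
  then have "commutators_coset M ` carrier G \<subseteq> (\<lambda>C. commutators_coset M (r C)) ` (rcosets M)" by (rule image_subsetI)
  then show ?thesis by (rule finite_subset) (use fin in simp)
qed

text \<open>Iterates \<open>hyper_union\<close>; the lengths add up, so finiteness of the family is
  what bounds them.\<close>

lemma hyper_Union_finite:
  assumes M: "subgroup M G" and fin: "finite \<L>"
    and L: "\<And>L. L \<in> \<L> \<Longrightarrow> L \<subseteq> M \<and> M \<subseteq> nrm L" and A: "A \<subseteq> M"
    and k: "\<And>L. L \<in> \<L> \<Longrightarrow> \<exists>k. A \<subseteq> hyper G M L {\<one>} k"
  shows "\<exists>k. A \<subseteq> hyper G M (\<Union>\<L>) {\<one>} k"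
  using fin L k
proof (induction \<L> rule: finite_induct)
  case empty
  have "A \<subseteq> hyper G M {} {\<one>} (Suc 0)" using A by auto
  then show ?case unfolding Union_empty by blast
next
  case (insert L \<L>)
  obtain k where k: "A \<subseteq> hyper G M (\<Union>\<L>) {\<one>} k"
    using insert.IH insert.prems by (metis insertCI)
  obtain l where l: "A \<subseteq> hyper G M L {\<one>} l" using insert.prems(2)[of L] by blast
  have "M \<subseteq> nrm (\<Union>\<L>)"
  proof
    fix e assume e: "e \<in> M"
    then have "e \<in> nrm K" if "K \<in> \<L>" for K using insert.prems(1)[of K] that by blast
    then show "e \<in> nrm (\<Union>\<L>)" using subgroup.mem_carrier[OF M e] unfolding nrm_def by blast
  qed
  moreover have "L \<subseteq> M" "M \<subseteq> nrm L" "\<Union>\<L> \<subseteq> M" using insert.prems(1) by blast+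
  ultimately have "hyper G M L {\<one>} l \<inter> hyper G M (\<Union>\<L>) {\<one>} k \<subseteq> hyper G M (L \<union> \<Union>\<L>) {\<one>} (l + k)"
    by (intro hyper_union[OF M])
  then have "A \<subseteq> hyper G M (\<Union>(insert L \<L>)) {\<one>} (l + k)" using k l by auto
  then show ?case by blast
qed

lemma hyper_conj:
  assumes M: "M \<lhd> G" and g: "g \<in> carrier G" and DD: "D \<subseteq> carrier G" "D' \<subseteq> carrier G"
    and D: "\<And>d. d \<in> D' \<Longrightarrow> cj (inv g) d \<in> D"
  shows "a \<in> hyper G M D {\<one>} i \<Longrightarrow> cj g a \<in> hyper G M D' {\<one>} i"
proof (induction i arbitrary: a)
  case 0
  then show ?case using g by simp
next
  case (Suc i)
  have ac: "a \<in> carrier G" "cj g a \<in> M"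
    using Suc.prems subgroup.mem_carrier[OF normal_imp_subgroup[OF M], of a] normal_cj[OF M g, of a] by auto
  have "cm (cj g a) d \<in> hyper G M D' {\<one>} i" if d: "d \<in> D'" for d
  proof -
    have "cm (cj g a) d = cj g (cm a (cj (inv g) d))" using g ac d DD by (auto simp: cj_cm subset_iff)
    moreover have "cm a (cj (inv g) d) \<in> hyper G M D {\<one>} i" using Suc.prems D[OF d] by simp
    ultimately show ?thesis using Suc.IH by simp
  qed
  then show ?case using ac by simp
qed

lemma hyper_restrict:
  assumes M: "M \<lhd> G" and L: "L \<subseteq> D" "L \<subseteq> carrier G"
  shows "M \<inter> hyper G (carrier G) D {\<one>} i \<subseteq> hyper G M L {\<one>} i"
proof (induction i)
  case (Suc i)
  have "cm a l \<in> hyper G M L {\<one>} i"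
    if a: "a \<in> M \<inter> hyper G (carrier G) D {\<one>} (Suc i)" and l: "l \<in> L" for a l
  proof -
    have "l \<in> D" "l \<in> carrier G" using L l by blast+
    then have "cm a l \<in> M" "cm a l \<in> hyper G (carrier G) D {\<one>} i"
      using a normal_cm_left[OF M, of l a] by simp_all
    then show ?thesis using Suc.IH by blast
  qed
  then show ?case by auto
qed simp

text \<open>The elements \<open>x\<close> for which \<open>[xM, M]\<close> acts nilpotently on \<open>[M, M]\<close> generate \<open>G\<close>, so \<open>[G, M]\<close> lies in the group
  generated by these \<open>[xM, M]\<close>. There are only finitely many of them and they normalize each other, whence by Fitting's
  argument all of \<open>[G, M]\<close> acts nilpotently on \<open>[M, M]\<close>.\<close>

theorem good_pairs_nilpotent_action:
  assumes M1: "M1 \<lhd> G" and M: "M \<lhd> G" "M \<subseteq> M1" "finite (rcosets M)"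
    and good1: "\<And>x y. x \<in> M1 \<Longrightarrow> y \<in> M1 \<Longrightarrow> good_pair M x y"
    and good: "\<And>g. g \<in> carrier G \<Longrightarrow> \<exists>x\<in>carrier G. \<exists>y\<in>carrier G. inv g \<otimes> x \<in> M1 \<and> good_pair M x y"
  shows "\<exists>R0 r. R0 \<subseteq> M \<and> nrm R0 = carrier G \<and> (\<forall>m\<in>M. \<forall>g\<in>carrier G. cm m g \<in> generate G R0) \<and>
    generate G {cm m n | m n. m \<in> M \<and> n \<in> M} \<subseteq> hyper G M R0 {\<one>} r"
proof -
  let ?C = "{cm m n | m n. m \<in> M \<and> n \<in> M}"
  let ?A = "generate G ?C"
  have Ms: "subgroup M G" and M1s: "subgroup M1 G" using M M1 normal_imp_subgroup by blast+
  have Mc: "m \<in> carrier G" if "m \<in> M" for m using that Ms subgroup.mem_carrier by metis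
  have M1c: "m \<in> carrier G" if "m \<in> M1" for m using that M1s subgroup.mem_carrier by metis
  have Cc: "?C \<subseteq> carrier G" using Mc by auto
  have An: "?A \<lhd> G"
  proof (rule generate_normal_cj[OF Cc])
    fix g s assume g: "g \<in> carrier G" and "s \<in> ?C"
    then obtain m n where mn: "m \<in> M" "n \<in> M" "s = cm m n" by blast
    then have "cj g s = cm (cj g m) (cj g n)" using g Mc by (simp add: cj_cm)
    then show "cj g s \<in> ?C" using normal_cj[OF M(1) g] mn by blast
  qed
  have AM: "?A \<subseteq> M" using Ms subgroup_cm[OF Ms] by (intro generate_subgroup_incl) auto
  \<comment> \<open>The elements \<open>x\<close> for which \<open>[xM, M]\<close> acts nilpotently
    on \<open>?A\<close>, with a length depending on \<open>x\<close>. Normality of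
    \<open>?A\<close> makes \<open>Y\<close> invariant under conjugation.\<close>
  define Y where "Y = {x \<in> carrier G. \<exists>k. ?A \<subseteq> hyper G M (commutators_coset M x) {\<one>} k}"
  have pc: "commutators_coset M x \<subseteq> carrier G" if "x \<in> carrier G" for x using commutators_coset_subset[OF M(1) that] Mc by blast
  have Ycj: "cj g x \<in> Y" if x: "x \<in> Y" and g: "g \<in> carrier G" for g x
  proof -
    from x obtain k where k: "x \<in> carrier G" "?A \<subseteq> hyper G M (commutators_coset M x) {\<one>} k" by (auto simp: Y_def)
    have "cj (inv g) d \<in> commutators_coset M x" if "d \<in> commutators_coset M (cj g x)" for d
      using commutators_coset_conj[OF M(1) _ _ that, of "inv g"] g k(1) by simp
    then have *: "cj g a \<in> hyper G M (commutators_coset M (cj g x)) {\<one>} k" if "a \<in> ?A" for a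
      using hyper_conj[OF M(1) g pc[OF k(1)] pc] k g that by blast
    have "?A \<subseteq> hyper G M (commutators_coset M (cj g x)) {\<one>} k"
    proof
      fix a assume a: "a \<in> ?A"
      then have "cj (inv g) a \<in> ?A" using normal_cj[OF An] g by simp
      moreover have "a \<in> carrier G" using a AM Mc by blast
      ultimately show "a \<in> hyper G M (commutators_coset M (cj g x)) {\<one>} k" using *[of "cj (inv g) a"] g by simp
    qed
    then show ?thesis using k g by (auto simp: Y_def)
  qed
  have goodY: "x \<in> Y" if g: "good_pair M x y" and xy: "x \<in> carrier G" "y \<in> carrier G" for x y
  proof -
    obtain H k where H: "subgroup H G" "H \<subseteq> hyper G (carrier G) H {\<one>} k"
      "\<And>m n. m \<in> M \<Longrightarrow> n \<in> M \<Longrightarrow> cm (x \<otimes> m) (y \<otimes> n) \<in> H"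
      using g unfolding good_pair_def by blast
    \<comment> \<open>The nilpotent subgroup of a good pair contains both \<open>?A\<close> and
      \<open>[x^y M, M]\<close>. This puts \<open>x^y\<close> into \<open>Y\<close>, and conjugation
      by \<open>inv y\<close> leads back to \<open>x\<close>.\<close>
    have "?C \<subseteq> H" using commutator_coset_pair_subgroup[OF M(1) xy H(1,3)] by blast
    then have AH: "?A \<subseteq> H" using H(1) by (rule generate_subgroup_incl)
    have pH: "commutators_coset M (cj y x) \<subseteq> H" using commutator_coset_pair[OF M(1) xy H(1,3)] by (auto simp: commutators_coset_def)
    have "?A \<subseteq> M \<inter> hyper G (carrier G) H {\<one>} k" using AM AH H(2) by blast
    also have "\<dots> \<subseteq> hyper G M (commutators_coset M (cj y x)) {\<one>} k"
      using xy by (intro hyper_restrict[OF M(1) pH pc]) auto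
    finally have "cj y x \<in> Y" using xy by (auto simp: Y_def)
    then have "cj (inv y) (cj y x) \<in> Y" using Ycj xy by blast
    then show ?thesis using xy by simp
  qed
  have M1Y: "M1 \<subseteq> Y" using good1 goodY M1c by blast
  have gen: "carrier G \<subseteq> S" if S: "subgroup S G" "Y \<subseteq> S" for S
  proof
    fix g assume g: "g \<in> carrier G"
    then obtain x y where xy: "x \<in> carrier G" "y \<in> carrier G" "inv g \<otimes> x \<in> M1" "good_pair M x y" using good by blast
    have "x \<in> S" "inv g \<otimes> x \<in> S" using goodY[OF xy(4,1,2)] M1Y xy(3) S(2) by blast+
    \<comment> \<open>\<open>g = x (g^-1 x)^-1\<close>, where \<open>x\<close> belongs to a good
      pair and \<open>g^-1 x\<close> to \<open>M1\<close>.\<close>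
    then have "x \<otimes> inv (inv g \<otimes> x) \<in> S" using S(1) by (simp add: subgroup.m_closed subgroup.m_inv_closed)
    then show "g \<in> S" using g xy by (simp add: inv_mult_group)
  qed
  define R0 where "R0 = \<Union>(commutators_coset M ` Y)"
  have Yc: "Y \<subseteq> carrier G" by (auto simp: Y_def)
  have R0M: "R0 \<subseteq> M" using commutators_coset_subset[OF M(1)] Yc unfolding R0_def by blast
  then have R0c: "R0 \<subseteq> carrier G" using Mc by blast
  have R0cj: "cj g s \<in> R0" if g: "g \<in> carrier G" and s: "s \<in> R0" for g s
  proof -
    obtain x where x: "x \<in> Y" "s \<in> commutators_coset M x" using s by (auto simp: R0_def)
    then have "cj g s \<in> commutators_coset M (cj g x)" using commutators_coset_conj[OF M(1) _ g] Yc by blast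
    then show ?thesis using Ycj[OF x(1) g] by (auto simp: R0_def)
  qed
  have nR0: "nrm R0 = carrier G"
    using R0cj nrm_subset by (auto intro!: nrmI)
  have Rn: "generate G R0 \<lhd> G" using generate_normal_cj[OF R0c R0cj] .
  let ?S = "{g \<in> carrier G. \<forall>m\<in>M. cm g m \<in> generate G R0}"
  note Rs = normal_imp_subgroup[OF Rn]
  have "subgroup ?S G"
    using subgroup_commutator_right[OF Rn] commutator_left_right_eq[OF Rn] Mc by (simp add: subset_iff)
  moreover have "Y \<subseteq> ?S"
  proof
    fix x assume x: "x \<in> Y"
    then have xc: "x \<in> carrier G" using Yc by auto
    have "cm x m \<in> R0" if "m \<in> M" for m
    proof -
      have "cm (x \<otimes> \<one>) m \<in> commutators_coset M x" unfolding commutators_coset_def using that subgroup.one_closed[OF Ms] by blast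
      then show ?thesis using x xc unfolding R0_def by auto
    qed
    then show "x \<in> ?S" using xc generate.incl[of _ R0 G] by blast
  qed
  ultimately have "carrier G \<subseteq> ?S" using gen by blast
  then have "cm m g \<in> generate G R0" if "m \<in> M" "g \<in> carrier G" for m g
    using that inv_cm[of g m] Mc subgroup.m_inv_closed[OF Rs, of "cm g m"] by auto
  moreover have "\<exists>k. ?A \<subseteq> hyper G M (\<Union>(commutators_coset M ` Y)) {\<one>} k"
  proof (rule hyper_Union_finite[OF Ms _ _ AM])
    show "finite (commutators_coset M ` Y)"
      using finite_commutators_coset[OF M(1,3)] Yc by (meson finite_subset image_mono)
    show "L \<subseteq> M \<and> M \<subseteq> nrm L" if "L \<in> commutators_coset M ` Y" for L
      using that Yc commutators_coset_subset[OF M(1)] commutators_coset_nrm[OF M(1)] by blast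
    show "\<exists>k. ?A \<subseteq> hyper G M L {\<one>} k" if "L \<in> commutators_coset M ` Y" for L
      using that by (auto simp: Y_def)
  qed
  ultimately show ?thesis using R0M nR0 unfolding R0_def by blast
qed

end

section \<open>An open normal subgroup on which the commutators act nilpotently\<close>

context profinite_group
begin

text \<open>Since \<open>L / R\<close> is central in \<open>G / R\<close>, a commutator depends modulo \<open>R\<close> only on a pair of cosets of \<open>L\<close>, so that it may
  be taken to come from a good pair.\<close>

lemma commutator_section_nilpotent:
  assumes S: "abelian_section G V W" and M: "M \<lhd> G" "V \<subseteq> M"
    and L: "L \<lhd> G" "finite (rcosets L)" and R: "R \<lhd> G" "R \<subseteq> L"
    and central: "\<And>l g. l \<in> L \<Longrightarrow> g \<in> carrier G \<Longrightarrow> cm l g \<in> R"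
    and VR: "\<And>v r. v \<in> V \<Longrightarrow> r \<in> R \<Longrightarrow> cm v r \<in> W"
    and N: "N \<lhd> G" "finite (rcosets N)" "generate G (commutator_set G) \<inter> N \<subseteq> R"
    and good: "\<And>a b. a \<in> carrier G \<Longrightarrow> b \<in> carrier G \<Longrightarrow>
      \<exists>x\<in>carrier G. \<exists>y\<in>carrier G. inv a \<otimes> x \<in> L \<and> inv b \<otimes> y \<in> L \<and> good_pair M x y"
  shows "\<exists>m. V \<subseteq> hyper G (carrier G) (commutator_set G) W m"
proof -
  interpret S: abelian_section G V W by fact
  have Ls: "subgroup L G" using L normal_imp_subgroup by blast
  have Lc: "l \<in> carrier G" if "l \<in> L" for l using that Ls subgroup.mem_carrier by metis
  have Rc: "r \<in> carrier G" if "r \<in> R" for r using that R Lc by blast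
  have Rcent: "R \<subseteq> S.cent" using VR Rc by (auto simp: S.cent_def)
  have pair: "\<exists>k. \<forall>x\<in>C. \<forall>y\<in>C'. S.unip (cm x y) k" if C: "C \<in> rcosets L" and C': "C' \<in> rcosets L" for C C'
  proof -
    obtain a b where a: "a \<in> carrier G" "C = L #> a" and b: "b \<in> carrier G" "C' = L #> b"
      using C C' by (auto simp: RCOSETS_def)
    obtain x0 y0 where xy0: "x0 \<in> carrier G" "y0 \<in> carrier G" "inv a \<otimes> x0 \<in> L" "inv b \<otimes> y0 \<in> L" "good_pair M x0 y0"
      using good[OF a(1) b(1)] by blast
    obtain H k where H: "subgroup H G" "H \<subseteq> hyper G (carrier G) H {\<one>} k"
      "\<And>m n. m \<in> M \<Longrightarrow> n \<in> M \<Longrightarrow> cm (x0 \<otimes> m) (y0 \<otimes> n) \<in> H"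
      using xy0(5) unfolding good_pair_def by blast
    have one: "\<one> \<in> M" using M normal_imp_subgroup subgroup.one_closed by blast
    have c0: "cm x0 y0 \<in> H" using H(3)[OF one one] xy0 by simp
    have u: "cm (cj y0 x0) v \<in> H" and w: "cm (cj x0 y0) v \<in> H" if "v \<in> V" for v
      using commutator_coset_pair[OF M(1) xy0(1,2) H(1,3) one, of v]
        commutator_coset_pair_swap[OF M(1) xy0(1,2) H(1,3) one, of v] that M(2) xy0 by auto
    have U: "S.unip (cm x0 y0) (Suc k)"
      unfolding S.unip_def using commutator_unipotent[OF S xy0(1,2) H(1,2) c0 u w] by blast
    have near: "\<exists>l\<in>L. x0' = x \<otimes> l"
      if x: "x \<in> L #> a'" and a': "a' \<in> carrier G" and x0': "x0' \<in> carrier G" "inv a' \<otimes> x0' \<in> L" for x a' x0'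
    proof -
      obtain l where l: "l \<in> L" "x = l \<otimes> a'" using x by (auto simp: r_coset_def)
      have "inv x \<otimes> x0' = cj a' (inv l) \<otimes> (inv a' \<otimes> x0')" using l a' x0' Lc by (simp add: word_simps)
      moreover have "cj a' (inv l) \<in> L" using normal_cj[OF L(1) a'] l Ls by (simp add: subgroup.m_inv_closed)
      ultimately have "inv x \<otimes> x0' \<in> L" using x0'(2) subgroup.m_closed[OF Ls] by simp
      moreover have "x0' = x \<otimes> (inv x \<otimes> x0')" using l a' x0' Lc by simp
      ultimately show ?thesis by blast
    qed
    have "S.unip (cm x y) (Suc k)" if x: "x \<in> C" and y: "y \<in> C'" for x y
    proof -
      have xc: "x \<in> carrier G" "y \<in> carrier G"
        using x y a b r_coset_subset_G[OF subgroup.subset[OF Ls]] by blast+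
      obtain l where l: "l \<in> L" "x0 = x \<otimes> l" using near[OF _ a(1) xy0(1,3)] x a(2) by blast
      obtain l' where l': "l' \<in> L" "y0 = y \<otimes> l'" using near[OF _ b(1) xy0(2,4)] y b(2) by blast
      \<comment> \<open>The discrepancy between the commutator of the given pair and that of the
        good pair; it lies in \<open>R\<close> and so acts trivially on
        \<open>V / W\<close>.\<close>
      define r where "r = inv (cm x y) \<otimes> cm (x \<otimes> l) (y \<otimes> l')"
      have c1: "cm g l' \<in> R" if "g \<in> carrier G" for g
        using central[OF l'(1) that] inv_cm[of l' g] Lc[OF l'(1)] that
          subgroup.m_inv_closed[OF normal_imp_subgroup[OF R(1)], of "cm l' g"] by simp
      have "r \<in> R" unfolding r_def
        using commutator_congruent[OF R(1) xc Lc[OF l(1)] Lc[OF l'(1)] central[OF l(1)]] c1 xc by simp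
      moreover have "cm x0 y0 = cm x y \<otimes> r" using l l' xc Lc by (simp add: r_def)
      ultimately show ?thesis
        using S.unip_mult_cent[of "cm x y" r "Suc k"] U Rcent xc by auto
    qed
    then show ?thesis by blast
  qed
  then have "\<forall>p\<in>(rcosets L) \<times> (rcosets L). \<exists>k. \<forall>x\<in>fst p. \<forall>y\<in>snd p. S.unip (cm x y) k" by auto
  then obtain \<kappa> where \<kappa>: "\<And>C C' x y. C \<in> rcosets L \<Longrightarrow> C' \<in> rcosets L \<Longrightarrow> x \<in> C \<Longrightarrow> y \<in> C' \<Longrightarrow> S.unip (cm x y) (\<kappa> (C, C'))"
    by (metis SigmaI fst_conv snd_conv)
  \<comment> \<open>The exponents of unipotency depend only on pairs of cosets of \<open>L\<close>,
    of which there are finitely many, so they have a maximum.\<close>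
  define k where "k = Max (\<kappa> ` ((rcosets L) \<times> (rcosets L)))"
  have un: "S.unip (cm x y) k" if "x \<in> carrier G" "y \<in> carrier G" for x y
  proof -
    have C: "L #> x \<in> rcosets L" "L #> y \<in> rcosets L" using that subgroup.subset[OF Ls] by (auto intro: rcosetsI)
    have "\<kappa> (L #> x, L #> y) \<le> k" unfolding k_def using C L(2) by (intro Max_ge) auto
    moreover have "S.unip (cm x y) (\<kappa> (L #> x, L #> y))"
      using \<kappa>[OF C rcos_self[OF that(1) Ls] rcos_self[OF that(2) Ls]] .
    ultimately show ?thesis using S.unip_mono that by blast
  qed
  show ?thesis
  proof (rule section_nilpotent[OF S N(1,2), of k])
    show "cm v d \<in> W" if "d \<in> generate G (commutator_set G)" "d \<in> N" "v \<in> V" for d v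
      using that N(3) VR by blast
    show "((\<lambda>v. cm v (cm x y)) ^^ k) v \<in> W" if "x \<in> carrier G" "y \<in> carrier G" "v \<in> V" for x y v
      using un[OF that(1,2)] that(3) by (simp add: S.unip_def)
  qed
qed

text \<open>Only finitely many cosets of \<open>R\<close> meet \<open>D\<close>. Those not
  containing \<open>\<one>\<close> have a closed union, and an open normal subgroup disjoint from it
  meets \<open>D\<close> only inside \<open>R\<close>.\<close>

lemma open_normal_avoiding:
  assumes R: "R \<lhd> G" "closedin T R" and D: "D \<subseteq> carrier G" and fin: "finite ((\<lambda>x. R #> x) ` D)"
  shows "\<exists>N. N \<lhd> G \<and> openin T N \<and> D \<inter> N \<subseteq> R"
proof -
  have Rs: "subgroup R G" using R normal_imp_subgroup by blast
  define \<C> where "\<C> = {C \<in> (\<lambda>x. R #> x) ` D. \<one> \<notin> C}"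
  have "closedin T C" if C: "C \<in> \<C>" for C
  proof -
    obtain d where d: "d \<in> carrier G" "C = R #> d" using C D by (auto simp: \<C>_def)
    have "C = {y \<in> carrier G. y \<otimes> inv d \<in> R}"
      using d subgroup.rcos_module[OF Rs is_group d(1)] r_coset_subset_G[OF subgroup.subset[OF Rs] d(1)] by auto
    moreover have "closedin T {y \<in> carrier G. y \<otimes> inv d \<in> R}"
      using d R by (intro closedin_preimage cont_mult cont_id cont_const) auto
    ultimately show ?thesis by simp
  qed
  moreover have "finite \<C>" using fin by (simp add: \<C>_def)
  ultimately have "closedin T (\<Union>\<C>)" by (intro closedin_Union) auto
  then have "openin T (carrier G - \<Union>\<C>)" by (metis openin_diff openin_topspace topspace_eq)
  moreover have "\<one> \<in> carrier G - \<Union>\<C>" by (simp add: \<C>_def)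
  ultimately obtain N where N: "N \<lhd> G" "openin T N" "N \<subseteq> carrier G - \<Union>\<C>" using open_normal_subgroup by blast
  have "d \<in> R" if d: "d \<in> D" "d \<in> N" for d
  proof -
    have dc: "d \<in> carrier G" using d D by blast
    have "d \<in> R #> d" using rcos_self[OF dc Rs] .
    then have "R #> d \<notin> \<C>" using N d by blast
    then have "\<one> \<in> R #> d" using d by (simp add: \<C>_def)
    then obtain r where r: "r \<in> R" "\<one> = r \<otimes> d" by (auto simp: r_coset_def)
    have rc: "r \<in> carrier G" using r Rs subgroup.mem_carrier by metis
    have "d = inv r" using r rc dc by (metis inv_equality inv_inv)
    then show ?thesis using r subgroup.m_inv_closed[OF Rs] by simp
  qed
  then show ?thesis using N by blast
qed

text \<open>The open subgroup obtained is \<open>U\<close>. It is filtered by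
  \<open>B = U \<inter> A\<close> and the intersections of \<open>B\<close> with the terms
  \<open>Z i\<close>; each section is abelian and centralized by \<open>R\<close>, so
  \<open>commutator_section_nilpotent\<close> applies, and the lengths add up.\<close>

theorem countable_cover_imp_hypercentral:
  assumes F: "countable \<F>" "\<And>H. H \<in> \<F> \<Longrightarrow> subgroup H G" "\<And>H. H \<in> \<F> \<Longrightarrow> \<exists>k. H \<subseteq> hyper G (carrier G) H {\<one>} k"
    and cover: "commutator_set G \<subseteq> \<Union>\<F>"
  shows "\<exists>N m. N \<lhd> G \<and> openin T N \<and> N \<subseteq> hyper G (carrier G) (commutator_set G) {\<one>} m"
proof -
  have Gn: "carrier G \<lhd> G" by (simp add: normalI_cj subgroup_self)
  have Go: "openin T (carrier G)" using openin_topspace[of T] by (simp add: topspace_eq)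
  obtain x1 y1 M1 where M1: "x1 \<in> carrier G" "y1 \<in> carrier G" "M1 \<lhd> G" "openin T M1" "good_pair M1 x1 y1"
    using good_pair_in_cosets[OF F cover Gn Go one_closed one_closed] by blast
  obtain M where M: "M \<lhd> G" "openin T M" "M \<subseteq> M1" and goodM: "\<And>a b. a \<in> carrier G \<Longrightarrow> b \<in> carrier G \<Longrightarrow>
      \<exists>x\<in>carrier G. \<exists>y\<in>carrier G. inv a \<otimes> x \<in> M1 \<and> inv b \<otimes> y \<in> M1 \<and> good_pair M x y"
    using uniform_good_pairs[OF F cover M1(3,4)] by blast
  obtain U where U: "U \<lhd> G" "openin T U" "U \<subseteq> M" and goodU: "\<And>a b. a \<in> carrier G \<Longrightarrow> b \<in> carrier G \<Longrightarrow>
      \<exists>x\<in>carrier G. \<exists>y\<in>carrier G. inv a \<otimes> x \<in> M \<and> inv b \<otimes> y \<in> M \<and> good_pair U x y"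
    using uniform_good_pairs[OF F cover M(1,2)] by blast
  have Ms: "subgroup M G" using M normal_imp_subgroup by blast
  have Mc: "m \<in> carrier G" if "m \<in> M" for m using that Ms subgroup.mem_carrier by metis
  have finM: "finite (rcosets M)" using open_subgroup_finite_index[OF Ms M(2) compact] .
  define A where "A = generate G {cm m n | m n. m \<in> M \<and> n \<in> M}"
  have "\<exists>R0 r. R0 \<subseteq> M \<and> nrm R0 = carrier G \<and> (\<forall>m\<in>M. \<forall>g\<in>carrier G. cm m g \<in> generate G R0) \<and>
      A \<subseteq> hyper G M R0 {\<one>} r"
    unfolding A_def
  proof (rule good_pairs_nilpotent_action[OF M1(3) M(1,3) finM])
    show "good_pair M x y" if "x \<in> M1" "y \<in> M1" for x y
      using good_pair_antimono[OF good_pair_subgroup[OF M1(3,5,1,2) that] M(3)] .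
    show "\<exists>x\<in>carrier G. \<exists>y\<in>carrier G. inv g \<otimes> x \<in> M1 \<and> good_pair M x y" if "g \<in> carrier G" for g
      using goodM[OF that that] by blast
  qed
  then obtain R0 r where R0: "R0 \<subseteq> M" "nrm R0 = carrier G" "\<And>m g. m \<in> M \<Longrightarrow> g \<in> carrier G \<Longrightarrow> cm m g \<in> generate G R0"
    "A \<subseteq> hyper G M R0 {\<one>} r" by blast
  have R0c: "R0 \<subseteq> carrier G" using R0(1) Mc by blast
  \<comment> \<open>The series of \<open>R0\<close> inside \<open>M\<close>, with \<open>A\<close>
    contained in \<open>Z r\<close>; its terms are closed and normal in \<open>G\<close>.\<close>
  define Z where "Z i = hyper G M R0 {\<one>} i" for i
  have one1: "{\<one>} \<subseteq> M" using subgroup.one_closed[OF Ms] by simp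
  have nM: "nrm M = carrier G" using M normal_iff_nrm by blast
  have n1: "nrm {\<one>} = carrier G" using one_is_normal normal_iff_nrm by blast
  have Zs: "subgroup (Z i) G" for i
    unfolding Z_def using R0 R0c n1 Mc by (intro subgroup_hyper Ms triv_subgroup one1) auto
  have ZM: "Z i \<subseteq> M" for i unfolding Z_def using hyper_subset[OF one1] .
  have Zn: "Z i \<lhd> G" for i
  proof (rule normalI_cj[OF Zs])
    fix g z assume g: "g \<in> carrier G" "z \<in> Z i"
    have "g \<in> nrm (Z i)" unfolding Z_def using g R0 R0c n1 nM Mc by (intro nrm_hyper) auto
    then show "cj g z \<in> Z i" using nrmD g by blast
  qed
  have Zcl: "closedin T (Z i)" for i
    unfolding Z_def using open_subgroup_closed[OF Ms M(2)] closed_one R0c by (rule closedin_hyper)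
  have Zc: "z \<in> carrier G" if "z \<in> Z i" for z i using that ZM Mc by blast
  have Zmono: "Z i \<subseteq> Z (Suc i)" for i
    unfolding Z_def using R0c n1 by (intro hyper_Suc_mono triv_subgroup one1) auto
  \<comment> \<open>The elements of \<open>M\<close> acting trivially on each quotient
    \<open>Z (Suc i) / Z i\<close> with \<open>i < r\<close>. Writing them as an intersection over
    single elements shows that \<open>R\<close> is closed.\<close>
  define R where "R = M \<inter> (\<Inter>z\<in>{(i, z). i < r \<and> z \<in> Z (Suc i)}. {g \<in> carrier G. cm (snd z) g \<in> Z (fst z)})"
  have Riff: "g \<in> R \<longleftrightarrow> g \<in> M \<and> (\<forall>i<r. \<forall>z\<in>Z (Suc i). cm z g \<in> Z i)" for g
    using Mc by (auto simp: R_def)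
  have Rcl: "closedin T R"
  proof (cases "{(i, z). i < r \<and> z \<in> Z (Suc i)} = {}")
    case True
    then show ?thesis unfolding R_def True using open_subgroup_closed[OF Ms M(2)] by simp
  next
    case False
    have "closedin T {g \<in> carrier G. cm (snd z) g \<in> Z (fst z)}" if "z \<in> {(i, z). i < r \<and> z \<in> Z (Suc i)}" for z
      using that Zc Zcl by (intro closedin_preimage cont_commutator cont_id cont_const) auto
    then show ?thesis
      unfolding R_def using False open_subgroup_closed[OF Ms M(2)] by (intro closedin_Int closedin_INT) auto
  qed
  have Rn: "R \<lhd> G"
  proof -
    define S where "S i = {g \<in> carrier G. \<forall>z\<in>Z (Suc i). cm z g \<in> Z i}" for i
    have S: "S i \<lhd> G" for i unfolding S_def using Zn Zn by (rule normal_commutator_right)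
    have "M \<inter> (\<Inter>i\<in>{..<j}. S i) \<lhd> G" for j
    proof (induction j)
      case (Suc j)
      have "M \<inter> (\<Inter>i\<in>{..<Suc j}. S i) = S j \<inter> (M \<inter> (\<Inter>i\<in>{..<j}. S i))" by (auto simp: lessThan_Suc)
      then show ?case using normal_subgroup_intersect[OF S Suc] by simp
    qed (use M in simp)
    moreover have "R = M \<inter> (\<Inter>i\<in>{..<r}. S i)" using Riff Mc by (auto simp: S_def)
    ultimately show ?thesis by simp
  qed
  have "R0 \<subseteq> R" using R0(1) Riff by (auto simp: Z_def)
  then have genR: "generate G R0 \<subseteq> R" using normal_imp_subgroup[OF Rn] by (rule generate_subgroup_incl)
  have MR: "cm m g \<in> R" if "m \<in> M" "g \<in> carrier G" for m g using R0(3)[OF that] genR by blast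
  have RM: "R \<subseteq> M" using Riff by blast
  have AR: "A \<subseteq> R" unfolding A_def using MR Mc by (intro generate_subgroup_incl normal_imp_subgroup[OF Rn]) blast
  have Cc: "{cm m n | m n. m \<in> M \<and> n \<in> M} \<subseteq> carrier G" using Mc by auto
  have An: "A \<lhd> G" unfolding A_def
  proof (rule generate_normal_cj[OF Cc])
    fix g s assume g: "g \<in> carrier G" and "s \<in> {cm m n | m n. m \<in> M \<and> n \<in> M}"
    then obtain m n where mn: "m \<in> M" "n \<in> M" "s = cm m n" by blast
    then have "cj g s = cm (cj g m) (cj g n)" using g Mc by (simp add: cj_cm)
    then show "cj g s \<in> {cm m n | m n. m \<in> M \<and> n \<in> M}" using normal_cj[OF M(1) g] mn by blast
  qed
  have MA: "cm m n \<in> A" if "m \<in> M" "n \<in> M" for m n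
    unfolding A_def using that by (intro generate.incl) blast
  let ?D = "generate G (commutator_set G)"
  \<comment> \<open>Schur's theorem modulo \<open>R\<close>, where \<open>M\<close> serves both as
    the central subgroup and as the subgroup of finite index.\<close>
  have "finite ((\<lambda>x. R #> x) ` generate G {cm l x | l x. l \<in> carrier G \<and> x \<in> carrier G})"
  proof (rule finite_commutators_central_mod[OF Rn Gn Ms _ MR _ Ms finM])
    show "M \<subseteq> carrier G" using Mc by blast
    have "(\<lambda>x. M #> x) ` carrier G = rcosets M" by (auto simp: RCOSETS_def)
    then show "finite ((\<lambda>x. M #> x) ` carrier G)" using finM by simp
    show "cm l u \<in> R" if "l \<in> carrier G" "u \<in> M" for l u
      using MR[OF that(2,1)] inv_cm[of u l] Mc that subgroup.m_inv_closed[OF normal_imp_subgroup[OF Rn], of "cm u l"] by simp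
  qed
  moreover have "{cm l x | l x. l \<in> carrier G \<and> x \<in> carrier G} = commutator_set G"
    by (auto simp: commutator_set_def)
  ultimately have "finite ((\<lambda>x. R #> x) ` ?D)" by simp
  then obtain N where N: "N \<lhd> G" "openin T N" "?D \<inter> N \<subseteq> R"
    using open_normal_avoiding[OF Rn Rcl, of ?D] generate_in_carrier[OF commutator_set_subset] by blast
  have finN: "finite (rcosets N)" using open_subgroup_finite_index[OF normal_imp_subgroup[OF N(1)] N(2) compact] .
  have sec: "\<exists>m. V \<subseteq> hyper G (carrier G) (commutator_set G) W m"
    if V: "V \<lhd> G" "W \<lhd> G" "W \<subseteq> V" "V \<subseteq> U" "\<And>v v'. v \<in> V \<Longrightarrow> v' \<in> V \<Longrightarrow> cm v v' \<in> W"
      "\<And>v r. v \<in> V \<Longrightarrow> r \<in> R \<Longrightarrow> cm v r \<in> W" for V W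
    using commutator_section_nilpotent[OF abelian_sectionI[OF V(1,2,3,5)] U(1) V(4) M(1) finM Rn RM MR V(6) N(1) finN N(3) goodU]
    by blast
  \<comment> \<open>\<open>U / B\<close> is abelian and centralized by \<open>R\<close>, because
    \<open>[U, M]\<close> lies in \<open>U\<close> and in \<open>A\<close>. The sections of
    \<open>B\<close> along \<open>Z\<close> are centralized by \<open>R\<close> by construction, and
    are abelian because \<open>B\<close> is contained in \<open>R\<close>.\<close>
  define B where "B = U \<inter> A"
  have Bn: "B \<lhd> G" unfolding B_def using U(1) An by (rule normal_subgroup_intersect)
  have chain: "i \<le> r \<Longrightarrow> \<exists>m. B \<inter> Z i \<subseteq> hyper G (carrier G) (commutator_set G) {\<one>} m" for i
  proof (induction i)
    case 0
    have "B \<inter> Z 0 \<subseteq> hyper G (carrier G) (commutator_set G) {\<one>} 0" by (auto simp: Z_def)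
    then show ?case by blast
  next
    case (Suc i)
    have 1: "B \<inter> Z (Suc i) \<lhd> G" "B \<inter> Z i \<lhd> G" using Bn Zn normal_subgroup_intersect by blast+
    have act: "cm v s \<in> B \<inter> Z i" if v: "v \<in> B \<inter> Z (Suc i)" and s: "s \<in> R" for v s
    proof -
      have "s \<in> carrier G" using s RM Mc by blast
      then have "cm v s \<in> B" using normal_cm_left[OF Bn] v by blast
      moreover have "cm v s \<in> Z i" using v s Riff Suc.prems by auto
      ultimately show ?thesis by blast
    qed
    have "\<exists>m. B \<inter> Z (Suc i) \<subseteq> hyper G (carrier G) (commutator_set G) (B \<inter> Z i) m"
    proof (rule sec[OF 1])
      show "B \<inter> Z i \<subseteq> B \<inter> Z (Suc i)" using Zmono by blast
      show "B \<inter> Z (Suc i) \<subseteq> U" by (auto simp: B_def)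
      show "cm v v' \<in> B \<inter> Z i" if "v \<in> B \<inter> Z (Suc i)" "v' \<in> B \<inter> Z (Suc i)" for v v'
        using act[OF that(1), of v'] that(2) AR by (auto simp: B_def)
    qed (rule act)
    moreover obtain m where "B \<inter> Z i \<subseteq> hyper G (carrier G) (commutator_set G) {\<one>} m" using Suc by auto
    ultimately show ?case using hyper_trans by blast
  qed
  have "B \<subseteq> Z r" using R0(4) by (auto simp: B_def Z_def)
  then obtain m where m: "B \<subseteq> hyper G (carrier G) (commutator_set G) {\<one>} m" using chain[of r] by (auto simp: Int_absorb2)
  have top: "cm v s \<in> B" if "v \<in> U" "s \<in> M" for v s
    using that normal_cm_left[OF U(1) Mc[OF that(2)]] MA U(3) by (auto simp: B_def)
  have "\<exists>m. U \<subseteq> hyper G (carrier G) (commutator_set G) B m"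
    using top U RM by (intro sec[OF U(1) Bn]) (auto simp: B_def)
  then show ?thesis using hyper_trans[OF _ m] U by blast
qed

end

section \<open>The equivalences\<close>

lemma (in group) hyper_subgroup_restrict:
  assumes H: "subgroup H G"
  shows "H \<inter> hyper G (carrier G) H {\<one>} i \<subseteq> hyper G H H {\<one>} i"
  by (induction i) (auto simp: subgroup_cm[OF H] subset_iff)

context topological_group
begin

lemma subgroup_topological_group:
  assumes D: "subgroup D G"
  shows "topological_group (G\<lparr>carrier := D\<rparr>) (subtopology T D)"
proof -
  note Dc = subgroup.subset[OF D]
  have ts: "topspace (subtopology T D) = D" using Dc by (simp add: topspace_eq Int_absorb1)
  have "continuous_map (prod_topology (subtopology T D) (subtopology T D)) (subtopology T D) (\<lambda>(x, y). x \<otimes> y)"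
    using continuous_map_from_subtopology[OF continuous_mult, of "D \<times> D"] subgroup.m_closed[OF D]
    by (auto simp: continuous_map_in_subtopology topspace_eq simp flip: subtopology_Times)
  moreover have "continuous_map (subtopology T D) (subtopology T D) (\<lambda>x. inv\<^bsub>G\<lparr>carrier := D\<rparr>\<^esub> x)"
  proof (rule continuous_map_eq)
    show "continuous_map (subtopology T D) (subtopology T D) (\<lambda>x. inv x)"
      using continuous_map_from_subtopology[OF continuous_inv, of D] subgroup.m_inv_closed[OF D]
      by (auto simp: continuous_map_in_subtopology topspace_eq)
    show "inv x = inv\<^bsub>G\<lparr>carrier := D\<rparr>\<^esub> x" if "x \<in> topspace (subtopology T D)" for x
      using that ts D by (simp add: m_inv_consistent)
  qed
  ultimately show ?thesis
    using subgroup.subgroup_is_group[OF D is_group] ts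
    by (simp add: topological_group_def topological_group_axioms_def)
qed

lemma closed_generate_subgroup: "subgroup (closed_generate G T S) G" if "S \<subseteq> carrier G"
proof -
  have "carrier G \<in> {H. subgroup H G \<and> closedin T H \<and> S \<subseteq> H}"
    using that subgroup_self closedin_topspace[of T] by (simp add: topspace_eq)
  then show ?thesis unfolding closed_generate_def by (intro subgroups_Inter) auto
qed

lemma closed_generate_closed: "closedin T (closed_generate G T S)" if "S \<subseteq> carrier G"
proof -
  have "carrier G \<in> {H. subgroup H G \<and> closedin T H \<and> S \<subseteq> H}"
    using that subgroup_self closedin_topspace[of T] by (simp add: topspace_eq)
  then show ?thesis unfolding closed_generate_def by (intro closedin_Inter) auto
qed

lemma closed_generate_incl: "S \<subseteq> closed_generate G T S"
  by (auto simp: closed_generate_def)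

lemma closed_generate_minimal: "subgroup H G \<Longrightarrow> closedin T H \<Longrightarrow> S \<subseteq> H \<Longrightarrow> closed_generate G T S \<subseteq> H"
  by (auto simp: closed_generate_def)

text \<open>For fixed \<open>a\<close>, the \<open>d\<close> with \<open>[a, d]\<close> in a closed
  normal subgroup form a closed subgroup; once it contains \<open>S\<close>, it contains the closed
  subgroup generated by \<open>S\<close>.\<close>

lemma hyper_closed_generate:
  assumes S: "S \<subseteq> carrier G" "nrm S = carrier G" and one: "closedin T {\<one>}"
  shows "hyper G (carrier G) S {\<one>} i \<subseteq> hyper G (carrier G) (closed_generate G T S) {\<one>} i"
proof (induction i)
  case (Suc i)
  let ?Z = "hyper G (carrier G) S {\<one>} i"
  have Zn: "?Z \<lhd> G" using hyper_carrier_normal[OF one_is_normal S] .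
  have Zcl: "closedin T ?Z"
    using closedin_hyper[OF _ one S(1), of "carrier G"] closedin_topspace[of T] by (simp add: topspace_eq)
  have "closed_generate G T S \<subseteq> {d \<in> carrier G. cm a d \<in> ?Z}"
    if a: "a \<in> hyper G (carrier G) S {\<one>} (Suc i)" for a
  proof (rule closed_generate_minimal)
    have ac: "a \<in> carrier G" using a by simp
    show "subgroup {d \<in> carrier G. cm a d \<in> ?Z} G"
      using subgroup_commutator_right[OF Zn, of "{a}"] ac by simp
    show "closedin T {d \<in> carrier G. cm a d \<in> ?Z}"
      using ac Zcl by (intro closedin_preimage cont_commutator cont_id cont_const) auto
    show "S \<subseteq> {d \<in> carrier G. cm a d \<in> ?Z}" using a S by auto
  qed
  then show ?case using Suc by fastforce
qed simp

end

section \<open>Openness of the upper central terms of the closed commutator subgroup\<close>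

context profinite_group
begin

abbreviation "D \<equiv> closed_derived G T"
abbreviation "GD \<equiv> G\<lparr>carrier := closed_derived G T\<rparr>"

lemma D_subgroup: "subgroup D G" and D_closed: "closedin T D" and commutator_D: "commutator_set G \<subseteq> D"
  unfolding closed_derived_def using commutator_set_subset
  by (simp_all add: closed_generate_subgroup closed_generate_closed closed_generate_incl)

lemma GD_topological: "topological_group GD (subtopology T D)"
  using D_subgroup by (rule subgroup_topological_group)

lemma GD_compact: "compact_space (subtopology T D)"
  using compact D_closed by (simp add: closedin_compact_space compact_space_subtopology)

text \<open>A subgroup of \<open>D\<close> containing the relatively open
  \<open>N \<inter> D\<close> is the trace on \<open>D\<close> of a union of cosets of
  \<open>N\<close>.\<close>

lemma open_upper_central:
  assumes N: "N \<lhd> G" "openin T N" "N \<inter> D \<subseteq> hyper G D D {\<one>} m"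
  shows "\<exists>m>0. openin (subtopology T D) (upper_central GD m)"
proof -
  interpret GD: topological_group GD "subtopology T D" by (rule GD_topological)
  have Ns: "subgroup N G" using N normal_imp_subgroup by blast
  \<comment> \<open>Raising the index by one makes it positive.\<close>
  let ?Z = "upper_central GD (Suc m)"
  have Zeq: "upper_central GD i = hyper G D D {\<one>} i" for i using upper_central_subgroup[OF D_subgroup] .
  have "upper_central GD m \<subseteq> ?Z"
    unfolding GD.upper_central_eq using GD.uc_mono[of m "Suc m"] by simp
  then have NZ: "N \<inter> D \<subseteq> ?Z" using N(3) Zeq by blast
  have ZsG: "subgroup ?Z GD" using GD.upper_central_eq GD.uc_normal normal_imp_subgroup by metis
  then have Zs: "subgroup ?Z G" using incl_subgroup[OF D_subgroup] by blast
  have ZD: "?Z \<subseteq> D" using subgroup.subset[OF ZsG] by simp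
  have Zc: "z \<in> carrier G" if "z \<in> ?Z" for z using that ZD subgroup.subset[OF D_subgroup] by blast
  have "?Z = (\<Union>z\<in>?Z. N #> z) \<inter> D"
  proof (rule subset_antisym; rule subsetI)
    fix z assume z: "z \<in> ?Z"
    then show "z \<in> (\<Union>z\<in>?Z. N #> z) \<inter> D" using rcos_self[OF Zc Ns] ZD by blast
  next
    fix g assume "g \<in> (\<Union>z\<in>?Z. N #> z) \<inter> D"
    then obtain z n where zn: "z \<in> ?Z" "n \<in> N" "g = n \<otimes> z" "g \<in> D" by (auto simp: r_coset_def)
    have nc: "n \<in> carrier G" using zn Ns subgroup.mem_carrier by metis
    have "g \<otimes> inv z = n" using zn(3) nc Zc[OF zn(1)] by (simp add: m_assoc)
    moreover have "z \<in> D" using zn(1) ZD by (rule subsetD[rotated])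
    ultimately have "n \<in> D"
      using subgroup.m_closed[OF D_subgroup zn(4) subgroup.m_inv_closed[OF D_subgroup]] by metis
    then have "n \<in> ?Z" using NZ zn by blast
    then show "g \<in> ?Z" using zn subgroup.m_closed[OF Zs] by simp
  qed
  moreover have "openin T (\<Union>z\<in>?Z. N #> z)" using openin_coset[OF Ns N(2)] Zc by blast
  ultimately have "openin (subtopology T D) ?Z" by (auto simp: openin_subtopology)
  then show ?thesis by blast
qed

lemma cover_imp_open:
  assumes "countable \<F>" "\<And>H. H \<in> \<F> \<Longrightarrow> subgroup H G \<and> nilpotent_group (G\<lparr>carrier := H\<rparr>)"
    and "commutator_set G \<subseteq> \<Union>\<F>"
  shows "\<exists>m>0. openin (subtopology T D) (upper_central GD m)"
proof -
  have "\<exists>k. H \<subseteq> hyper G (carrier G) H {\<one>} k" if "H \<in> \<F>" for H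
    using assms(2)[OF that] nilpotent_subgroup_iff by blast
  then obtain N m where N: "N \<lhd> G" "openin T N" "N \<subseteq> hyper G (carrier G) (commutator_set G) {\<one>} m"
    using countable_cover_imp_hypercentral[OF assms(1) _ _ assms(3)] assms(2) by blast
  have "nrm (commutator_set G) = carrier G"
    using commutator_set_cj nrm_subset by (auto intro!: nrmI)
  then have "N \<subseteq> hyper G (carrier G) D {\<one>} m"
    using N(3) hyper_closed_generate[OF commutator_set_subset _ closed_one] unfolding closed_derived_def by blast
  then have "N \<inter> D \<subseteq> hyper G D D {\<one>} m" using hyper_subgroup_restrict[OF D_subgroup] by blast
  then show ?thesis using open_upper_central N by blast
qed

lemma open_imp_finite_index:
  assumes "openin (subtopology T D) (upper_central GD m)"
  shows "finite (rcosets\<^bsub>GD\<^esub> (upper_central GD m))"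
proof -
  interpret GD: topological_group GD "subtopology T D" by (rule GD_topological)
  have "subgroup (upper_central GD m) GD" using GD.upper_central_eq GD.uc_normal normal_imp_subgroup by metis
  then show ?thesis using GD.open_subgroup_finite_index assms GD_compact by blast
qed

lemma open_imp_finite_by_nilpotent:
  assumes "openin (subtopology T D) (upper_central GD m)"
  shows "finite_by_nilpotent GD"
proof -
  interpret GD: topological_group GD "subtopology T D" by (rule GD_topological)
  show ?thesis
    using GD.finite_index_uc_imp_finite_by_nilpotent open_imp_finite_index[OF assms] by (simp only: GD.upper_central_eq)
qed

lemma open_imp_cover:
  assumes "openin (subtopology T D) (upper_central GD m)"
  shows "\<exists>\<F>. countable \<F> \<and> (\<forall>H\<in>\<F>. subgroup H G \<and> nilpotent_group (G\<lparr>carrier := H\<rparr>)) \<and> commutator_set G \<subseteq> \<Union>\<F>"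
proof -
  interpret GD: topological_group GD "subtopology T D" by (rule GD_topological)
  obtain \<F> where F: "finite \<F>" "\<And>H. H \<in> \<F> \<Longrightarrow> subgroup H GD \<and> nilpotent_group (GD\<lparr>carrier := H\<rparr>)" "carrier GD \<subseteq> \<Union>\<F>"
    using GD.finite_index_uc_nilpotent_cover open_imp_finite_index[OF assms] unfolding GD.upper_central_eq by metis
  have "subgroup H G \<and> nilpotent_group (G\<lparr>carrier := H\<rparr>)" if "H \<in> \<F>" for H
    using F(2)[OF that] incl_subgroup[OF D_subgroup] by simp
  moreover have "commutator_set G \<subseteq> \<Union>\<F>" using F(3) commutator_D by simp
  ultimately show ?thesis using countable_finite[OF F(1)] by blast
qed

text \<open>Finite sets are closed in a Hausdorff space, so some open normal \<open>N\<close> meets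
  \<open>K\<close> at most in \<open>\<one>\<close>. Commutators of elements of \<open>N\<close>
  stay in \<open>N\<close>; for them, reaching \<open>K\<close> means reaching
  \<open>\<one>\<close>.\<close>

lemma finite_by_nilpotent_imp_open:
  assumes "finite_by_nilpotent GD"
  shows "\<exists>m>0. openin (subtopology T D) (upper_central GD m)"
proof -
  interpret GD: topological_group GD "subtopology T D" by (rule GD_topological)
  obtain K n where K: "K \<lhd> GD" "finite K" "D \<subseteq> hyper GD D D K n"
    using assms GD.finite_by_nilpotent_iff by auto
  have KD: "K \<subseteq> D" using subgroup.subset[OF normal_imp_subgroup[OF K(1)]] by simp
  then have Kc: "K \<subseteq> topspace T" using subgroup.subset[OF D_subgroup] by (simp add: topspace_eq)
  have "closedin T (K - {\<one>})"
    using Kc K(2) closedin_Hausdorff_finite[OF Hausdorff, of "K - {\<one>}"] by auto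
  then have "openin T (carrier G - (K - {\<one>}))" by (metis openin_diff openin_topspace topspace_eq)
  then obtain N where N: "N \<lhd> G" "openin T N" "N \<subseteq> carrier G - (K - {\<one>})" using open_normal_subgroup by blast
  have "N \<inter> hyper GD D D K i \<subseteq> hyper G D D {\<one>} i" for i
  proof (induction i)
    case 0
    then show ?case using N by auto
  next
    case (Suc i)
    have "cm a d \<in> hyper G D D {\<one>} i" if a: "a \<in> N" "a \<in> hyper GD D D K (Suc i)" and d: "d \<in> D" for a d
    proof -
      have "cm a d \<in> N" using normal_cm_left[OF N(1) _ a(1)] d subgroup.mem_carrier[OF D_subgroup] by blast
      moreover have "GD.cm a d \<in> hyper GD D D K i" using a(2) d by simp
      moreover have "GD.cm a d = cm a d" using a(2) d subgroup_commutator[OF D_subgroup] by simp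
      ultimately show ?thesis using Suc by auto
    qed
    then show ?case by auto
  qed
  then have "N \<inter> D \<subseteq> hyper G D D {\<one>} n" using K(3) by blast
  then show ?thesis using open_upper_central N by blast
qed

end

theorem theorem1p3:
  fixes G :: "('a, 'b) monoid_scheme" and T :: "'a topology"
  assumes "profinite_group G T"
  shows "let D = G\<lparr>carrier := closed_derived G T\<rparr> in
    ((\<exists>\<F>. countable \<F> \<and>
        (\<forall>H \<in> \<F>. subgroup H G \<and> nilpotent_group (G\<lparr>carrier := H\<rparr>)) \<and>
        commutator_set G \<subseteq> \<Union>\<F>)
      \<longleftrightarrow> finite_by_nilpotent D) \<and>
    (finite_by_nilpotent D
      \<longleftrightarrow> (\<exists>m > 0. openin (subtopology T (carrier D)) (upper_central D m)))"
proof -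
  interpret profinite_group G T by fact
  let ?cover = "\<exists>\<F>. countable \<F> \<and> (\<forall>H \<in> \<F>. subgroup H G \<and> nilpotent_group (G\<lparr>carrier := H\<rparr>)) \<and>
    commutator_set G \<subseteq> \<Union>\<F>"
  let ?open = "\<exists>m > 0. openin (subtopology T D) (upper_central GD m)"
  have "?cover \<longrightarrow> ?open" using cover_imp_open by blast
  moreover have "?open \<longrightarrow> ?cover" using open_imp_cover by blast
  moreover have "?open \<longleftrightarrow> finite_by_nilpotent GD"
    using open_imp_finite_by_nilpotent finite_by_nilpotent_imp_open by blast
  moreover have cGD: "carrier GD = D" by simp
  ultimately show ?thesis unfolding Let_def cGD by argo
qed

end
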